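(* Let $k\in\mathbb{N}$ and $i_1,\ldots,i_k\in\{1,\ldots,m\}$. Suppose that every $\psi_l(\tau)$ $(l=1,\ldots,k)$ is a continuous nonrandom function on $[t,T]$ and $\{\phi_j(x)\}_{j=0}^{\infty}$ is a complete orthonormal system of continuous functions in the space $L_2([t,T])$. Then $$\mathsf{M}\left\{\left(J[\psi^{(k)}]_{T,t}-J[\psi^{(k)}]_{T,t}^p\right)^2\right\}=\int_{[t,T]^k}K^2(t_1,\ldots,t_k)\,dt_1\ldots dt_k$$ $$-\sum_{j_1=0}^{p}\ldots\sum_{j_k=0}^{p}C_{j_k\ldots j_1}\,\mathsf{M}\left\{J[\psi^{(k)}]_{T,t}\sum_{(j_1,\ldots,j_k)}\int_t^T\phi_{j_k}(t_k)\ldots\int_t^{t_2}\phi_{j_1}(t_1)\,d\mathbf{f}_{t_1}^{(i_1)}\ldots d\mathbf{f}_{t_k}^{(i_k)}\right\},$$ where $$J[\psi^{(k)}]_{T,t}=\int_t^T\psi_k(t_k)\ldots\int_t^{t_2}\psi_1(t_1)\,d\mathbf{f}_{t_1}^{(i_1)}\ldots d\mathbf{f}_{t_k}^{(i_k)},$$ $$J[\psi^{(k)}]_{T,t}^p=\sum_{j_1=0}^{p}\ldots\sum_{j_k=0}^{p}C_{j_k\ldots j_1}\left(\prod_{l=1}^k\zeta_{j_l}^{(i_l)}-S_{j_1,\ldots,j_k}^{(i_1\ldots i_k)}\right),$$ $$S_{j_1,\ldots,j_k}^{(i_1\ldots i_k)}=\mathop{\mathrm{l.i.m.}}_{N\to\infty}\sum_{(l_1,\ldots,l_k)\in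 \mathrm{G}_k}\phi_{j_1}(\tau_{l_1})\Delta\mathbf{f}_{\tau_{l_1}}^{(i_1)}\ldots\phi_{j_k}(\tau_{l_k})\Delta\mathbf{f}_{\tau_{l_k}}^{(i_k)},$$ $\zeta_j^{(i)}=\int_t^T\phi_j(s)\,d\mathbf{f}_s^{(i)}$ are independent standard Gaussian random variables for various $i$ or $j$ $(i=1,\ldots,m)$, and $\sum_{(j_1,\ldots,j_k)}$ means the sum over all possible permutations of $(j_1,\ldots,j_k)$, where whenever $j_r$ is swapped with $j_q$ in $(j_1,\ldots,j_k)$, also $i_r$ is swapped with $i_q$ in $(i_1,\ldots,i_k)$.
   Context: Setting: $(\Omega,\mathrm{F},\mathsf{P})$ is a complete probability space with a nondecreasing right-continuous family $\{\mathrm{F}_s\}_{s\in[0,T]}$ of sub-$\sigma$-fields, and $\mathbf{f}_s=(\mathbf{f}_s^{(1)},\ldots,\mathbf{f}_s^{(m)})$ is a standard $m$-dimensional Wiener process, $\mathrm{F}_s$-measurable for every $s\in[0,T]$, with independent components. $0\le t<T$. $\mathsf{M}$ denotes expectation; iterated stochastic integrals are Ito integrals; l.i.m. is the limit in the mean-square sense. Kernel: $K(t_1,\ldots,t_k)=\psi_1(t_1)\cdots\psi_k(t_k)$ if $t_1<\ldots<t_k$ and $K(t_1,\ldots,t_k)=0$ otherwise, for $t_1,\ldots,t_k\in[t,T]$, $k\ge2$; $K(t_1)=\psi_1(t_1)$ for $k=1$. Fourier coefficients: $C_{j_k\ldots j_1}=\int_{[t,T]^k}K(t_1,\ldots,t_k)\prod_{l=1}^k\phi_{j_l}(t_l)\,dt_1\ldots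 dt_k$. Partition: $t=\tau_0<\ldots<\tau_N=T$ with $\max_{0\le j\le N-1}(\tau_{j+1}-\tau_j)\to0$ as $N\to\infty$; $\Delta\mathbf{f}_{\tau_j}^{(i)}=\mathbf{f}_{\tau_{j+1}}^{(i)}-\mathbf{f}_{\tau_j}^{(i)}$. Index sets: $\mathrm{G}_k=\mathrm{H}_k\setminus\mathrm{L}_k$, where $\mathrm{H}_k=\{(l_1,\ldots,l_k): l_1,\ldots,l_k=0,1,\ldots,N-1\}$ and $\mathrm{L}_k=\{(l_1,\ldots,l_k)\in\mathrm{H}_k: l_g\ne l_r\ \text{for } g\ne r;\ g,r=1,\ldots,k\}$. Permutation sum: explicitly, with $\mathfrak{S}_k$ the set of all $k!$ permutations of $\{1,\ldots,k\}$, $\sum_{(j_1,\ldots,j_k)}\int_t^T\phi_{j_k}(t_k)\ldots\int_t^{t_2}\phi_{j_1}(t_1)\,d\mathbf{f}_{t_1}^{(i_1)}\ldots d\mathbf{f}_{t_k}^{(i_k)}=\sum_{\sigma\in\mathfrak{S}_k}\int_t^T\phi_{j_{\sigma(k)}}(t_k)\ldots\int_t^{t_2}\phi_{j_{\sigma(1)}}(t_1)\,d\mathbf{f}_{t_1}^{(i_{\sigma(1)})}\ldots d\mathbf{f}_{t_k}^{(i_{\sigma(k)})}$ (all $k!$ permutations are counted, even if some $j$'s coincide). $p$ is a nonnegative integer. *)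

theory Defs
  imports "HOL-Probability.Probability" "HOL-Combinatorics.Permutations"
begin

section \<open>Filtered probability spaces and Wiener processes\<close>

locale filtered_prob_space = prob_space M + complete_measure M
  for M :: "'a measure" +
  fixes F :: "real \<Rightarrow> 'a measure" and T :: real
  assumes subalg: "s \<in> {0..T} \<Longrightarrow> subalgebra M (F s)"
    and filt_mono: "0 \<le> s \<Longrightarrow> s \<le> u \<Longrightarrow> u \<le> T \<Longrightarrow> sets (F s) \<subseteq> sets (F u)"
    and filt_right_cont: "s \<in> {0..<T} \<Longrightarrow> sets (F s) = (\<Inter>u\<in>{s<..T}. sets (F u))"

text \<open>
  \<open>f i s \<omega>\<close> is the value of component \<open>i \<in> {1..m}\<close> at time \<open>s\<close>. It is a Wiener process with
  respect to the filtration: the vector of increments after time \<open>s\<close> is independent of \<open>F s\<close>.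
  In \<open>indep_components\<close> every component is regarded as a random element of the product
  space of real functions on \<open>{0..T}\<close>, so that whole trajectories are independent.
\<close>

locale wiener_process = filtered_prob_space M F T
  for M :: "'a measure" and F :: "real \<Rightarrow> 'a measure" and T :: real +
  fixes m :: nat and f :: "nat \<Rightarrow> real \<Rightarrow> 'a \<Rightarrow> real"
  assumes adapted: "i \<in> {1..m} \<Longrightarrow> s \<in> {0..T} \<Longrightarrow> f i s \<in> borel_measurable (F s)"
    and start: "i \<in> {1..m} \<Longrightarrow> AE \<omega> in M. f i 0 \<omega> = 0"
    and cont_paths: "i \<in> {1..m} \<Longrightarrow> AE \<omega> in M. continuous_on {0..T} (\<lambda>s. f i s \<omega>)"
    and gaussian_increments: "i \<in> {1..m} \<Longrightarrow> 0 \<le> s \<Longrightarrow> s < u \<Longrightarrow> u \<le> T \<Longrightarrow>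
      distributed M lborel (\<lambda>\<omega>. f i u \<omega> - f i s \<omega>) (normal_density 0 (sqrt (u - s)))"
    and indep_increments: "0 \<le> s \<Longrightarrow> s < u \<Longrightarrow> u \<le> T \<Longrightarrow>
      indep_set (sets (F s))
        {(\<lambda>\<omega>. \<lambda>i\<in>{1..m}. f i u \<omega> - f i s \<omega>) -` A \<inter> space M | A.
           A \<in> sets (\<Pi>\<^sub>M i\<in>{1..m}. (borel :: real measure))}"
    and indep_components: "indep_vars (\<lambda>_. \<Pi>\<^sub>M s\<in>{0..T}. (borel :: real measure))
      (\<lambda>i \<omega>. \<lambda>s\<in>{0..T}. f i s \<omega>) {1..m}"


section \<open>Mean-square limits\<close>

definition has_ms_limit :: "'a measure \<Rightarrow> (nat \<Rightarrow> 'a \<Rightarrow> real) \<Rightarrow> ('a \<Rightarrow> real) \<Rightarrow> bool" where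
  "has_ms_limit M X Y \<longleftrightarrow>
     (\<forall>n. X n \<in> borel_measurable M) \<and> Y \<in> borel_measurable M \<and>
     (\<lambda>n. \<integral>\<^sup>+\<omega>. ennreal ((X n \<omega> - Y \<omega>)\<^sup>2) \<partial>M) \<longlonglongrightarrow> 0"

text \<open>Mean-square limits are unique up to null sets; one version is selected.\<close>

definition ms_lim :: "'a measure \<Rightarrow> (nat \<Rightarrow> 'a \<Rightarrow> real) \<Rightarrow> 'a \<Rightarrow> real" where
  "ms_lim M X = (SOME Y. has_ms_limit M X Y)"


section \<open>The Ito integral\<close>

definition partition_of :: "real \<Rightarrow> real \<Rightarrow> nat \<Rightarrow> (nat \<Rightarrow> real) \<Rightarrow> bool" where
  "partition_of a b n \<tau> \<longleftrightarrow> \<tau> 0 = a \<and> \<tau> n = b \<and> (\<forall>j<n. \<tau> j < \<tau> (Suc j))"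

text \<open>
  The triple \<open>n, \<tau>, X\<close> stands for the step process with value \<open>X j\<close> on
  \<open>{\<tau> j..<\<tau> (Suc j)}\<close>. The case \<open>n = 0\<close> occurs exactly when \<open>a = b\<close>.
\<close>

definition step_data ::
  "'a measure \<Rightarrow> (real \<Rightarrow> 'a measure) \<Rightarrow> real \<Rightarrow> real \<Rightarrow> nat \<Rightarrow> (nat \<Rightarrow> real) \<Rightarrow> (nat \<Rightarrow> 'a \<Rightarrow> real) \<Rightarrow> bool"
  where
  "step_data M F a b n \<tau> X \<longleftrightarrow> partition_of a b n \<tau> \<and>
     (\<forall>j<n. X j \<in> borel_measurable (F (\<tau> j)) \<and> integrable M (\<lambda>\<omega>. (X j \<omega>)\<^sup>2))"

definition step_process :: "nat \<Rightarrow> (nat \<Rightarrow> real) \<Rightarrow> (nat \<Rightarrow> 'a \<Rightarrow> real) \<Rightarrow> real \<Rightarrow> 'a \<Rightarrow> real" where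
  "step_process n \<tau> X s \<omega> = (\<Sum>j<n. X j \<omega> * indicator {\<tau> j..<\<tau> (Suc j)} s)"

definition step_integral ::
  "(real \<Rightarrow> 'a \<Rightarrow> real) \<Rightarrow> nat \<Rightarrow> (nat \<Rightarrow> real) \<Rightarrow> (nat \<Rightarrow> 'a \<Rightarrow> real) \<Rightarrow> 'a \<Rightarrow> real" where
  "step_integral w n \<tau> X \<omega> = (\<Sum>j<n. X j \<omega> * (w (\<tau> (Suc j)) \<omega> - w (\<tau> j) \<omega>))"

text \<open>
  \<open>I\<close> is a version of the Ito integral of \<open>\<xi>\<close> over \<open>{a..b}\<close> with respect to \<open>w\<close> if it is the
  mean-square limit of the integrals of step processes \<open>\<xi>\<^sub>N\<close> for which the integral over
  \<open>s \<in> {a..b}\<close> of the expectation of \<open>(\<xi>\<^sub>N(s) - \<xi>(s))\<^sup>2\<close> tends to 0. This criterion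
  depends on each \<open>\<xi> s\<close> only up to a null set of \<open>M\<close>. Hence measurability is required of
  the mean-square distance as a function of \<open>s\<close> and not of \<open>\<xi>\<close> jointly in \<open>(s, \<omega>)\<close>,
  and an integrand may itself be a family of arbitrarily selected versions of integrals.
\<close>

definition has_ito_integral ::
  "'a measure \<Rightarrow> (real \<Rightarrow> 'a measure) \<Rightarrow> (real \<Rightarrow> 'a \<Rightarrow> real) \<Rightarrow> real \<Rightarrow> real \<Rightarrow>
   (real \<Rightarrow> 'a \<Rightarrow> real) \<Rightarrow> ('a \<Rightarrow> real) \<Rightarrow> bool" where
  "has_ito_integral M F w a b \<xi> I \<longleftrightarrow>
     (\<forall>s\<in>{a..b}. \<xi> s \<in> borel_measurable (F s)) \<and>
     I \<in> borel_measurable (F b) \<and>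
     (\<exists>n \<tau> X.
        (\<forall>N. step_data M F a b (n N) (\<tau> N) (X N)) \<and>
        (\<forall>N. (\<lambda>s. \<integral>\<^sup>+\<omega>. ennreal ((step_process (n N) (\<tau> N) (X N) s \<omega> - \<xi> s \<omega>)\<^sup>2) \<partial>M)
               \<in> borel_measurable (restrict_space lborel {a..b})) \<and>
        (\<lambda>N. \<integral>\<^sup>+s. (\<integral>\<^sup>+\<omega>. ennreal ((step_process (n N) (\<tau> N) (X N) s \<omega> - \<xi> s \<omega>)\<^sup>2) \<partial>M)
               \<partial>restrict_space lborel {a..b}) \<longlonglongrightarrow> 0 \<and>
        has_ms_limit M (\<lambda>N. step_integral w (n N) (\<tau> N) (X N)) I)"

definition ito_integral ::
  "'a measure \<Rightarrow> (real \<Rightarrow> 'a measure) \<Rightarrow> (real \<Rightarrow> 'a \<Rightarrow> real) \<Rightarrow> real \<Rightarrow> real \<Rightarrow>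
   (real \<Rightarrow> 'a \<Rightarrow> real) \<Rightarrow> 'a \<Rightarrow> real" where
  "ito_integral M F w a b \<xi> = (SOME I. has_ito_integral M F w a b \<xi> I)"

text \<open>
  \<open>iterated_ito M F f t \<psi> i k s\<close> is the integral of \<open>\<psi> k t\<^sub>k \<cdots> \<psi> 1 t\<^sub>1\<close> over
  \<open>t \<le> t\<^sub>1 \<le> \<cdots> \<le> t\<^sub>k \<le> s\<close>, where \<open>t\<^sub>l\<close> is integrated with respect to \<open>f (i l)\<close>
  and \<open>t\<^sub>1\<close> is the innermost variable.
\<close>

primrec iterated_ito ::
  "'a measure \<Rightarrow> (real \<Rightarrow> 'a measure) \<Rightarrow> (nat \<Rightarrow> real \<Rightarrow> 'a \<Rightarrow> real) \<Rightarrow> real \<Rightarrow>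
   (nat \<Rightarrow> real \<Rightarrow> real) \<Rightarrow> (nat \<Rightarrow> nat) \<Rightarrow> nat \<Rightarrow> real \<Rightarrow> 'a \<Rightarrow> real" where
  "iterated_ito M F f t \<psi> i 0 = (\<lambda>s \<omega>. 1)"
| "iterated_ito M F f t \<psi> i (Suc k) = (\<lambda>s. ito_integral M F (f (i (Suc k))) t s
     (\<lambda>u \<omega>. \<psi> (Suc k) u * iterated_ito M F f t \<psi> i k u \<omega>))"


section \<open>Orthonormal systems, kernel and Fourier coefficients\<close>

definition in_L2 :: "real \<Rightarrow> real \<Rightarrow> (real \<Rightarrow> real) \<Rightarrow> bool" where
  "in_L2 a b g \<longleftrightarrow> set_borel_measurable lborel {a..b} g \<and>
     set_integrable lborel {a..b} (\<lambda>x. (g x)\<^sup>2)"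

definition complete_orthonormal_system :: "real \<Rightarrow> real \<Rightarrow> (nat \<Rightarrow> real \<Rightarrow> real) \<Rightarrow> bool" where
  "complete_orthonormal_system a b \<phi> \<longleftrightarrow>
     (\<forall>j. in_L2 a b (\<phi> j)) \<and>
     (\<forall>j l. (LINT x:{a..b}|lborel. \<phi> j x * \<phi> l x) = (if j = l then 1 else 0)) \<and>
     (\<forall>g. in_L2 a b g \<longrightarrow> (\<forall>j. (LINT x:{a..b}|lborel. g x * \<phi> j x) = 0) \<longrightarrow>
          (AE x in lborel. x \<in> {a..b} \<longrightarrow> g x = 0))"

text \<open>Points \<open>(t\<^sub>1, \<dots>, t\<^sub>k)\<close> and multi-indices are functions on \<open>{1..k}\<close>.\<close>

definition ordered_kernel :: "(nat \<Rightarrow> real \<Rightarrow> real) \<Rightarrow> nat \<Rightarrow> (nat \<Rightarrow> real) \<Rightarrow> real" where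
  "ordered_kernel \<psi> k x = (if strict_mono_on {1..k} x then \<Prod>l\<in>{1..k}. \<psi> l (x l) else 0)"

definition cube_integral :: "real \<Rightarrow> real \<Rightarrow> nat \<Rightarrow> ((nat \<Rightarrow> real) \<Rightarrow> real) \<Rightarrow> real" where
  "cube_integral a b k g = (LINT x:({1..k} \<rightarrow>\<^sub>E {a..b})|(\<Pi>\<^sub>M l\<in>{1..k}. lborel). g x)"

definition fourier_coeff ::
  "(nat \<Rightarrow> real \<Rightarrow> real) \<Rightarrow> (nat \<Rightarrow> real \<Rightarrow> real) \<Rightarrow> real \<Rightarrow> real \<Rightarrow> nat \<Rightarrow> (nat \<Rightarrow> nat) \<Rightarrow> real" where
  "fourier_coeff \<psi> \<phi> t T k j =
     cube_integral t T k (\<lambda>x. ordered_kernel \<psi> k x * (\<Prod>l\<in>{1..k}. \<phi> (j l) (x l)))"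


section \<open>The approximation of the iterated integral\<close>

definition zeta ::
  "'a measure \<Rightarrow> (real \<Rightarrow> 'a measure) \<Rightarrow> (nat \<Rightarrow> real \<Rightarrow> 'a \<Rightarrow> real) \<Rightarrow> real \<Rightarrow> real \<Rightarrow>
   (nat \<Rightarrow> real \<Rightarrow> real) \<Rightarrow> nat \<Rightarrow> nat \<Rightarrow> 'a \<Rightarrow> real" where
  "zeta M F f t T \<phi> i j = ito_integral M F (f i) t T (\<lambda>s \<omega>. \<phi> j s)"

definition H_set :: "nat \<Rightarrow> nat \<Rightarrow> (nat \<Rightarrow> nat) set" where
  "H_set k N = {1..k} \<rightarrow>\<^sub>E {..<N}"

definition L_set :: "nat \<Rightarrow> nat \<Rightarrow> (nat \<Rightarrow> nat) set" where
  "L_set k N = {l \<in> H_set k N. \<forall>g\<in>{1..k}. \<forall>r\<in>{1..k}. g \<noteq> r \<longrightarrow> l g \<noteq> l r}"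

definition G_set :: "nat \<Rightarrow> nat \<Rightarrow> (nat \<Rightarrow> nat) set" where
  "G_set k N = H_set k N - L_set k N"

text \<open>\<open>\<tau> N\<close> is the \<open>N\<close>-th partition; it has \<open>N\<close> subintervals.\<close>

definition S_term ::
  "'a measure \<Rightarrow> (nat \<Rightarrow> real \<Rightarrow> 'a \<Rightarrow> real) \<Rightarrow> (nat \<Rightarrow> real \<Rightarrow> real) \<Rightarrow> (nat \<Rightarrow> nat \<Rightarrow> real) \<Rightarrow>
   nat \<Rightarrow> (nat \<Rightarrow> nat) \<Rightarrow> (nat \<Rightarrow> nat) \<Rightarrow> 'a \<Rightarrow> real" where
  "S_term M f \<phi> \<tau> k i j = ms_lim M (\<lambda>N \<omega>. \<Sum>l\<in>G_set k N. \<Prod>q\<in>{1..k}.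
     \<phi> (j q) (\<tau> N (l q)) * (f (i q) (\<tau> N (Suc (l q))) \<omega> - f (i q) (\<tau> N (l q)) \<omega>))"

definition J_approx ::
  "'a measure \<Rightarrow> (real \<Rightarrow> 'a measure) \<Rightarrow> (nat \<Rightarrow> real \<Rightarrow> 'a \<Rightarrow> real) \<Rightarrow> real \<Rightarrow> real \<Rightarrow>
   (nat \<Rightarrow> real \<Rightarrow> real) \<Rightarrow> (nat \<Rightarrow> real \<Rightarrow> real) \<Rightarrow> (nat \<Rightarrow> nat \<Rightarrow> real) \<Rightarrow>
   nat \<Rightarrow> (nat \<Rightarrow> nat) \<Rightarrow> nat \<Rightarrow> 'a \<Rightarrow> real" where
  "J_approx M F f t T \<psi> \<phi> \<tau> k i p \<omega> =
     (\<Sum>j\<in>{1..k} \<rightarrow>\<^sub>E {0..p}. fourier_coeff \<psi> \<phi> t T k j *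
        ((\<Prod>l\<in>{1..k}. zeta M F f t T \<phi> (i l) (j l) \<omega>) - S_term M f \<phi> \<tau> k i j \<omega>))"

text \<open>A permutation \<open>\<sigma>\<close> acts simultaneously on the indices \<open>j\<close> and \<open>i\<close>.\<close>

definition perm_sum ::
  "'a measure \<Rightarrow> (real \<Rightarrow> 'a measure) \<Rightarrow> (nat \<Rightarrow> real \<Rightarrow> 'a \<Rightarrow> real) \<Rightarrow> real \<Rightarrow> real \<Rightarrow>
   (nat \<Rightarrow> real \<Rightarrow> real) \<Rightarrow> nat \<Rightarrow> (nat \<Rightarrow> nat) \<Rightarrow> (nat \<Rightarrow> nat) \<Rightarrow> 'a \<Rightarrow> real" where
  "perm_sum M F f t T \<phi> k i j \<omega> = (\<Sum>\<sigma> | \<sigma> permutes {1..k}.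
     iterated_ito M F f t (\<lambda>l. \<phi> (j (\<sigma> l))) (\<lambda>l. i (\<sigma> l)) k T \<omega>)"

end

theory Submission
  imports Defs "HOL-Combinatorics.Multiset_Permutations"
begin

text \<open>
  Write \<open>D\<^sub>j\<close> for the permutation sum attached to the multi-index \<open>j\<close>. Splitting the multi-indices
  of a Riemann sum into those with distinct entries and the rest shows that
  \<open>\<Prod>\<zeta> - S = D\<^sub>j\<close> almost surely, so \<open>J\<^sup>p = \<Sum> C\<^sub>j D\<^sub>j\<close>. Iterated integrals whose component indices
  differ are orthogonal, and otherwise their inner product is an integral over a simplex. With
  \<open>G\<close> the group of permutations fixing the component indices this gives
  \<open>E (J D\<^sub>j) = \<Sum>\<rho>\<in>G. C\<^bsub>j\<circ>\<rho>\<^esub>\<close>, and, because the simplices obtained by permuting coordinates fill the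
  cube, \<open>E (D\<^sub>j D\<^sub>j\<^sub>') = card {\<rho>\<in>G. j = j' \<circ> \<rho>}\<close>. Hence \<open>E ((J\<^sup>p)\<^sup>2) = E (J J\<^sup>p)\<close>, and expanding the square
  yields the formula. The variables \<open>\<zeta>\<close> are handled through the joint characteristic function of
  Riemann sums, which factorizes over disjoint increments.
\<close>

section \<open>Square-integrable random variables\<close>

text \<open>Both \<open>ito_integral\<close> and \<open>ms_lim\<close> are versions picked by
  choice, and integrands need not be jointly measurable in time and \<omega>, so pathwise arguments
  and Fubini are not at hand. Everything is done in mean square: the isometry is proved for step
  processes, and a chosen version is reached through an inequality with a harmless constant. All
  integrands are adapted and uniformly continuous in mean square; this class is closed under
  integration and under multiplication by continuous functions, and on it every sampling with
  vanishing mesh yields the integral. More than second moments are needed where a product of Riemann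
  sums converges to the product of the \<zeta>, since mean-square convergence does not survive
  multiplication. The characteristic function shows each Riemann sum to be exactly normal with
  bounded variance, so all its moments are bounded; it also gives law and independence of the
  \<zeta>. \<open>E ((J\<^sup>p)\<^sup>2) = E (J J\<^sup>p)\<close> holds for each finite
  \<open>p\<close>: the multi-indices with entries up to \<open>p\<close> are closed under
  permutation of their entries.\<close>

definition sq_integrable :: "'a measure \<Rightarrow> ('a \<Rightarrow> real) \<Rightarrow> bool" where
  "sq_integrable M X \<longleftrightarrow> X \<in> borel_measurable M \<and> integrable M (\<lambda>\<omega>. (X \<omega>)\<^sup>2)"

lemma sq_integrable_measurable: "sq_integrable M X \<Longrightarrow> X \<in> borel_measurable M"
  by (simp add: sq_integrable_def)

lemma sq_integrable_mult:
  assumes "sq_integrable M X" "sq_integrable M Y"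
  shows "integrable M (\<lambda>\<omega>. X \<omega> * Y \<omega>)"
proof (rule Bochner_Integration.integrable_bound)
  show "integrable M (\<lambda>\<omega>. (X \<omega>)\<^sup>2 + (Y \<omega>)\<^sup>2)"
    using assms by (auto simp: sq_integrable_def)
  show "(\<lambda>\<omega>. X \<omega> * Y \<omega>) \<in> borel_measurable M"
    using assms by (auto simp: sq_integrable_def)
  have "\<bar>x * y\<bar> \<le> x\<^sup>2 + y\<^sup>2" for x y :: real
  proof -
    have "2 * (\<bar>x\<bar> * \<bar>y\<bar>) \<le> x\<^sup>2 + y\<^sup>2"
      using sum_squares_bound[of "\<bar>x\<bar>" "\<bar>y\<bar>"] by simp
    moreover have "0 \<le> \<bar>x\<bar> * \<bar>y\<bar>" by simp
    ultimately show ?thesis unfolding abs_mult by linarith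
  qed
  then show "AE \<omega> in M. norm (X \<omega> * Y \<omega>) \<le> norm ((X \<omega>)\<^sup>2 + (Y \<omega>)\<^sup>2)"
    by auto
qed

lemma sq_integrable_cmult: "sq_integrable M X \<Longrightarrow> sq_integrable M (\<lambda>\<omega>. c * X \<omega>)"
  by (auto simp: sq_integrable_def power_mult_distrib)

lemma sq_integrable_multc: "sq_integrable M X \<Longrightarrow> sq_integrable M (\<lambda>\<omega>. X \<omega> * c)"
  by (auto simp: sq_integrable_def power_mult_distrib)

lemma sq_integrable_add:
  assumes "sq_integrable M X" "sq_integrable M Y"
  shows "sq_integrable M (\<lambda>\<omega>. X \<omega> + Y \<omega>)"
proof -
  have "integrable M (\<lambda>\<omega>. (X \<omega>)\<^sup>2 + (Y \<omega>)\<^sup>2 + 2 * (X \<omega> * Y \<omega>))"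
    using assms sq_integrable_mult[OF assms] by (auto simp: sq_integrable_def)
  also have "(\<lambda>\<omega>. (X \<omega>)\<^sup>2 + (Y \<omega>)\<^sup>2 + 2 * (X \<omega> * Y \<omega>)) = (\<lambda>\<omega>. (X \<omega> + Y \<omega>)\<^sup>2)"
    by (simp add: power2_sum mult.assoc)
  finally show ?thesis using assms by (auto simp: sq_integrable_def)
qed

lemma sq_integrable_diff:
  assumes "sq_integrable M X" "sq_integrable M Y"
  shows "sq_integrable M (\<lambda>\<omega>. X \<omega> - Y \<omega>)"
  using sq_integrable_add[OF assms(1) sq_integrable_cmult[OF assms(2), of "-1"]] by simp

lemma sq_integrable_zero: "sq_integrable M (\<lambda>\<omega>. 0)"
  by (simp add: sq_integrable_def)

lemma sq_integrable_sum:
  "(\<And>k. k \<in> K \<Longrightarrow> sq_integrable M (X k)) \<Longrightarrow> sq_integrable M (\<lambda>\<omega>. \<Sum>k\<in>K. X k \<omega>)"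
  by (induction K rule: infinite_finite_induct) (auto simp: sq_integrable_zero intro!: sq_integrable_add)

text \<open>The second moment of \<open>X - c * Y\<close> is a quadratic in \<open>c\<close> that is
  never negative, so its discriminant is not positive.\<close>

lemma Cauchy_Schwarz_integral:
  assumes X: "sq_integrable M X" and Y: "sq_integrable M Y"
  shows "(\<integral>\<omega>. X \<omega> * Y \<omega> \<partial>M)\<^sup>2 \<le> (\<integral>\<omega>. (X \<omega>)\<^sup>2 \<partial>M) * (\<integral>\<omega>. (Y \<omega>)\<^sup>2 \<partial>M)"
proof -
  define A B D where "A = (\<integral>\<omega>. (X \<omega>)\<^sup>2 \<partial>M)" and "B = (\<integral>\<omega>. X \<omega> * Y \<omega> \<partial>M)"
    and "D = (\<integral>\<omega>. (Y \<omega>)\<^sup>2 \<partial>M)"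
  have quad: "0 \<le> A - 2 * c * B + c\<^sup>2 * D" for c
  proof -
    have "(\<integral>\<omega>. (X \<omega> - c * Y \<omega>)\<^sup>2 \<partial>M) = (\<integral>\<omega>. (X \<omega>)\<^sup>2 - (2 * c) * (X \<omega> * Y \<omega>) + c\<^sup>2 * (Y \<omega>)\<^sup>2 \<partial>M)"
      by (intro Bochner_Integration.integral_cong) (auto simp: power2_eq_square algebra_simps)
    also have "\<dots> = A - (2 * c) * B + c\<^sup>2 * D"
      using X Y sq_integrable_mult[OF X Y] by (simp add: sq_integrable_def A_def B_def D_def)
    finally have "(\<integral>\<omega>. (X \<omega> - c * Y \<omega>)\<^sup>2 \<partial>M) = A - 2 * c * B + c\<^sup>2 * D" .
    moreover have "0 \<le> (\<integral>\<omega>. (X \<omega> - c * Y \<omega>)\<^sup>2 \<partial>M)" by simp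
    ultimately show ?thesis by linarith
  qed
  have "D \<ge> 0" unfolding D_def by simp
  show ?thesis
  proof (cases "D = 0")
    case True
    have "B = 0"
    proof (rule ccontr)
      assume "B \<noteq> 0"
      \<comment> \<open>With \<open>D = 0\<close> the quadratic is affine in \<open>c\<close>; this
        \<open>c\<close> gives it the value \<open>-1\<close>.\<close>
      then have "2 * ((A + 1) / (2 * B)) * B = A + 1" by simp
      with quad[of "(A + 1) / (2 * B)"] True show False by simp
    qed
    then show ?thesis using True by (simp add: A_def B_def D_def)
  next
    case False
    with \<open>D \<ge> 0\<close> have "D > 0" by simp
    have "0 \<le> A - 2 * (B / D) * B + (B / D)\<^sup>2 * D" by (rule quad)
    also have "\<dots> = A - B\<^sup>2 / D" using \<open>D > 0\<close> by (simp add: field_simps power2_eq_square)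
    finally have "B\<^sup>2 / D \<le> A" by simp
    then have "B\<^sup>2 \<le> A * D" using \<open>D > 0\<close> by (simp add: pos_divide_le_eq)
    then show ?thesis by (simp add: A_def B_def D_def)
  qed
qed

lemma nn_integral_sq:
  "sq_integrable M X \<Longrightarrow> (\<integral>\<^sup>+\<omega>. ennreal ((X \<omega>)\<^sup>2) \<partial>M) = ennreal (\<integral>\<omega>. (X \<omega>)\<^sup>2 \<partial>M)"
  by (intro nn_integral_eq_integral) (auto simp: sq_integrable_def)

lemma sq_integrableI_nn:
  assumes "X \<in> borel_measurable M" "(\<integral>\<^sup>+\<omega>. ennreal ((X \<omega>)\<^sup>2) \<partial>M) < \<infinity>"
  shows "sq_integrable M X"
  using assms by (auto simp: sq_integrable_def intro!: integrableI_bounded)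

text \<open>Replaces the triangle inequality of the mean-square norm, so that no roots occur. The
  constants 2, 4, 8 and 16 in later estimates come from repeated use of it.\<close>

lemma square_add_le: "((x::real) + y)\<^sup>2 \<le> 2 * x\<^sup>2 + 2 * y\<^sup>2"
  using sum_squares_bound[of x y] by (simp add: power2_sum)

lemma square_diff_le: "((x::real) - z)\<^sup>2 \<le> 2 * (x - y)\<^sup>2 + 2 * (y - z)\<^sup>2"
  using square_add_le[of "x - y" "y - z"] by simp

text \<open>The version with nonnegative integrals applies to variables not yet known to be square
  integrable, such as a candidate limit.\<close>

lemma nn_integral_square_diff_le:
  fixes X Y Z :: "'a \<Rightarrow> real"
  assumes [measurable]: "X \<in> borel_measurable M" "Y \<in> borel_measurable M" "Z \<in> borel_measurable M"
  shows "(\<integral>\<^sup>+\<omega>. ennreal ((X \<omega> - Z \<omega>)\<^sup>2) \<partial>M) \<le>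
    2 * (\<integral>\<^sup>+\<omega>. ennreal ((X \<omega> - Y \<omega>)\<^sup>2) \<partial>M) + 2 * (\<integral>\<^sup>+\<omega>. ennreal ((Y \<omega> - Z \<omega>)\<^sup>2) \<partial>M)"
proof -
  have "(\<integral>\<^sup>+\<omega>. ennreal ((X \<omega> - Z \<omega>)\<^sup>2) \<partial>M)
      \<le> (\<integral>\<^sup>+\<omega>. 2 * ennreal ((X \<omega> - Y \<omega>)\<^sup>2) + 2 * ennreal ((Y \<omega> - Z \<omega>)\<^sup>2) \<partial>M)"
  proof (rule nn_integral_mono)
    fix \<omega>
    have "ennreal ((X \<omega> - Z \<omega>)\<^sup>2) \<le> ennreal (2 * (X \<omega> - Y \<omega>)\<^sup>2 + 2 * (Y \<omega> - Z \<omega>)\<^sup>2)"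
      by (rule ennreal_leI) (rule square_diff_le)
    then show "ennreal ((X \<omega> - Z \<omega>)\<^sup>2) \<le> 2 * ennreal ((X \<omega> - Y \<omega>)\<^sup>2) + 2 * ennreal ((Y \<omega> - Z \<omega>)\<^sup>2)"
      by (simp add: ennreal_mult)
  qed
  also have "\<dots> = 2 * (\<integral>\<^sup>+\<omega>. ennreal ((X \<omega> - Y \<omega>)\<^sup>2) \<partial>M) + 2 * (\<integral>\<^sup>+\<omega>. ennreal ((Y \<omega> - Z \<omega>)\<^sup>2) \<partial>M)"
    by (simp add: nn_integral_add nn_integral_cmult)
  finally show ?thesis .
qed

lemma integral_square_diff_le:
  assumes "sq_integrable M X" "sq_integrable M Y" "sq_integrable M Z"
  shows "(\<integral>\<omega>. (X \<omega> - Z \<omega>)\<^sup>2 \<partial>M) \<le> 2 * (\<integral>\<omega>. (X \<omega> - Y \<omega>)\<^sup>2 \<partial>M) + 2 * (\<integral>\<omega>. (Y \<omega> - Z \<omega>)\<^sup>2 \<partial>M)"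
proof -
  note d = sq_integrable_diff[OF assms(1,3)] sq_integrable_diff[OF assms(1,2)] sq_integrable_diff[OF assms(2,3)]
  have "(\<integral>\<omega>. (X \<omega> - Z \<omega>)\<^sup>2 \<partial>M) \<le> (\<integral>\<omega>. 2 * (X \<omega> - Y \<omega>)\<^sup>2 + 2 * (Y \<omega> - Z \<omega>)\<^sup>2 \<partial>M)"
    by (rule integral_mono) (use d in \<open>auto simp: sq_integrable_def intro: square_diff_le\<close>)
  also have "\<dots> = 2 * (\<integral>\<omega>. (X \<omega> - Y \<omega>)\<^sup>2 \<partial>M) + 2 * (\<integral>\<omega>. (Y \<omega> - Z \<omega>)\<^sup>2 \<partial>M)"
    using d by (simp add: sq_integrable_def)
  finally show ?thesis .
qed

section \<open>Limits in mean square\<close>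

lemma has_ms_limit_sq_integrable:
  assumes "has_ms_limit M X Y" "\<And>n. sq_integrable M (X n)"
  shows "sq_integrable M Y"
proof -
  have m: "\<And>n. X n \<in> borel_measurable M" "Y \<in> borel_measurable M"
    using assms(1) by (auto simp: has_ms_limit_def)
  have "\<forall>\<^sub>F n in sequentially. (\<integral>\<^sup>+\<omega>. ennreal ((X n \<omega> - Y \<omega>)\<^sup>2) \<partial>M) < 1"
    using assms(1) by (intro order_tendstoD(2)[of _ 0]) (auto simp: has_ms_limit_def)
  then obtain n where n: "(\<integral>\<^sup>+\<omega>. ennreal ((X n \<omega> - Y \<omega>)\<^sup>2) \<partial>M) < 1"
    by (auto simp: eventually_sequentially)
  \<comment> \<open>One approximant at finite distance suffices: \<open>Y\<close> is that
    approximant minus a square-integrable difference.\<close>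
  have "sq_integrable M (\<lambda>\<omega>. X n \<omega> - Y \<omega>)"
    by (rule sq_integrableI_nn) (use m in \<open>auto intro: less_trans[OF n]\<close>)
  from sq_integrable_diff[OF assms(2)[of n] this] show ?thesis by simp
qed

lemma has_ms_limit_iff:
  assumes "\<And>n. sq_integrable M (X n)" "sq_integrable M Y"
  shows "has_ms_limit M X Y \<longleftrightarrow> (\<lambda>n. \<integral>\<omega>. (X n \<omega> - Y \<omega>)\<^sup>2 \<partial>M) \<longlonglongrightarrow> 0"
proof -
  have "(\<lambda>n. \<integral>\<^sup>+\<omega>. ennreal ((X n \<omega> - Y \<omega>)\<^sup>2) \<partial>M) = (\<lambda>n. ennreal (\<integral>\<omega>. (X n \<omega> - Y \<omega>)\<^sup>2 \<partial>M))"
    by (simp add: nn_integral_sq sq_integrable_diff assms)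
  then show ?thesis
    using assms unfolding has_ms_limit_def
    by (simp add: sq_integrable_measurable ennreal_tendsto_0_iff)
qed

lemma has_ms_limit_unique:
  assumes "has_ms_limit M X Y" "has_ms_limit M X Z"
  shows "AE \<omega> in M. Y \<omega> = Z \<omega>"
proof -
  have [measurable]: "\<And>n. X n \<in> borel_measurable M" "Y \<in> borel_measurable M" "Z \<in> borel_measurable M"
    using assms by (auto simp: has_ms_limit_def)
  have "(\<integral>\<^sup>+\<omega>. ennreal ((Y \<omega> - Z \<omega>)\<^sup>2) \<partial>M) \<le>
      2 * (\<integral>\<^sup>+\<omega>. ennreal ((X n \<omega> - Y \<omega>)\<^sup>2) \<partial>M) + 2 * (\<integral>\<^sup>+\<omega>. ennreal ((X n \<omega> - Z \<omega>)\<^sup>2) \<partial>M)" for n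
    using nn_integral_square_diff_le[of Y M "X n" Z] by (simp add: power2_commute)
  moreover have "(\<lambda>n. 2 * (\<integral>\<^sup>+\<omega>. ennreal ((X n \<omega> - Y \<omega>)\<^sup>2) \<partial>M) + 2 * (\<integral>\<^sup>+\<omega>. ennreal ((X n \<omega> - Z \<omega>)\<^sup>2) \<partial>M))
      \<longlonglongrightarrow> 2 * 0 + 2 * 0"
    using assms unfolding has_ms_limit_def by (intro tendsto_add ennreal_tendsto_cmult) auto
  ultimately have "(\<integral>\<^sup>+\<omega>. ennreal ((Y \<omega> - Z \<omega>)\<^sup>2) \<partial>M) \<le> 2 * 0 + 2 * 0"
    by (intro LIMSEQ_le_const) auto
  then have "(\<integral>\<^sup>+\<omega>. ennreal ((Y \<omega> - Z \<omega>)\<^sup>2) \<partial>M) = 0" by simp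
  then have "AE \<omega> in M. ennreal ((Y \<omega> - Z \<omega>)\<^sup>2) = 0"
    by (subst (asm) nn_integral_0_iff_AE) auto
  then show ?thesis by (auto simp: ennreal_eq_0_iff)
qed

lemma has_ms_limit_ms_lim: "has_ms_limit M X Y \<Longrightarrow> has_ms_limit M X (ms_lim M X)"
  unfolding ms_lim_def by (rule someI[of "has_ms_limit M X"])

text \<open>Continuity of the inner product. \<open>X n * Y n\<close> is expanded around the limits;
  each of the three correction terms contains a difference and is controlled by
  Cauchy-Schwarz.\<close>

lemma integral_mult_tendsto:
  assumes X: "\<And>n. sq_integrable M (X n)" "sq_integrable M X'"
      "(\<lambda>n. \<integral>\<omega>. (X n \<omega> - X' \<omega>)\<^sup>2 \<partial>M) \<longlonglongrightarrow> 0"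
    and Y: "\<And>n. sq_integrable M (Y n)" "sq_integrable M Y'"
      "(\<lambda>n. \<integral>\<omega>. (Y n \<omega> - Y' \<omega>)\<^sup>2 \<partial>M) \<longlonglongrightarrow> 0"
  shows "(\<lambda>n. \<integral>\<omega>. X n \<omega> * Y n \<omega> \<partial>M) \<longlonglongrightarrow> (\<integral>\<omega>. X' \<omega> * Y' \<omega> \<partial>M)"
proof -
  have cs: "(\<lambda>n. \<integral>\<omega>. U n \<omega> * V n \<omega> \<partial>M) \<longlonglongrightarrow> 0"
    if "\<And>n. sq_integrable M (U n)" "\<And>n. sq_integrable M (V n)"
      "(\<lambda>n. (\<integral>\<omega>. (U n \<omega>)\<^sup>2 \<partial>M) * (\<integral>\<omega>. (V n \<omega>)\<^sup>2 \<partial>M)) \<longlonglongrightarrow> 0" for U V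
  proof (rule tendsto_0_le[where K=1])
    have "(\<lambda>n. sqrt ((\<integral>\<omega>. (U n \<omega>)\<^sup>2 \<partial>M) * (\<integral>\<omega>. (V n \<omega>)\<^sup>2 \<partial>M))) \<longlonglongrightarrow> sqrt 0"
      by (intro tendsto_real_sqrt that)
    then show "(\<lambda>n. sqrt ((\<integral>\<omega>. (U n \<omega>)\<^sup>2 \<partial>M) * (\<integral>\<omega>. (V n \<omega>)\<^sup>2 \<partial>M))) \<longlonglongrightarrow> 0" by simp
    show "\<forall>\<^sub>F n in sequentially. norm (\<integral>\<omega>. U n \<omega> * V n \<omega> \<partial>M)
        \<le> norm (sqrt ((\<integral>\<omega>. (U n \<omega>)\<^sup>2 \<partial>M) * (\<integral>\<omega>. (V n \<omega>)\<^sup>2 \<partial>M))) * 1"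
      using Cauchy_Schwarz_integral[OF that(1,2)]
      by (auto intro!: always_eventually) (metis real_sqrt_abs real_sqrt_le_mono)
  qed
  have "(\<lambda>n. (\<integral>\<omega>. (X n \<omega> - X' \<omega>) * (Y n \<omega> - Y' \<omega>) \<partial>M) + (\<integral>\<omega>. X' \<omega> * (Y n \<omega> - Y' \<omega>) \<partial>M)
        + (\<integral>\<omega>. (X n \<omega> - X' \<omega>) * Y' \<omega> \<partial>M) + (\<integral>\<omega>. X' \<omega> * Y' \<omega> \<partial>M))
      \<longlonglongrightarrow> 0 + 0 + 0 + (\<integral>\<omega>. X' \<omega> * Y' \<omega> \<partial>M)"
    using tendsto_mult[OF X(3) Y(3)] tendsto_mult[OF X(3) tendsto_const[of "\<integral>\<omega>. (Y' \<omega>)\<^sup>2 \<partial>M"]]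
      tendsto_mult[OF tendsto_const[of "\<integral>\<omega>. (X' \<omega>)\<^sup>2 \<partial>M"] Y(3)]
    by (intro tendsto_add cs tendsto_const sq_integrable_diff X Y) auto
  moreover have "(\<integral>\<omega>. (X n \<omega> - X' \<omega>) * (Y n \<omega> - Y' \<omega>) \<partial>M) + (\<integral>\<omega>. X' \<omega> * (Y n \<omega> - Y' \<omega>) \<partial>M)
        + (\<integral>\<omega>. (X n \<omega> - X' \<omega>) * Y' \<omega> \<partial>M) + (\<integral>\<omega>. X' \<omega> * Y' \<omega> \<partial>M) = (\<integral>\<omega>. X n \<omega> * Y n \<omega> \<partial>M)" for n
  proof -
    have eq: "X n \<omega> * Y n \<omega> = (X n \<omega> - X' \<omega>) * (Y n \<omega> - Y' \<omega>) + X' \<omega> * (Y n \<omega> - Y' \<omega>)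
        + (X n \<omega> - X' \<omega>) * Y' \<omega> + X' \<omega> * Y' \<omega>" for \<omega>
      by (simp add: algebra_simps)
    note i = sq_integrable_mult[OF sq_integrable_diff[OF X(1)[of n] X(2)] sq_integrable_diff[OF Y(1)[of n] Y(2)]]
      sq_integrable_mult[OF X(2) sq_integrable_diff[OF Y(1)[of n] Y(2)]]
      sq_integrable_mult[OF sq_integrable_diff[OF X(1)[of n] X(2)] Y(2)] sq_integrable_mult[OF X(2) Y(2)]
    show ?thesis unfolding eq
      using i by (subst Bochner_Integration.integral_add; auto)+
  qed
  ultimately show ?thesis by simp
qed

section \<open>Completeness in mean square\<close>

lemma (in prob_space) abs_expectation_le_sq:
  assumes "sq_integrable M X"
  shows "expectation (\<lambda>\<omega>. \<bar>X \<omega>\<bar>) \<le> sqrt (expectation (\<lambda>\<omega>. (X \<omega>)\<^sup>2))" "integrable M X"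
proof -
  have 1: "sq_integrable M (\<lambda>\<omega>. 1)" by (simp add: sq_integrable_def)
  show "integrable M X" using sq_integrable_mult[OF assms 1] by simp
  have "sq_integrable M (\<lambda>\<omega>. \<bar>X \<omega>\<bar>)" using assms by (auto simp: sq_integrable_def)
  from Cauchy_Schwarz_integral[OF this 1]
  have "(expectation (\<lambda>\<omega>. \<bar>X \<omega>\<bar>))\<^sup>2 \<le> expectation (\<lambda>\<omega>. (X \<omega>)\<^sup>2)" by (simp add: prob_space)
  then show "expectation (\<lambda>\<omega>. \<bar>X \<omega>\<bar>) \<le> sqrt (expectation (\<lambda>\<omega>. (X \<omega>)\<^sup>2))"
    by (rule real_le_rsqrt)
qed

lemma (in prob_space) sq_integrable_const: "sq_integrable M (\<lambda>\<omega>. c)"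
  by (simp add: sq_integrable_def)

text \<open>The rate \<open>1/4\<close> for squares becomes \<open>1/2\<close> for first absolute
  moments, so the increments have summable expectations and almost surely form an absolutely
  convergent series.\<close>

lemma (in prob_space) AE_convergent_if_sq_summable:
  assumes sq: "\<And>n. sq_integrable M (X n)"
    and d: "\<And>k. expectation (\<lambda>\<omega>. (X (Suc k) \<omega> - X k \<omega>)\<^sup>2) \<le> (1/4)^k"
  shows "AE \<omega> in M. (\<lambda>k. X k \<omega>) \<longlonglongrightarrow> lim (\<lambda>k. X k \<omega>)"
proof -
  have [measurable]: "\<And>n. X n \<in> borel_measurable M" using sq by (rule sq_integrable_measurable)
  have E: "expectation (\<lambda>\<omega>. \<bar>X (Suc k) \<omega> - X k \<omega>\<bar>) \<le> (1/2)^k" for k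
  proof -
    have "expectation (\<lambda>\<omega>. \<bar>X (Suc k) \<omega> - X k \<omega>\<bar>) \<le> sqrt ((1/4)^k)"
      by (rule order_trans[OF abs_expectation_le_sq(1)[OF sq_integrable_diff[OF sq sq]]])
        (intro real_sqrt_le_mono d)
    also have "(1/4::real)^k = ((1/2)^k)\<^sup>2"
      by (simp add: power2_eq_square flip: power_mult_distrib)
    finally show ?thesis by simp
  qed
  have "(\<integral>\<^sup>+\<omega>. (\<Sum>k. ennreal \<bar>X (Suc k) \<omega> - X k \<omega>\<bar>) \<partial>M)
     = (\<Sum>k. \<integral>\<^sup>+\<omega>. ennreal \<bar>X (Suc k) \<omega> - X k \<omega>\<bar> \<partial>M)"
    by (rule nn_integral_suminf) simp
  also have "\<dots> \<le> (\<Sum>k. ennreal ((1/2)^k))"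
  proof (rule suminf_le)
    fix k
    have "(\<integral>\<^sup>+\<omega>. ennreal \<bar>X (Suc k) \<omega> - X k \<omega>\<bar> \<partial>M)
       = ennreal (expectation (\<lambda>\<omega>. \<bar>X (Suc k) \<omega> - X k \<omega>\<bar>))"
      by (rule nn_integral_eq_integral)
        (use abs_expectation_le_sq(2)[OF sq_integrable_diff[OF sq sq]] in auto)
    also have "\<dots> \<le> ennreal ((1/2)^k)" by (rule ennreal_leI) (rule E)
    finally show "(\<integral>\<^sup>+\<omega>. ennreal \<bar>X (Suc k) \<omega> - X k \<omega>\<bar> \<partial>M) \<le> ennreal ((1/2)^k)" .
  qed auto
  also have "\<dots> = ennreal (\<Sum>k. (1/2)^k)"
    by (rule suminf_ennreal2) (auto simp: summable_geometric)
  also have "\<dots> < \<infinity>" by simp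
  finally have "AE \<omega> in M. (\<Sum>k. ennreal \<bar>X (Suc k) \<omega> - X k \<omega>\<bar>) \<noteq> \<infinity>"
    by (intro nn_integral_PInf_AE) auto
  then show ?thesis
  proof eventually_elim
    case (elim \<omega>)
    have "summable (\<lambda>k. \<bar>X (Suc k) \<omega> - X k \<omega>\<bar>)"
      by (rule summable_suminf_not_top) (use elim in auto)
    then have "summable (\<lambda>k. X (Suc k) \<omega> - X k \<omega>)" by (rule summable_rabs_cancel)
    then have "convergent (\<lambda>n. \<Sum>k<n. X (Suc k) \<omega> - X k \<omega>)"
      by (simp add: summable_iff_convergent)
    then have "convergent (\<lambda>n. X n \<omega> - X 0 \<omega>)"
      by (simp only: sum_lessThan_telescope[of "\<lambda>k. X k \<omega>"])
    from convergent_add[OF this convergent_const[of "X 0 \<omega>"]]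
    have "convergent (\<lambda>n. X n \<omega>)" by simp
    then show ?case by (simp only: convergent_LIMSEQ_iff)
  qed
qed

text \<open>Fatou's lemma along an almost surely convergent sequence. It bounds the distance to
  \<open>Y\<close> before \<open>Y\<close> is known to be square integrable.\<close>

lemma (in prob_space) ms_Fatou:
  assumes X: "sq_integrable M X" and Z: "\<And>k. sq_integrable M (Z k)" and Y [measurable]: "Y \<in> borel_measurable M"
    and conv: "AE \<omega> in M. (\<lambda>k. Z k \<omega>) \<longlonglongrightarrow> Y \<omega>"
    and ev: "\<forall>\<^sub>F k in sequentially. expectation (\<lambda>\<omega>. (X \<omega> - Z k \<omega>)\<^sup>2) \<le> e"
  shows "(\<integral>\<^sup>+\<omega>. ennreal ((X \<omega> - Y \<omega>)\<^sup>2) \<partial>M) \<le> ennreal e"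
proof -
  note [measurable] = sq_integrable_measurable[OF X] sq_integrable_measurable[OF Z]
  have "(\<integral>\<^sup>+\<omega>. ennreal ((X \<omega> - Y \<omega>)\<^sup>2) \<partial>M)
      = (\<integral>\<^sup>+\<omega>. liminf (\<lambda>k. ennreal ((X \<omega> - Z k \<omega>)\<^sup>2)) \<partial>M)"
  proof (rule nn_integral_cong_AE)
    show "AE \<omega> in M. ennreal ((X \<omega> - Y \<omega>)\<^sup>2) = liminf (\<lambda>k. ennreal ((X \<omega> - Z k \<omega>)\<^sup>2))"
      using conv
    proof eventually_elim
      case (elim \<omega>)
      have "(\<lambda>k. ennreal ((X \<omega> - Z k \<omega>)\<^sup>2)) \<longlonglongrightarrow> ennreal ((X \<omega> - Y \<omega>)\<^sup>2)"
        by (intro tendsto_ennrealI tendsto_power tendsto_diff tendsto_const elim)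
      then show ?case by (intro lim_imp_Liminf[symmetric]) auto
    qed
  qed
  also have "\<dots> \<le> liminf (\<lambda>k. \<integral>\<^sup>+\<omega>. ennreal ((X \<omega> - Z k \<omega>)\<^sup>2) \<partial>M)"
    by (rule nn_integral_liminf) simp
  also have "\<dots> \<le> limsup (\<lambda>k. \<integral>\<^sup>+\<omega>. ennreal ((X \<omega> - Z k \<omega>)\<^sup>2) \<partial>M)"
    by (rule Liminf_le_Limsup) simp
  also have "\<dots> \<le> ennreal e"
  proof (rule Limsup_bounded)
    show "\<forall>\<^sub>F k in sequentially. (\<integral>\<^sup>+\<omega>. ennreal ((X \<omega> - Z k \<omega>)\<^sup>2) \<partial>M) \<le> ennreal e"
      using ev
      by eventually_elim (simp add: nn_integral_sq sq_integrable_diff X Z ennreal_leI)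
  qed
  finally show ?thesis .
qed

text \<open>Stated for a sub-\<sigma>-algebra \<open>G\<close> because a stochastic integral over an
  interval ending at \<open>b\<close> has to be measurable for \<open>F b\<close>. The limit is
  therefore constructed as a pointwise \<open>lim\<close> of \<open>G\<close>-measurable functions,
  which is \<open>G\<close>-measurable even if the sequence diverges at some points.\<close>

lemma (in prob_space) ms_complete:
  assumes G: "subalgebra M G" "\<And>n. X n \<in> borel_measurable G"
    and sq: "\<And>n. sq_integrable M (X n)"
    and Cauchy: "\<And>e. e > 0 \<Longrightarrow> \<exists>N. \<forall>a\<ge>N. \<forall>b\<ge>N. expectation (\<lambda>\<omega>. (X a \<omega> - X b \<omega>)\<^sup>2) < e"
  shows "\<exists>Y. Y \<in> borel_measurable G \<and> sq_integrable M Y \<and>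
    (\<lambda>n. expectation (\<lambda>\<omega>. (X n \<omega> - Y \<omega>)\<^sup>2)) \<longlonglongrightarrow> 0"
proof -
  define R where "R k = (SOME N. \<forall>a\<ge>N. \<forall>b\<ge>N. expectation (\<lambda>\<omega>. (X a \<omega> - X b \<omega>)\<^sup>2) < (1/4)^k)" for k
  have R': "\<forall>a\<ge>R k. \<forall>b\<ge>R k. expectation (\<lambda>\<omega>. (X a \<omega> - X b \<omega>)\<^sup>2) < (1/4)^k" for k
    unfolding R_def by (rule someI_ex, rule Cauchy) simp
  have R: "\<And>k a b. a \<ge> R k \<Longrightarrow> b \<ge> R k \<Longrightarrow> expectation (\<lambda>\<omega>. (X a \<omega> - X b \<omega>)\<^sup>2) < (1/4)^k"
    by (rule R'[rule_format])
  \<comment> \<open>Summing the \<open>R l\<close> makes \<open>r\<close> monotone, and adding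
    \<open>k\<close> makes it exceed every bound; \<open>R\<close> itself need do neither.\<close>
  define r where "r k = (\<Sum>l\<le>k. R l) + k" for k
  have rR: "R k \<le> r k" for k 
  proof -
    have "R k \<le> (\<Sum>l\<le>k. R l)" by (rule member_le_sum[of k "{..k}" R]) auto
    then show ?thesis unfolding r_def by linarith
  qed
  have rmono: "r k \<le> r (Suc k)" for k unfolding r_def by simp
  have rk: "k \<le> r k" for k unfolding r_def by simp
  define Y where "Y \<omega> = lim (\<lambda>k. X (r k) \<omega>)" for \<omega>
  have conv: "AE \<omega> in M. (\<lambda>k. X (r k) \<omega>) \<longlonglongrightarrow> Y \<omega>"
    unfolding Y_def
  proof (rule AE_convergent_if_sq_summable[of "\<lambda>k. X (r k)", OF sq])
    fix k
    have "R k \<le> r (Suc k)" using rR[of k] rmono[of k] by (rule order_trans)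
    from R[OF this rR] show "expectation (\<lambda>\<omega>. (X (r (Suc k)) \<omega> - X (r k) \<omega>)\<^sup>2) \<le> (1/4)^k"
      by (rule less_imp_le)
  qed
  have YG: "Y \<in> borel_measurable G" unfolding Y_def
    by (rule borel_measurable_lim_metric) (rule G(2))
  have Ym [measurable]: "Y \<in> borel_measurable M" by (rule measurable_from_subalg[OF G(1) YG])
  note [measurable] = sq_integrable_measurable[OF sq]
  have bound: "(\<integral>\<^sup>+\<omega>. ennreal ((X a \<omega> - Y \<omega>)\<^sup>2) \<partial>M) \<le> ennreal e"
    if "\<forall>b\<ge>N. expectation (\<lambda>\<omega>. (X a \<omega> - X b \<omega>)\<^sup>2) < e" for a N e
  proof (rule ms_Fatou[of "X a" "\<lambda>k. X (r k)", OF sq sq Ym conv])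
    show "\<forall>\<^sub>F k in sequentially. expectation (\<lambda>\<omega>. (X a \<omega> - X (r k) \<omega>)\<^sup>2) \<le> e"
      using eventually_ge_at_top[of N]
    proof eventually_elim
      case (elim k)
      then have "N \<le> r k" using rk[of k] by (rule order_trans)
      from that[rule_format, OF this] show ?case by (rule less_imp_le)
    qed
  qed
  from Cauchy[OF zero_less_one]
  obtain N0 where N0: "\<forall>a\<ge>N0. \<forall>b\<ge>N0. expectation (\<lambda>\<omega>. (X a \<omega> - X b \<omega>)\<^sup>2) < 1" ..
  have "(\<integral>\<^sup>+\<omega>. ennreal ((X N0 \<omega> - Y \<omega>)\<^sup>2) \<partial>M) \<le> ennreal 1"
    by (rule bound[of N0], intro allI impI, rule N0[rule_format], rule order_refl)
  then have "(\<integral>\<^sup>+\<omega>. ennreal ((X N0 \<omega> - Y \<omega>)\<^sup>2) \<partial>M) < \<infinity>"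
    by (rule le_less_trans) simp
  then have "sq_integrable M (\<lambda>\<omega>. X N0 \<omega> - Y \<omega>)"
    by (rule sq_integrableI_nn[rotated]) measurable
  from sq_integrable_diff[OF sq[of N0] this] have Ysq: "sq_integrable M Y" by simp
  have "(\<lambda>n. expectation (\<lambda>\<omega>. (X n \<omega> - Y \<omega>)\<^sup>2)) \<longlonglongrightarrow> 0"
  proof (rule LIMSEQ_I)
    fix e :: real assume "e > 0"
    from Cauchy[OF half_gt_zero[OF this]]
    obtain N where N: "\<forall>a\<ge>N. \<forall>b\<ge>N. expectation (\<lambda>\<omega>. (X a \<omega> - X b \<omega>)\<^sup>2) < e / 2" ..
    have "norm (expectation (\<lambda>\<omega>. (X n \<omega> - Y \<omega>)\<^sup>2) - 0) < e" if "n \<ge> N" for n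
    proof -
      have "(\<integral>\<^sup>+\<omega>. ennreal ((X n \<omega> - Y \<omega>)\<^sup>2) \<partial>M) \<le> ennreal (e / 2)"
        by (rule bound[of N], intro allI impI, rule N[rule_format, OF that])
      then have "expectation (\<lambda>\<omega>. (X n \<omega> - Y \<omega>)\<^sup>2) \<le> e / 2" using \<open>e > 0\<close>
        by (subst (asm) nn_integral_sq[OF sq_integrable_diff[OF sq Ysq]])
          (simp add: ennreal_le_iff)
      moreover have "0 \<le> expectation (\<lambda>\<omega>. (X n \<omega> - Y \<omega>)\<^sup>2)" by simp
      ultimately show ?thesis using \<open>e > 0\<close> unfolding real_norm_def by linarith
    qed
    then show "\<exists>N. \<forall>n\<ge>N. norm (expectation (\<lambda>\<omega>. (X n \<omega> - Y \<omega>)\<^sup>2) - 0) < e" by blast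
  qed
  with Ysq YG show ?thesis by blast
qed

section \<open>Increments of the Wiener process\<close>

context wiener_process begin

definition incr :: "nat \<Rightarrow> real \<Rightarrow> real \<Rightarrow> 'a \<Rightarrow> real" where
  "incr i s u \<omega> = f i u \<omega> - f i s \<omega>"

lemma incr_refl [simp]: "incr i s s = (\<lambda>\<omega>. 0)"
  by (simp add: incr_def fun_eq_iff)

lemma incr_split: "incr i s u \<omega> = incr i s v \<omega> + incr i v u \<omega>"
  by (simp add: incr_def)

lemma F_measurable_M:
  "0 \<le> s \<Longrightarrow> s \<le> T \<Longrightarrow> X \<in> measurable (F s) N \<Longrightarrow> X \<in> measurable M N"
  by (rule measurable_from_subalg[OF subalg]) auto

lemma subalgebra_F: "0 \<le> s \<Longrightarrow> s \<le> u \<Longrightarrow> u \<le> T \<Longrightarrow> subalgebra (F u) (F s)"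
  using subalg[of s] subalg[of u] filt_mono[of s u] by (simp add: subalgebra_def)

lemma F_measurable_mono:
  "0 \<le> s \<Longrightarrow> s \<le> u \<Longrightarrow> u \<le> T \<Longrightarrow> X \<in> measurable (F s) N \<Longrightarrow> X \<in> measurable (F u) N"
  by (rule measurable_from_subalg[OF subalgebra_F])

lemma incr_measurable_F:
  assumes "i \<in> {1..m}" "0 \<le> s" "s \<le> u" "u \<le> T"
  shows "incr i s u \<in> borel_measurable (F u)"
proof -
  have "f i u \<in> borel_measurable (F u)" using assms by (intro adapted) auto
  moreover have "f i s \<in> borel_measurable (F u)"
    by (rule F_measurable_mono[of s]) (use assms in \<open>auto intro: adapted\<close>)
  ultimately show ?thesis unfolding incr_def[abs_def] by (rule borel_measurable_diff)
qed

lemma incr_measurable: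
  assumes "i \<in> {1..m}" "0 \<le> s" "s \<le> u" "u \<le> T"
  shows "incr i s u \<in> borel_measurable M"
  by (rule F_measurable_M[of u]) (use assms incr_measurable_F in auto)

lemma incr_distributed:
  assumes "i \<in> {1..m}" "0 \<le> s" "s < u" "u \<le> T"
  shows "distributed M lborel (incr i s u) (normal_density 0 (sqrt (u - s)))"
  unfolding incr_def[abs_def] by (rule gaussian_increments[OF assms])

lemma incr_moments:
  assumes i: "i \<in> {1..m}" and s: "0 \<le> s" "s \<le> u" "u \<le> T"
  shows sq_integrable_incr: "sq_integrable M (incr i s u)"
    and expectation_incr: "expectation (incr i s u) = 0"
    and expectation_incr_sq: "expectation (\<lambda>\<omega>. (incr i s u \<omega>)\<^sup>2) = u - s"
proof -
  have "sq_integrable M (incr i s u) \<and> expectation (incr i s u) = 0 \<and> expectation (\<lambda>\<omega>. (incr i s u \<omega>)\<^sup>2) = u - s"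
  proof (cases "s = u")
    case True
    then show ?thesis by (simp add: sq_integrable_zero)
  next
    case False
    then have d: "distributed M lborel (incr i s u) (normal_density 0 (sqrt (u - s)))"
      and pos: "0 < sqrt (u - s)" using incr_distributed[of i s u] i s by auto
    have e: "expectation (incr i s u) = 0"
      by (rule normal_distributed_expectation[OF pos d])
    have "integrable lborel (\<lambda>x. normal_density 0 (sqrt (u - s)) x * x ^ 2)"
      using integrable_normal_moment[OF pos, of 0 2] by simp
    then have "integrable M (\<lambda>\<omega>. (incr i s u \<omega>)\<^sup>2)"
      by (subst distributed_integrable[OF d, symmetric]) auto
    moreover have "expectation (\<lambda>\<omega>. (incr i s u \<omega>)\<^sup>2) = u - s"
      using normal_distributed_variance[OF pos d] e pos by simp
    ultimately show ?thesis using e incr_measurable[OF i s] by (simp add: sq_integrable_def)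
  qed
  then show "sq_integrable M (incr i s u)" "expectation (incr i s u) = 0"
    "expectation (\<lambda>\<omega>. (incr i s u \<omega>)\<^sup>2) = u - s" by auto
qed

lemma char_incr:
  assumes i: "i \<in> {1..m}" and s: "0 \<le> s" "s \<le> u" "u \<le> T"
  shows "(CLINT \<omega>|M. iexp (c * incr i s u \<omega>)) = exp (- (c\<^sup>2 * (u - s)) / 2)"
proof (cases "s = u")
  case True
  then show ?thesis by (simp add: prob_space)
next
  case False
  define \<sigma> where "\<sigma> = sqrt (u - s)"
  have d: "distributed M lborel (incr i s u) (normal_density 0 \<sigma>)" and pos: "0 < \<sigma>"
    using incr_distributed[of i s u] i s False by (auto simp: \<sigma>_def)
  have m [measurable]: "incr i s u \<in> borel_measurable M" by (rule incr_measurable[OF i s])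
  have d': "distributed M lborel (\<lambda>\<omega>. incr i s u \<omega> / \<sigma>) std_normal_density"
    using d normal_standard_normal_convert[OF pos, of "incr i s u" 0] by simp
  have "(CLINT \<omega>|M. iexp (c * incr i s u \<omega>)) = (CLINT \<omega>|M. iexp ((c * \<sigma>) * (incr i s u \<omega> / \<sigma>)))"
    using pos by simp
  also have "\<dots> = (CLINT x|distr M lborel (\<lambda>\<omega>. incr i s u \<omega> / \<sigma>). iexp ((c * \<sigma>) * x))"
    by (rule integral_distr[symmetric]) auto
  also have "distr M lborel (\<lambda>\<omega>. incr i s u \<omega> / \<sigma>) = std_normal_distribution"
    using distributed_distr_eq_density[OF d'] by simp
  also have "(CLINT x|std_normal_distribution. iexp ((c * \<sigma>) * x)) = char std_normal_distribution (c * \<sigma>)"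
    by (simp add: char_def)
  also have "\<dots> = exp (- (c\<^sup>2 * (u - s)) / 2)"
    using s by (simp add: char_std_normal_distribution power_mult_distrib \<sigma>_def)
  finally show ?thesis .
qed

text \<open>The sets in \<open>indep_increments\<close> form the \<sigma>-algebra generated by the
  increment vector, here \<open>?V\<close>; the preimages under any measurable function
  \<open>g\<close> of the vector stay inside it. The whole vector is used since products of
  different components over one interval occur later.\<close>

lemma indep_incr_vector:
  assumes s: "0 \<le> s" "s < u" "u \<le> T" and X: "X \<in> measurable (F s) N"
    and g: "g \<in> measurable (\<Pi>\<^sub>M i\<in>{1..m}. (borel :: real measure)) N'"
  shows "indep_var N X N' (\<lambda>\<omega>. g (\<lambda>i\<in>{1..m}. incr i s u \<omega>))"
proof -
  let ?D = "\<lambda>\<omega>. \<lambda>i\<in>{1..m}. incr i s u \<omega>" and ?P = "\<Pi>\<^sub>M i\<in>{1..m}. (borel :: real measure)"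
  let ?V = "vimage_algebra (space M) ?D ?P"
  have sp: "space (F s) = space M" using subalg[of s] s by (simp add: subalgebra_def)
  have XM: "X \<in> measurable M N" using s by (intro F_measurable_M[OF _ _ X]) auto
  have DM: "?D \<in> measurable M ?P"
    by (rule measurable_restrict) (use s in \<open>auto intro: incr_measurable\<close>)
  have YM: "(\<lambda>\<omega>. g (?D \<omega>)) \<in> measurable M N'" by (rule measurable_compose[OF DM g])
  have V: "sets ?V = {?D -` A \<inter> space M | A. A \<in> sets ?P}"
    by (rule sets_vimage_algebra2) (use measurable_space[OF DM] in auto)
  have ind: "indep_set (sets (F s)) (sets ?V)"
    unfolding V using indep_increments[OF s] by (simp add: incr_def)
  have "X -` A \<inter> space M \<in> sets (F s)" if "A \<in> sets N" for A
    using measurable_sets[OF X that] by (simp add: sp)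
  then have 1: "sigma_sets (space M) {X -` A \<inter> space M | A. A \<in> sets N} \<subseteq> sets (F s)"
    unfolding sp[symmetric] by (intro sets.sigma_sets_subset) auto
  have gV: "(\<lambda>\<omega>. g (?D \<omega>)) \<in> measurable ?V N'"
    by (rule measurable_compose[OF measurable_vimage_algebra1 g]) (use measurable_space[OF DM] in auto)
  have "(\<lambda>\<omega>. g (?D \<omega>)) -` A \<inter> space M \<in> sets ?V" if "A \<in> sets N'" for A
    using measurable_sets[OF gV that] by (simp add: space_vimage_algebra)
  then have 2: "sigma_sets (space M) {(\<lambda>\<omega>. g (?D \<omega>)) -` A \<inter> space M | A. A \<in> sets N'} \<subseteq> sets ?V"
    using sets.sigma_sets_subset[of "{(\<lambda>\<omega>. g (?D \<omega>)) -` A \<inter> space M | A. A \<in> sets N'}" ?V]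
    by (auto simp: space_vimage_algebra)
  show ?thesis
    unfolding indep_var_eq
  proof (intro conjI XM YM)
    show "indep_set (sigma_sets (space M) {X -` A \<inter> space M | A. A \<in> sets N})
        (sigma_sets (space M) {(\<lambda>\<omega>. g (?D \<omega>)) -` A \<inter> space M | A. A \<in> sets N'})"
      using ind unfolding indep_set_def
      by (rule indep_sets_mono_sets) (use 1 2 in \<open>auto split: bool.split\<close>)
  qed
qed

text \<open>An increment is a function of the trajectory, namely a difference of two coordinates, so
  independence of whole trajectories passes to increments.\<close>

lemma indep_vars_incr:
  assumes "0 \<le> s" "s \<le> u" "u \<le> T"
  shows "indep_vars (\<lambda>_. borel) (\<lambda>i. incr i s u) {1..m}"
proof -
  have "indep_vars (\<lambda>_. borel) (\<lambda>i \<omega>. (\<lambda>x. x u - x s) (\<lambda>s\<in>{0..T}. f i s \<omega>)) {1..m}"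
    by (rule indep_vars_compose2[OF indep_components]) (use assms in auto)
  then show ?thesis using assms by (simp add: incr_def[abs_def])
qed

lemma expectation_incr_mult:
  assumes i: "i \<in> {1..m}" "j \<in> {1..m}" and s: "0 \<le> s" "s \<le> u" "u \<le> T"
  shows "expectation (\<lambda>\<omega>. incr i s u \<omega> * incr j s u \<omega>) = (if i = j then u - s else 0)"
proof (cases "i = j")
  case True
  then show ?thesis using expectation_incr_sq[OF i(1) s] by (simp add: power2_eq_square)
next
  case False
  have int: "integrable M (incr k s u)" if "k \<in> {1..m}" for k
    by (rule abs_expectation_le_sq(2)[OF sq_integrable_incr[OF that s]])
  have "indep_vars (\<lambda>_. borel) (\<lambda>i. incr i s u) {i, j}"
    by (rule indep_vars_subset[OF indep_vars_incr[OF s]]) (use i in auto)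
  then have "expectation (\<lambda>\<omega>. \<Prod>k\<in>{i,j}. incr k s u \<omega>) = (\<Prod>k\<in>{i,j}. expectation (incr k s u))"
    by (intro indep_vars_lebesgue_integral) (use i int in auto)
  then show ?thesis using False expectation_incr[OF i(1) s] by simp
qed

lemma incr_independent_mult:
  fixes g :: "(nat \<Rightarrow> real) \<Rightarrow> real"
  assumes s: "0 \<le> s" "s \<le> u" "u \<le> T" and X: "X \<in> borel_measurable (F s)" "integrable M X"
    and g: "g \<in> borel_measurable (\<Pi>\<^sub>M i\<in>{1..m}. (borel :: real measure))"
      "integrable M (\<lambda>\<omega>. g (\<lambda>i\<in>{1..m}. incr i s u \<omega>))"
  shows "integrable M (\<lambda>\<omega>. X \<omega> * g (\<lambda>i\<in>{1..m}. incr i s u \<omega>))"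
    and "expectation (\<lambda>\<omega>. X \<omega> * g (\<lambda>i\<in>{1..m}. incr i s u \<omega>))
      = expectation X * expectation (\<lambda>\<omega>. g (\<lambda>i\<in>{1..m}. incr i s u \<omega>))"
proof -
  have *: "integrable M (\<lambda>\<omega>. X \<omega> * g (\<lambda>i\<in>{1..m}. incr i s u \<omega>)) \<and>
    expectation (\<lambda>\<omega>. X \<omega> * g (\<lambda>i\<in>{1..m}. incr i s u \<omega>))
      = expectation X * expectation (\<lambda>\<omega>. g (\<lambda>i\<in>{1..m}. incr i s u \<omega>))"
  \<comment> \<open>The independence axiom covers only \<open>s < u\<close>; on a degenerate
    interval the increments vanish and \<open>g\<close> is evaluated at a constant.\<close>
  proof (cases "s = u")
    case True
    then show ?thesis using X(2) by (simp add: prob_space)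
  next
    case False
    then have "s < u" using s by simp
    from indep_incr_vector[OF s(1) this s(3) X(1) g(1)]
    show ?thesis using X(2) g(2) by (intro conjI indep_var_integrable indep_var_lebesgue_integral)
  qed
  then show "integrable M (\<lambda>\<omega>. X \<omega> * g (\<lambda>i\<in>{1..m}. incr i s u \<omega>))"
    "expectation (\<lambda>\<omega>. X \<omega> * g (\<lambda>i\<in>{1..m}. incr i s u \<omega>))
      = expectation X * expectation (\<lambda>\<omega>. g (\<lambda>i\<in>{1..m}. incr i s u \<omega>))" by auto
qed

lemma adapted_mult_incr:
  assumes i: "i \<in> {1..m}" and s: "0 \<le> s" "s \<le> u" "u \<le> T"
    and X: "X \<in> borel_measurable (F s)" "integrable M X"
  shows "integrable M (\<lambda>\<omega>. X \<omega> * incr i s u \<omega>)" "expectation (\<lambda>\<omega>. X \<omega> * incr i s u \<omega>) = 0"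
proof -
  have "integrable M (incr i s u)"
    by (rule abs_expectation_le_sq(2)[OF sq_integrable_incr[OF i s]])
  with incr_independent_mult[OF s X, of "\<lambda>x. x i"] i expectation_incr[OF i s]
  show "integrable M (\<lambda>\<omega>. X \<omega> * incr i s u \<omega>)" "expectation (\<lambda>\<omega>. X \<omega> * incr i s u \<omega>) = 0"
    by auto
qed

lemma adapted_mult_incr_incr:
  assumes i: "i \<in> {1..m}" "j \<in> {1..m}" and s: "0 \<le> s" "s \<le> u" "u \<le> T"
    and X: "X \<in> borel_measurable (F s)" "integrable M X"
  shows "integrable M (\<lambda>\<omega>. X \<omega> * (incr i s u \<omega> * incr j s u \<omega>))"
    "expectation (\<lambda>\<omega>. X \<omega> * (incr i s u \<omega> * incr j s u \<omega>)) = (if i = j then (u - s) * expectation X else 0)"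
proof -
  have "integrable M (\<lambda>\<omega>. incr i s u \<omega> * incr j s u \<omega>)"
    by (rule sq_integrable_mult) (use sq_integrable_incr i s in auto)
  with incr_independent_mult[OF s X, of "\<lambda>x. x i * x j"] i expectation_incr_mult[OF i s]
  show "integrable M (\<lambda>\<omega>. X \<omega> * (incr i s u \<omega> * incr j s u \<omega>))"
    "expectation (\<lambda>\<omega>. X \<omega> * (incr i s u \<omega> * incr j s u \<omega>)) = (if i = j then (u - s) * expectation X else 0)"
    by auto
qed

text \<open>Independence takes the place of a fourth-moment assumption:
  \<open>(X \<omega>)\<^sup>2\<close> is integrable and independent of the squared
  increment.\<close>

lemma sq_integrable_mult_incr:
  assumes i: "i \<in> {1..m}" and s: "0 \<le> s" "s \<le> u" "u \<le> T"
    and X: "X \<in> borel_measurable (F s)" "sq_integrable M X"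
  shows "sq_integrable M (\<lambda>\<omega>. X \<omega> * incr i s u \<omega>)"
proof -
  have "integrable M (\<lambda>\<omega>. (X \<omega>)\<^sup>2 * (incr i s u \<omega> * incr i s u \<omega>))"
    using X by (intro adapted_mult_incr_incr(1) i s) (auto simp: sq_integrable_def)
  then show ?thesis using X incr_measurable[OF i s]
    by (auto simp: sq_integrable_def power_mult_distrib simp flip: power2_eq_square)
qed

section \<open>Covariances of elementary integrals\<close>

definition overlap :: "real \<Rightarrow> real \<Rightarrow> real \<Rightarrow> real \<Rightarrow> real" where
  "overlap a b a' b' = max 0 (min b b' - max a a')"

lemma overlap_commute: "overlap a b a' b' = overlap a' b' a b"
  by (simp add: overlap_def min.commute max.commute)

text \<open>\<open>overlap\<close> is the length of the intersection of \<open>{a..<b}\<close> and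
  \<open>{a'..<b'}\<close>. The two intervals are otherwise unrelated, so step processes on
  different partitions can be compared without a common refinement. Cut at \<open>a'\<close> and at
  the smaller right endpoint: an increment that lies after everything else in a product has mean
  zero, and only the product of the two increments over the common part survives.\<close>

lemma elementary_isometry_ordered:
  assumes i: "i \<in> {1..m}" "j \<in> {1..m}"
    and a: "0 \<le> a" "a \<le> b" "b \<le> T" and a': "0 \<le> a'" "a' \<le> b'" "b' \<le> T" and aa': "a \<le> a'"
    and X: "X \<in> borel_measurable (F a)" "sq_integrable M X"
    and Y: "Y \<in> borel_measurable (F a')" "sq_integrable M Y"
  shows "expectation (\<lambda>\<omega>. (X \<omega> * incr i a b \<omega>) * (Y \<omega> * incr j a' b' \<omega>))
    = (if i = j then expectation (\<lambda>\<omega>. X \<omega> * Y \<omega>) * overlap a b a' b' else 0)"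
proof (cases "b \<le> a'")
  case True
  have "X \<in> borel_measurable (F a')" "incr i a b \<in> borel_measurable (F a')"
    using F_measurable_mono[OF _ _ _ X(1), of a'] F_measurable_mono[OF _ _ _ incr_measurable_F[OF i(1) a], of a']
      a a' aa' True by auto
  then have m: "(\<lambda>\<omega>. (X \<omega> * incr i a b \<omega>) * Y \<omega>) \<in> borel_measurable (F a')" using Y(1) by measurable
  have "integrable M (\<lambda>\<omega>. (X \<omega> * incr i a b \<omega>) * Y \<omega>)"
    by (rule sq_integrable_mult[OF sq_integrable_mult_incr[OF i(1) a X] Y(2)])
  from adapted_mult_incr(2)[OF i(2) a' m this]
  have "expectation (\<lambda>\<omega>. (X \<omega> * incr i a b \<omega>) * (Y \<omega> * incr j a' b' \<omega>)) = 0"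
    by (simp add: mult.assoc)
  moreover have "overlap a b a' b' = 0" using True a a' by (simp add: overlap_def)
  ultimately show ?thesis by simp
next
  case False
  define c where "c = min b b'"
  have c: "a' \<le> c" "c \<le> b" "c \<le> b'" "c \<le> T" "0 \<le> c" using False a a' by (auto simp: c_def)
  have XF: "X \<in> borel_measurable (F a')"
    by (rule F_measurable_mono[of a]) (use a a' aa' X in auto)
  have incF: "incr i a a' \<in> borel_measurable (F a')"
    by (rule incr_measurable_F) (use i a a' aa' in auto)
  have incX: "sq_integrable M (\<lambda>\<omega>. X \<omega> * incr i a a' \<omega>)"
    by (rule sq_integrable_mult_incr) (use i a a' aa' X in auto)
  have Xc: "sq_integrable M (\<lambda>\<omega>. X \<omega> * incr i a' c \<omega>)"
    by (rule sq_integrable_mult_incr) (use i a' c X XF in auto)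
  have Yc: "sq_integrable M (\<lambda>\<omega>. Y \<omega> * incr j a' c \<omega>)"
    by (rule sq_integrable_mult_incr) (use i a' c Y in auto)
  have Xcm: "(\<lambda>\<omega>. X \<omega> * incr i a' c \<omega> * Y \<omega>) \<in> borel_measurable (F c)"
    "(\<lambda>\<omega>. X \<omega> * (Y \<omega> * incr j a' c \<omega>)) \<in> borel_measurable (F c)"
    using F_measurable_mono[OF _ c(1) _ XF] F_measurable_mono[OF _ c(1) _ Y(1)]
      incr_measurable_F[OF i(1), of a' c] incr_measurable_F[OF i(2), of a' c] a' c
    by (auto intro!: borel_measurable_times)
  have m1: "(\<lambda>\<omega>. X \<omega> * incr i a a' \<omega> * Y \<omega>) \<in> borel_measurable (F a')"
    using XF Y(1) incF by measurable
  have m2: "(\<lambda>\<omega>. X \<omega> * Y \<omega>) \<in> borel_measurable (F a')"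
    using XF Y(1) by measurable
  note A1 = adapted_mult_incr[OF i(2) a' m1 sq_integrable_mult[OF incX Y(2)]]
  have A2: "integrable M (\<lambda>\<omega>. X \<omega> * Y \<omega> * (incr i a' c \<omega> * incr j a' c \<omega>))"
    "expectation (\<lambda>\<omega>. X \<omega> * Y \<omega> * (incr i a' c \<omega> * incr j a' c \<omega>)) =
      (if i = j then (c - a') * expectation (\<lambda>\<omega>. X \<omega> * Y \<omega>) else 0)"
    using adapted_mult_incr_incr[OF i a'(1) c(1) c(4) m2 sq_integrable_mult[OF X(2) Y(2)]] by auto
  note A3 = adapted_mult_incr[OF i(2) c(5,3) a'(3) Xcm(1) sq_integrable_mult[OF Xc Y(2)]]
  note A4 = adapted_mult_incr[OF i(1) c(5,2) a(3) Xcm(2) sq_integrable_mult[OF X(2) Yc]]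
  \<comment> \<open>\<open>c\<close> is one of the two right endpoints, so one of the two tails is
    an empty increment.\<close>
  have z: "incr i c b \<omega> * incr j c b' \<omega> = 0" for \<omega>
    by (cases "b \<le> b'") (simp_all add: c_def incr_def)
  have "(X \<omega> * incr i a b \<omega>) * (Y \<omega> * incr j a' b' \<omega>) =
      X \<omega> * incr i a a' \<omega> * Y \<omega> * incr j a' b' \<omega> + X \<omega> * Y \<omega> * (incr i a' c \<omega> * incr j a' c \<omega>)
      + X \<omega> * incr i a' c \<omega> * Y \<omega> * incr j c b' \<omega> + X \<omega> * (Y \<omega> * incr j a' c \<omega>) * incr i c b \<omega>" for \<omega>
  proof -
    have "X \<omega> * Y \<omega> * (incr i c b \<omega> * incr j c b' \<omega>) = 0" using z by simp
    then show ?thesis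
      unfolding incr_split[of i a b \<omega> a'] incr_split[of i a' b \<omega> c] incr_split[of j a' b' \<omega> c]
      by (simp add: algebra_simps)
  qed
  then have "expectation (\<lambda>\<omega>. (X \<omega> * incr i a b \<omega>) * (Y \<omega> * incr j a' b' \<omega>)) =
      (if i = j then (c - a') * expectation (\<lambda>\<omega>. X \<omega> * Y \<omega>) else 0)"
    using A1 A2 A3 A4 by simp
  moreover have "overlap a b a' b' = c - a'" using aa' c by (simp add: overlap_def c_def)
  ultimately show ?thesis by (simp add: mult.commute)
qed

lemma elementary_isometry:
  assumes i: "i \<in> {1..m}" "j \<in> {1..m}"
    and a: "0 \<le> a" "a \<le> b" "b \<le> T" and a': "0 \<le> a'" "a' \<le> b'" "b' \<le> T"
    and X: "X \<in> borel_measurable (F a)" "sq_integrable M X"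
    and Y: "Y \<in> borel_measurable (F a')" "sq_integrable M Y"
  shows "expectation (\<lambda>\<omega>. (X \<omega> * incr i a b \<omega>) * (Y \<omega> * incr j a' b' \<omega>))
    = (if i = j then expectation (\<lambda>\<omega>. X \<omega> * Y \<omega>) * overlap a b a' b' else 0)"
proof (cases "a \<le> a'")
  case True
  then show ?thesis using assms by (intro elementary_isometry_ordered)
next
  case False
  then have "a' \<le> a" by simp
  from elementary_isometry_ordered[OF i(2,1) a' a this Y X]
  show ?thesis by (auto simp: mult.commute overlap_commute)
qed

end

section \<open>Isometry for step integrals\<close>

lemma partition_bounds:
  assumes "partition_of a b n \<tau>"
  shows partition_mono: "j \<le> l \<Longrightarrow> l \<le> n \<Longrightarrow> \<tau> j \<le> \<tau> l"
    and partition_ge: "j \<le> n \<Longrightarrow> a \<le> \<tau> j" and partition_le: "j \<le> n \<Longrightarrow> \<tau> j \<le> b"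
proof -
  have *: "\<tau> j \<le> \<tau> l" if "j \<le> l" "l \<le> n" for j l
    using that
  proof (induction l rule: dec_induct)
    case (step l)
    then have "\<tau> l < \<tau> (Suc l)" using assms by (simp add: partition_of_def)
    then show ?case using step by simp
  qed simp
  show "j \<le> l \<Longrightarrow> l \<le> n \<Longrightarrow> \<tau> j \<le> \<tau> l" by (rule *)
  show "j \<le> n \<Longrightarrow> a \<le> \<tau> j" "j \<le> n \<Longrightarrow> \<tau> j \<le> b"
    using *[of 0 j] *[of j n] assms by (auto simp: partition_of_def)
qed

text \<open>The index \<open>j\<close> depends on \<open>s\<close> only, so the last property may be
  used for several families \<open>X\<close> at once.\<close>

lemma partition_cover:
  assumes "partition_of a b n \<tau>" "a \<le> s" "s < b"
  obtains j where "j < n" "\<tau> j \<le> s" "s < \<tau> (Suc j)" "\<And>X \<omega>. step_process n \<tau> X s \<omega> = X j \<omega>"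
proof -
  define j where "j = (LEAST j. s < \<tau> (Suc j))"
  have n0: "n \<noteq> 0" using assms by (cases "n = 0") (auto simp: partition_of_def)
  have ex: "s < \<tau> (Suc (n - 1))" using assms n0 by (simp add: partition_of_def)
  have 1: "s < \<tau> (Suc j)" unfolding j_def by (rule LeastI) (rule ex)
  have "j \<le> n - 1" unfolding j_def by (rule Least_le) (rule ex)
  then have 2: "j < n" using n0 by simp
  have 3: "\<tau> j \<le> s"
  proof (cases j)
    case 0 then show ?thesis using assms by (simp add: partition_of_def)
  next
    case (Suc l)
    then have "\<not> s < \<tau> (Suc l)" using not_less_Least[of l "\<lambda>j. s < \<tau> (Suc j)"] by (simp add: j_def)
    then show ?thesis using Suc by simp
  qed
  have "step_process n \<tau> X s \<omega> = X j \<omega>" for X :: "nat \<Rightarrow> 'b \<Rightarrow> real" and \<omega>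
  proof -
    have "X l \<omega> * indicator {\<tau> l..<\<tau> (Suc l)} s = (if l = j then X j \<omega> else 0)" if "l < n" for l
    proof -
      consider "l = j" | "l < j" | "j < l" by linarith
      then show ?thesis
      proof cases
        case 1 then show ?thesis using \<open>s < \<tau> (Suc j)\<close> 3 by simp
      next
        case 2
        then have "\<tau> (Suc l) \<le> \<tau> j" using \<open>j < n\<close> by (intro partition_mono[OF assms(1)]) auto
        then show ?thesis using 2 3 by simp
      next
        case 3
        then have "\<tau> (Suc j) \<le> \<tau> l" using that by (intro partition_mono[OF assms(1)]) auto
        then show ?thesis using 3 1 by simp
      qed
    qed
    then have "step_process n \<tau> X s \<omega> = (\<Sum>l<n. if l = j then X j \<omega> else 0)"
      unfolding step_process_def by (intro sum.cong) auto
    then show ?thesis using 2 by simp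
  qed
  then show thesis by (rule that[OF 2 3 1])
qed

lemma step_process_outside:
  assumes "partition_of a b n \<tau>" "s \<notin> {a..<b}"
  shows "step_process n \<tau> X s \<omega> = 0"
proof -
  have "s \<notin> {\<tau> j..<\<tau> (Suc j)}" if "j < n" for j
    using partition_ge[OF assms(1), of j] partition_le[OF assms(1), of "Suc j"] that assms(2) by auto
  then show ?thesis unfolding step_process_def by (intro sum.neutral) auto
qed

lemma lborel_overlap:
  assumes "a \<le> b" "a' \<le> b'"
  shows "integrable lborel (\<lambda>s. indicator {a..<b} s * indicator {a'..<b'} s :: real)"
    and "(\<integral>s. indicator {a..<b} s * indicator {a'..<b'} s \<partial>lborel) = max 0 (min b b' - max a a' :: real)"
proof -
  have *: "(\<lambda>s. indicator {a..<b} s * indicator {a'..<b'} s :: real) = indicator {max a a'..<min b b'}"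
    by (auto simp: fun_eq_iff indicator_def)
  show "integrable lborel (\<lambda>s. indicator {a..<b} s * indicator {a'..<b'} s :: real)"
    unfolding * by (cases "max a a' \<le> min b b'") auto
  show "(\<integral>s. indicator {a..<b} s * indicator {a'..<b'} s \<partial>lborel) = max 0 (min b b' - max a a' :: real)"
    unfolding * by (cases "max a a' \<le> min b b'") (auto simp: measure_def)
qed

context wiener_process begin

text \<open>Arbitrary finite families of intervals are allowed, so the difference of two step
  integrals is again such a family. Both sides expand into the same double sum of
  \<open>E (X k * X l)\<close> times overlaps: on the left by \<open>elementary_isometry\<close>, on
  the right because an overlap is the integral of a product of indicators.\<close>

lemma family_isometry:
  assumes i: "i \<in> {1..m}" and K: "finite K"
    and a: "\<And>k. k \<in> K \<Longrightarrow> 0 \<le> a k" "\<And>k. k \<in> K \<Longrightarrow> a k \<le> b k" "\<And>k. k \<in> K \<Longrightarrow> b k \<le> T"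
    and X: "\<And>k. k \<in> K \<Longrightarrow> X k \<in> borel_measurable (F (a k))" "\<And>k. k \<in> K \<Longrightarrow> sq_integrable M (X k)"
  shows "(\<integral>\<^sup>+\<omega>. ennreal ((\<Sum>k\<in>K. X k \<omega> * incr i (a k) (b k) \<omega>)\<^sup>2) \<partial>M)
    = (\<integral>\<^sup>+s. (\<integral>\<^sup>+\<omega>. ennreal ((\<Sum>k\<in>K. X k \<omega> * indicator {a k..<b k} s)\<^sup>2) \<partial>M) \<partial>lborel)"
proof -
  define c where "c k l = expectation (\<lambda>\<omega>. X k \<omega> * X l \<omega>)" for k l
  define h where "h s = (\<Sum>k\<in>K. \<Sum>l\<in>K. c k l * (indicator {a k..<b k} s * indicator {a l..<b l} s))" for s :: real
  have sqi: "sq_integrable M (\<lambda>\<omega>. X k \<omega> * incr i (a k) (b k) \<omega>)" if "k \<in> K" for k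
    by (rule sq_integrable_mult_incr) (use that i a X in auto)
  have "(\<integral>\<^sup>+\<omega>. ennreal ((\<Sum>k\<in>K. X k \<omega> * incr i (a k) (b k) \<omega>)\<^sup>2) \<partial>M)
      = ennreal (expectation (\<lambda>\<omega>. (\<Sum>k\<in>K. X k \<omega> * incr i (a k) (b k) \<omega>)\<^sup>2))"
    by (intro nn_integral_sq sq_integrable_sum sqi)
  also have "expectation (\<lambda>\<omega>. (\<Sum>k\<in>K. X k \<omega> * incr i (a k) (b k) \<omega>)\<^sup>2)
      = expectation (\<lambda>\<omega>. \<Sum>k\<in>K. \<Sum>l\<in>K. (X k \<omega> * incr i (a k) (b k) \<omega>) * (X l \<omega> * incr i (a l) (b l) \<omega>))"
    by (simp add: power2_eq_square sum_product)
  also have "\<dots> = (\<Sum>k\<in>K. \<Sum>l\<in>K. expectation (\<lambda>\<omega>. (X k \<omega> * incr i (a k) (b k) \<omega>) * (X l \<omega> * incr i (a l) (b l) \<omega>)))"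
    by (simp add: Bochner_Integration.integral_sum Bochner_Integration.integrable_sum sq_integrable_mult[OF sqi sqi])
  also have "\<dots> = (\<Sum>k\<in>K. \<Sum>l\<in>K. c k l * overlap (a k) (b k) (a l) (b l))"
    unfolding c_def using elementary_isometry[OF i i] a X by (intro sum.cong refl) simp
  also have "\<dots> = (\<integral>s. h s \<partial>lborel)"
    unfolding h_def using lborel_overlap a
    by (simp add: Bochner_Integration.integral_sum Bochner_Integration.integrable_sum overlap_def)
  also have "ennreal \<dots> = (\<integral>\<^sup>+s. ennreal (h s) \<partial>lborel)"
  proof (rule nn_integral_eq_integral[symmetric])
    show "integrable lborel h" unfolding h_def[abs_def] using lborel_overlap a
      by (intro Bochner_Integration.integrable_sum) auto
    \<comment> \<open>\<open>h s\<close> is a second moment, hence nonnegative; this is what turns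
      its Lebesgue integral into a nonnegative integral.\<close>
    have "h s = expectation (\<lambda>\<omega>. (\<Sum>k\<in>K. X k \<omega> * indicator {a k..<b k} s)\<^sup>2)" for s
    proof -
      have "expectation (\<lambda>\<omega>. (\<Sum>k\<in>K. X k \<omega> * indicator {a k..<b k} s)\<^sup>2)
        = expectation (\<lambda>\<omega>. \<Sum>k\<in>K. \<Sum>l\<in>K. (X k \<omega> * X l \<omega>) * (indicator {a k..<b k} s * indicator {a l..<b l} s))"
        by (simp add: power2_eq_square sum_product mult_ac)
      also have "\<dots> = h s" unfolding h_def c_def
        by (simp add: Bochner_Integration.integral_sum Bochner_Integration.integrable_sum sq_integrable_mult X)
      finally show ?thesis by simp
    qed
    note h = this
    show "AE s in lborel. 0 \<le> h s" by (simp add: h)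
  qed
  also have "\<dots> = (\<integral>\<^sup>+s. (\<integral>\<^sup>+\<omega>. ennreal ((\<Sum>k\<in>K. X k \<omega> * indicator {a k..<b k} s)\<^sup>2) \<partial>M) \<partial>lborel)"
  proof (rule nn_integral_cong)
    fix s :: real
    have "(\<integral>\<^sup>+\<omega>. ennreal ((\<Sum>k\<in>K. X k \<omega> * indicator {a k..<b k} s)\<^sup>2) \<partial>M)
      = ennreal (expectation (\<lambda>\<omega>. (\<Sum>k\<in>K. X k \<omega> * indicator {a k..<b k} s)\<^sup>2))"
      by (intro nn_integral_sq sq_integrable_sum sq_integrable_multc X)
    also have "expectation (\<lambda>\<omega>. (\<Sum>k\<in>K. X k \<omega> * indicator {a k..<b k} s)\<^sup>2)
        = expectation (\<lambda>\<omega>. \<Sum>k\<in>K. \<Sum>l\<in>K. (X k \<omega> * X l \<omega>) * (indicator {a k..<b k} s * indicator {a l..<b l} s))"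
        by (simp add: power2_eq_square sum_product mult_ac)
    also have "\<dots> = h s" unfolding h_def c_def
      by (simp add: Bochner_Integration.integral_sum Bochner_Integration.integrable_sum sq_integrable_mult X)
    finally show "ennreal (h s) = (\<integral>\<^sup>+\<omega>. ennreal ((\<Sum>k\<in>K. X k \<omega> * indicator {a k..<b k} s)\<^sup>2) \<partial>M)"
      by simp
  qed
  finally show ?thesis .
qed

lemma step_dataD:
  assumes "step_data M F a b n \<tau> X" "0 \<le> a" "b \<le> T" "j < n"
  shows "0 \<le> \<tau> j" "\<tau> j \<le> \<tau> (Suc j)" "\<tau> (Suc j) \<le> T" "X j \<in> borel_measurable (F (\<tau> j))" "sq_integrable M (X j)"
proof -
  have p: "partition_of a b n \<tau>" using assms by (simp add: step_data_def)
  show 1: "0 \<le> \<tau> j" "\<tau> j \<le> \<tau> (Suc j)" "\<tau> (Suc j) \<le> T" "X j \<in> borel_measurable (F (\<tau> j))"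
    using partition_ge[OF p, of j] partition_mono[OF p, of j "Suc j"] partition_le[OF p, of "Suc j"] assms
    by (auto simp: step_data_def)
  have "X j \<in> borel_measurable M" by (rule F_measurable_M[of "\<tau> j"]) (use 1 in auto)
  then show "sq_integrable M (X j)" using assms by (simp add: step_data_def sq_integrable_def)
qed

lemma sq_integrable_step_process:
  assumes "step_data M F a b n \<tau> X" "0 \<le> a" "b \<le> T"
  shows "sq_integrable M (step_process n \<tau> X s)"
  unfolding step_process_def[abs_def]
  by (intro sq_integrable_sum sq_integrable_multc step_dataD(5)[OF assms]) simp

lemma sq_integrable_step_integral:
  assumes "step_data M F a b n \<tau> X" "0 \<le> a" "b \<le> T" "i \<in> {1..m}"
  shows "sq_integrable M (step_integral (f i) n \<tau> X)"
  unfolding step_integral_def[abs_def] incr_def[symmetric]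
  by (rule sq_integrable_sum, rule sq_integrable_mult_incr) (use step_dataD[OF assms(1-3)] assms(4) in auto)

lemma step_integral_measurable_F:
  assumes "step_data M F a b n \<tau> X" "0 \<le> a" "b \<le> T" "i \<in> {1..m}"
  shows "step_integral (f i) n \<tau> X \<in> borel_measurable (F b)"
proof -
  have p: "partition_of a b n \<tau>" using assms by (simp add: step_data_def)
  have "(\<lambda>\<omega>. X j \<omega> * incr i (\<tau> j) (\<tau> (Suc j)) \<omega>) \<in> borel_measurable (F b)" if "j < n" for j
  proof -
    note d = step_dataD[OF assms(1-3) that]
    have "\<tau> (Suc j) \<le> b" using partition_le[OF p] that by auto
    then have "X j \<in> borel_measurable (F b)" "incr i (\<tau> j) (\<tau> (Suc j)) \<in> borel_measurable (F b)"
      using F_measurable_mono[OF _ _ assms(3) d(4)] F_measurable_mono[OF _ _ assms(3) incr_measurable_F[OF assms(4) d(1-3)]]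
        d by auto
    then show ?thesis by measurable
  qed
  then show ?thesis unfolding step_integral_def[abs_def] incr_def[symmetric]
    by (intro borel_measurable_sum) auto
qed

lemma step_integral_isometry:
  assumes X: "step_data M F a b n \<tau> X" and Y: "step_data M F a b n' \<tau>' Y"
    and ab: "0 \<le> a" "b \<le> T" and i: "i \<in> {1..m}"
  shows "(\<integral>\<^sup>+\<omega>. ennreal ((step_integral (f i) n \<tau> X \<omega> - step_integral (f i) n' \<tau>' Y \<omega>)\<^sup>2) \<partial>M)
    = (\<integral>\<^sup>+s. (\<integral>\<^sup>+\<omega>. ennreal ((step_process n \<tau> X s \<omega> - step_process n' \<tau>' Y s \<omega>)\<^sup>2) \<partial>M) \<partial>lborel)"
proof -
  \<comment> \<open>The two partitions are put side by side as a disjoint sum, the second step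
    process with a minus sign.\<close>
  let ?a = "case_sum \<tau> \<tau>'" and ?b = "case_sum (\<lambda>j. \<tau> (Suc j)) (\<lambda>j. \<tau>' (Suc j))"
  let ?Z = "case_sum X (\<lambda>j \<omega>. - Y j \<omega>)" and ?K = "{..<n} <+> {..<n'}"
  have "sq_integrable M (\<lambda>\<omega>. - Y j \<omega>)" if "j < n'" for j
    using sq_integrable_cmult[OF step_dataD(5)[OF Y ab that], of "-1"] by simp
  then have "(\<integral>\<^sup>+\<omega>. ennreal ((\<Sum>k\<in>?K. ?Z k \<omega> * incr i (?a k) (?b k) \<omega>)\<^sup>2) \<partial>M)
    = (\<integral>\<^sup>+s. (\<integral>\<^sup>+\<omega>. ennreal ((\<Sum>k\<in>?K. ?Z k \<omega> * indicator {?a k..<?b k} s)\<^sup>2) \<partial>M) \<partial>lborel)"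
    by (intro family_isometry i) (use step_dataD[OF X ab] step_dataD[OF Y ab] in auto)
  then show ?thesis
    by (simp only: sum.Plus finite_lessThan comp_def sum.case step_integral_def step_process_def incr_def
        sum_negf mult_minus_left add_uminus_conv_diff)
qed

text \<open>The access to an arbitrary version \<open>I\<close>: its unknown approximating step
  processes are compared with the given one. The square inequality is used twice, once for the
  integrals and once for the processes at each time, whence the factor 4. A measurable majorant
  \<open>G\<close> stands in for the distance itself, whose measurability in time is not assumed for
  the given \<open>X\<close>.\<close>

lemma ito_step_bound:
  assumes ito: "has_ito_integral M F (f i) a b \<xi> I" and X: "step_data M F a b n \<tau> X"
    and ab: "0 \<le> a" "b \<le> T" and i: "i \<in> {1..m}"
    and G [measurable]: "G \<in> borel_measurable borel"
    and le: "\<And>s. s \<in> {a..<b} \<Longrightarrow> (\<integral>\<^sup>+\<omega>. ennreal ((step_process n \<tau> X s \<omega> - \<xi> s \<omega>)\<^sup>2) \<partial>M) \<le> G s"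
  shows "(\<integral>\<^sup>+\<omega>. ennreal ((step_integral (f i) n \<tau> X \<omega> - I \<omega>)\<^sup>2) \<partial>M) \<le> 4 * (\<integral>\<^sup>+s. G s * indicator {a..<b} s \<partial>lborel)"
proof -
  obtain n' \<tau>' Y where Y: "\<And>N. step_data M F a b (n' N) (\<tau>' N) (Y N)"
    and meas: "\<And>N. (\<lambda>s. \<integral>\<^sup>+\<omega>. ennreal ((step_process (n' N) (\<tau>' N) (Y N) s \<omega> - \<xi> s \<omega>)\<^sup>2) \<partial>M)
               \<in> borel_measurable (restrict_space lborel {a..b})"
    and lim: "(\<lambda>N. \<integral>\<^sup>+s. (\<integral>\<^sup>+\<omega>. ennreal ((step_process (n' N) (\<tau>' N) (Y N) s \<omega> - \<xi> s \<omega>)\<^sup>2) \<partial>M)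
               \<partial>restrict_space lborel {a..b}) \<longlonglongrightarrow> 0"
    and ms: "has_ms_limit M (\<lambda>N. step_integral (f i) (n' N) (\<tau>' N) (Y N)) I"
    and adap: "\<And>s. s \<in> {a..b} \<Longrightarrow> \<xi> s \<in> borel_measurable (F s)"
    using ito unfolding has_ito_integral_def by blast
  \<comment> \<open>Extension by zero outside \<open>{a..b}\<close> moves the distance from the
    restricted measure to \<open>lborel\<close>.\<close>
  define D where "D N s = (\<integral>\<^sup>+\<omega>. ennreal ((step_process (n' N) (\<tau>' N) (Y N) s \<omega> - \<xi> s \<omega>)\<^sup>2) \<partial>M) * indicator {a..b} s" for N s
  have Dm [measurable]: "D N \<in> borel_measurable borel" for N
    using meas[of N] unfolding D_def[abs_def]
    by (subst (asm) borel_measurable_restrict_space_iff_ennreal) auto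
  have Dlim: "(\<lambda>N. \<integral>\<^sup>+s. D N s \<partial>lborel) \<longlonglongrightarrow> 0"
    using lim unfolding D_def by (simp add: nn_integral_restrict_space)
  let ?S = "step_integral (f i) n \<tau> X" and ?R = "\<lambda>N. step_integral (f i) (n' N) (\<tau>' N) (Y N)"
  let ?P = "step_process n \<tau> X" and ?Q = "\<lambda>N. step_process (n' N) (\<tau>' N) (Y N)"
  have pX: "partition_of a b n \<tau>" and pY: "partition_of a b (n' N) (\<tau>' N)" for N
    using X Y[of N] by (auto simp: step_data_def)
  have Im: "I \<in> borel_measurable M" using ms by (simp add: has_ms_limit_def)
  have Sm: "?S \<in> borel_measurable M" "?R N \<in> borel_measurable M" for N
    using sq_integrable_step_integral[OF X ab i] sq_integrable_step_integral[OF Y ab i]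
    by (auto intro: sq_integrable_measurable)
  have Pm: "?P s \<in> borel_measurable M" "?Q N s \<in> borel_measurable M" for N s
    using sq_integrable_step_process[OF X ab] sq_integrable_step_process[OF Y ab]
    by (auto intro: sq_integrable_measurable)
  have bound: "(\<integral>\<^sup>+\<omega>. ennreal ((?S \<omega> - I \<omega>)\<^sup>2) \<partial>M) \<le>
      (4 * (\<integral>\<^sup>+s. G s * indicator {a..<b} s \<partial>lborel) + 4 * (\<integral>\<^sup>+s. D N s \<partial>lborel))
      + 2 * (\<integral>\<^sup>+\<omega>. ennreal ((?R N \<omega> - I \<omega>)\<^sup>2) \<partial>M)" for N
  proof -
    have "(\<integral>\<^sup>+\<omega>. ennreal ((?S \<omega> - ?R N \<omega>)\<^sup>2) \<partial>M)
        = (\<integral>\<^sup>+s. (\<integral>\<^sup>+\<omega>. ennreal ((?P s \<omega> - ?Q N s \<omega>)\<^sup>2) \<partial>M) \<partial>lborel)"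
      by (rule step_integral_isometry[OF X Y ab i])
    also have "\<dots> \<le> (\<integral>\<^sup>+s. 2 * (G s * indicator {a..<b} s) + 2 * D N s \<partial>lborel)"
    proof (rule nn_integral_mono)
      fix s
      show "(\<integral>\<^sup>+\<omega>. ennreal ((?P s \<omega> - ?Q N s \<omega>)\<^sup>2) \<partial>M) \<le> 2 * (G s * indicator {a..<b} s) + 2 * D N s"
      proof (cases "s \<in> {a..<b}")
        case True
        have "\<xi> s \<in> borel_measurable M"
          by (rule F_measurable_M[of s]) (use True ab in \<open>auto intro: adap\<close>)
        from nn_integral_square_diff_le[OF Pm(1) this Pm(2), of s N s]
        have "(\<integral>\<^sup>+\<omega>. ennreal ((?P s \<omega> - ?Q N s \<omega>)\<^sup>2) \<partial>M) \<le>
           2 * (\<integral>\<^sup>+\<omega>. ennreal ((?P s \<omega> - \<xi> s \<omega>)\<^sup>2) \<partial>M) + 2 * (\<integral>\<^sup>+\<omega>. ennreal ((?Q N s \<omega> - \<xi> s \<omega>)\<^sup>2) \<partial>M)"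
          by (simp add: power2_commute)
        also have "\<dots> \<le> 2 * G s + 2 * D N s"
          using le[OF True] True by (intro add_mono mult_left_mono) (auto simp: D_def)
        finally show ?thesis using True by simp
      next
        case False
        then show ?thesis by (simp add: step_process_outside[OF pX] step_process_outside[OF pY])
      qed
    qed
    also have "\<dots> = 2 * (\<integral>\<^sup>+s. G s * indicator {a..<b} s \<partial>lborel) + 2 * (\<integral>\<^sup>+s. D N s \<partial>lborel)"
      by (simp add: nn_integral_add nn_integral_cmult)
    finally have "2 * (\<integral>\<^sup>+\<omega>. ennreal ((?S \<omega> - ?R N \<omega>)\<^sup>2) \<partial>M) \<le>
        2 * (2 * (\<integral>\<^sup>+s. G s * indicator {a..<b} s \<partial>lborel) + 2 * (\<integral>\<^sup>+s. D N s \<partial>lborel))"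
      by (rule mult_left_mono) simp
    also have "\<dots> = 4 * (\<integral>\<^sup>+s. G s * indicator {a..<b} s \<partial>lborel) + 4 * (\<integral>\<^sup>+s. D N s \<partial>lborel)"
      by (simp add: distrib_left flip: mult.assoc)
    finally show ?thesis
      by (rule order_trans[OF nn_integral_square_diff_le[OF Sm(1) Sm(2) Im, of N] add_right_mono])
  qed
  have "(\<lambda>N. (4 * (\<integral>\<^sup>+s. G s * indicator {a..<b} s \<partial>lborel) + 4 * (\<integral>\<^sup>+s. D N s \<partial>lborel))
      + 2 * (\<integral>\<^sup>+\<omega>. ennreal ((?R N \<omega> - I \<omega>)\<^sup>2) \<partial>M)) \<longlonglongrightarrow>
      (4 * (\<integral>\<^sup>+s. G s * indicator {a..<b} s \<partial>lborel) + 4 * 0) + 2 * 0"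
    using ms Dlim unfolding has_ms_limit_def
    by (intro tendsto_add tendsto_const ennreal_tendsto_cmult) auto
  from LIMSEQ_le_const[OF this, of "\<integral>\<^sup>+\<omega>. ennreal ((?S \<omega> - I \<omega>)\<^sup>2) \<partial>M"] bound
  have "(\<integral>\<^sup>+\<omega>. ennreal ((?S \<omega> - I \<omega>)\<^sup>2) \<partial>M)
      \<le> (4 * (\<integral>\<^sup>+s. G s * indicator {a..<b} s \<partial>lborel) + 4 * 0) + 2 * 0" by blast
  then show ?thesis by simp
qed

end

section \<open>Existence for mean-square continuous integrands\<close>

text \<open>Uniform continuity for the mean-square norm, written with squares. Uniformity lets one
  mesh size serve all times of an interval.\<close>

definition ms_ucont :: "'a measure \<Rightarrow> real set \<Rightarrow> (real \<Rightarrow> 'a \<Rightarrow> real) \<Rightarrow> bool" where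
  "ms_ucont M S \<xi> \<longleftrightarrow> (\<forall>s\<in>S. sq_integrable M (\<xi> s)) \<and>
     (\<forall>e>0. \<exists>d>0. \<forall>s\<in>S. \<forall>u\<in>S. \<bar>s - u\<bar> < d \<longrightarrow> (\<integral>\<omega>. (\<xi> s \<omega> - \<xi> u \<omega>)\<^sup>2 \<partial>M) < e)"

lemma ms_ucontD: "ms_ucont M S \<xi> \<Longrightarrow> s \<in> S \<Longrightarrow> sq_integrable M (\<xi> s)"
  by (simp add: ms_ucont_def)

lemma ms_ucont_uniform:
  assumes "ms_ucont M S \<xi>" "e > 0"
  obtains d where "d > 0"
    "\<And>s u. s \<in> S \<Longrightarrow> u \<in> S \<Longrightarrow> \<bar>s - u\<bar> < d \<Longrightarrow> (\<integral>\<omega>. (\<xi> s \<omega> - \<xi> u \<omega>)\<^sup>2 \<partial>M) < e"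
  using assms unfolding ms_ucont_def by meson

lemma ms_ucont_subset: "ms_ucont M S \<xi> \<Longrightarrow> S' \<subseteq> S \<Longrightarrow> ms_ucont M S' \<xi>"
  unfolding ms_ucont_def by (meson subsetD)

lemma ms_ucont_const: "sq_integrable M X \<Longrightarrow> ms_ucont M S (\<lambda>s. X)"
  by (auto simp: ms_ucont_def intro!: exI[of _ 1])

lemma ms_ucont_const_diff:
  assumes "sq_integrable M X" "ms_ucont M S \<xi>"
  shows "ms_ucont M S (\<lambda>s \<omega>. X \<omega> - \<xi> s \<omega>)"
proof -
  have "((X \<omega> - \<xi> s \<omega>) - (X \<omega> - \<xi> u \<omega>))\<^sup>2 = (\<xi> s \<omega> - \<xi> u \<omega>)\<^sup>2" for s u \<omega>
    by (simp add: power2_commute)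
  then show ?thesis using assms by (simp add: ms_ucont_def sq_integrable_diff)
qed

text \<open>Continuity of the covariance supplies measurability in time of mean-square distances,
  boundedness on compact intervals, and the Riemann sums in the isometry.\<close>

lemma ms_ucont_continuous:
  assumes X: "ms_ucont M S \<xi>" and Y: "ms_ucont M S \<eta>"
  shows "continuous_on S (\<lambda>s. \<integral>\<omega>. \<xi> s \<omega> * \<eta> s \<omega> \<partial>M)"
proof -
  have lim: "(\<lambda>n. \<integral>\<omega>. (\<zeta> (x n) \<omega> - \<zeta> a \<omega>)\<^sup>2 \<partial>M) \<longlonglongrightarrow> 0"
    if "ms_ucont M S \<zeta>" "a \<in> S" "\<And>n. x n \<in> S" "x \<longlonglongrightarrow> a" for \<zeta> :: "real \<Rightarrow> 'a \<Rightarrow> real" and x a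
  proof (rule LIMSEQ_I)
    fix e :: real assume "e > 0"
    from ms_ucont_uniform[OF that(1) this] obtain d where d: "d > 0"
      "\<And>s u. s \<in> S \<Longrightarrow> u \<in> S \<Longrightarrow> \<bar>s - u\<bar> < d \<Longrightarrow> (\<integral>\<omega>. (\<zeta> s \<omega> - \<zeta> u \<omega>)\<^sup>2 \<partial>M) < e" by metis
    from LIMSEQ_D[OF that(4) d(1)] obtain N where N: "\<And>n. n \<ge> N \<Longrightarrow> norm (x n - a) < d" by blast
    have "norm ((\<integral>\<omega>. (\<zeta> (x n) \<omega> - \<zeta> a \<omega>)\<^sup>2 \<partial>M) - 0) < e" if "n \<ge> N" for n
      using d(2)[of "x n" a] N[OF that] \<open>a \<in> S\<close> \<open>\<And>n. x n \<in> S\<close> by simp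
    then show "\<exists>N. \<forall>n\<ge>N. norm ((\<integral>\<omega>. (\<zeta> (x n) \<omega> - \<zeta> a \<omega>)\<^sup>2 \<partial>M) - 0) < e" by blast
  qed
  show ?thesis
    unfolding continuous_on_sequentially comp_def
  proof (intro allI ballI impI, elim conjE)
    fix x a assume x: "a \<in> S" "\<forall>n. x n \<in> S" "x \<longlonglongrightarrow> a"
    show "(\<lambda>n. \<integral>\<omega>. \<xi> (x n) \<omega> * \<eta> (x n) \<omega> \<partial>M) \<longlonglongrightarrow> (\<integral>\<omega>. \<xi> a \<omega> * \<eta> a \<omega> \<partial>M)"
      by (rule integral_mult_tendsto) (use x X Y in \<open>auto intro: ms_ucontD lim\<close>)
  qed
qed

lemma ms_ucont_bounded:
  assumes "ms_ucont M {a..b} \<xi>"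
  obtains C where "C > 0" "\<And>s. s \<in> {a..b} \<Longrightarrow> (\<integral>\<omega>. (\<xi> s \<omega>)\<^sup>2 \<partial>M) \<le> C"
proof -
  have "compact ((\<lambda>s. \<integral>\<omega>. \<xi> s \<omega> * \<xi> s \<omega> \<partial>M) ` {a..b})"
    by (rule compact_continuous_image[OF ms_ucont_continuous[OF assms assms] compact_Icc])
  then obtain C where C: "C > 0" "\<forall>x\<in>(\<lambda>s. \<integral>\<omega>. \<xi> s \<omega> * \<xi> s \<omega> \<partial>M) ` {a..b}. norm x \<le> C"
    using compact_imp_bounded bounded_pos by meson
  show thesis
  proof (rule that[OF C(1)])
    fix s assume "s \<in> {a..b}"
    then have "norm (\<integral>\<omega>. \<xi> s \<omega> * \<xi> s \<omega> \<partial>M) \<le> C" using C(2) by blast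
    then show "(\<integral>\<omega>. (\<xi> s \<omega>)\<^sup>2 \<partial>M) \<le> C" by (simp add: power2_eq_square)
  qed
qed

lemma continuous_on_bounded_sq:
  fixes g :: "real \<Rightarrow> real"
  assumes "continuous_on {a..b} g"
  obtains B where "B > 0" "\<And>s. s \<in> {a..b} \<Longrightarrow> (g s)\<^sup>2 \<le> B"
proof -
  have "compact ((\<lambda>s. (g s)\<^sup>2) ` {a..b})"
    by (intro compact_continuous_image continuous_on_power assms compact_Icc)
  then obtain B where B: "B > 0" "\<forall>x\<in>(\<lambda>s. (g s)\<^sup>2) ` {a..b}. norm x \<le> B"
    using compact_imp_bounded bounded_pos by meson
  show thesis
  proof (rule that[OF B(1)])
    fix s assume "s \<in> {a..b}"
    then have "norm ((g s)\<^sup>2) \<le> B" using B(2) by blast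
    then show "(g s)\<^sup>2 \<le> B" by simp
  qed
qed

lemma ms_ucont_scale:
  fixes g :: "real \<Rightarrow> real"
  assumes g: "continuous_on {a..b} g" and X: "ms_ucont M {a..b} \<xi>"
  shows "ms_ucont M {a..b} (\<lambda>s \<omega>. g s * \<xi> s \<omega>)"
  unfolding ms_ucont_def
proof (intro conjI ballI allI impI)
  show "sq_integrable M (\<lambda>\<omega>. g s * \<xi> s \<omega>)" if "s \<in> {a..b}" for s
    by (rule sq_integrable_cmult[OF ms_ucontD[OF X that]])
  fix e :: real assume "e > 0"
  obtain C where C: "C > 0" "\<And>s. s \<in> {a..b} \<Longrightarrow> (\<integral>\<omega>. (\<xi> s \<omega>)\<^sup>2 \<partial>M) \<le> C"
    using ms_ucont_bounded[OF X] by metis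
  obtain B where B: "B > 0" "\<And>s. s \<in> {a..b} \<Longrightarrow> (g s)\<^sup>2 \<le> B"
    using continuous_on_bounded_sq[OF g] by metis
  \<comment> \<open>Each of the two terms below carries a factor 2 and is to contribute at most
    \<open>e / 2\<close>.\<close>
  have "e / (4 * B) > 0" "sqrt (e / (4 * C)) > 0" using \<open>e > 0\<close> B C by simp_all
  from ms_ucont_uniform[OF X this(1)] obtain d1 where d1: "d1 > 0"
    "\<And>s u. s \<in> {a..b} \<Longrightarrow> u \<in> {a..b} \<Longrightarrow> \<bar>s - u\<bar> < d1 \<Longrightarrow> (\<integral>\<omega>. (\<xi> s \<omega> - \<xi> u \<omega>)\<^sup>2 \<partial>M) < e / (4 * B)" by metis
  have "uniformly_continuous_on {a..b} g" by (rule compact_uniformly_continuous[OF g compact_Icc])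
  from uniformly_continuous_onE[OF this \<open>sqrt (e / (4 * C)) > 0\<close>] obtain d2 where d2: "d2 > 0"
    "\<And>x x'. x \<in> {a..b} \<Longrightarrow> x' \<in> {a..b} \<Longrightarrow> dist x' x < d2 \<Longrightarrow> dist (g x') (g x) < sqrt (e / (4 * C))" by metis
  have "(\<integral>\<omega>. (g s * \<xi> s \<omega> - g u * \<xi> u \<omega>)\<^sup>2 \<partial>M) < e"
    if "s \<in> {a..b}" "u \<in> {a..b}" "\<bar>s - u\<bar> < min d1 d2" for s u
  proof -
    note sq = ms_ucontD[OF X that(1)] ms_ucontD[OF X that(2)]
    have "(\<integral>\<omega>. (g s * \<xi> s \<omega> - g u * \<xi> u \<omega>)\<^sup>2 \<partial>M) \<le>
        2 * (\<integral>\<omega>. (g s * \<xi> s \<omega> - g s * \<xi> u \<omega>)\<^sup>2 \<partial>M) + 2 * (\<integral>\<omega>. (g s * \<xi> u \<omega> - g u * \<xi> u \<omega>)\<^sup>2 \<partial>M)"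
      by (intro integral_square_diff_le sq_integrable_cmult sq)
    also have "(\<integral>\<omega>. (g s * \<xi> s \<omega> - g s * \<xi> u \<omega>)\<^sup>2 \<partial>M) = (g s)\<^sup>2 * (\<integral>\<omega>. (\<xi> s \<omega> - \<xi> u \<omega>)\<^sup>2 \<partial>M)"
      by (simp add: power_mult_distrib flip: right_diff_distrib)
    also have "(\<integral>\<omega>. (g s * \<xi> u \<omega> - g u * \<xi> u \<omega>)\<^sup>2 \<partial>M) = (g s - g u)\<^sup>2 * (\<integral>\<omega>. (\<xi> u \<omega>)\<^sup>2 \<partial>M)"
      by (simp add: power_mult_distrib flip: left_diff_distrib)
    also have "(g s)\<^sup>2 * (\<integral>\<omega>. (\<xi> s \<omega> - \<xi> u \<omega>)\<^sup>2 \<partial>M) \<le> B * (e / (4 * B))"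
      using d1(2)[OF that(1,2)] that B C by (intro mult_mono) auto
    also have "B * (e / (4 * B)) = e / 4" using B by simp
    also have "(g s - g u)\<^sup>2 * (\<integral>\<omega>. (\<xi> u \<omega>)\<^sup>2 \<partial>M) \<le> (g s - g u)\<^sup>2 * C"
      using C(2)[OF that(2)] by (rule mult_left_mono) simp
    also have "(g s - g u)\<^sup>2 * C < e / (4 * C) * C"
    proof (rule mult_strict_right_mono[OF _ C(1)])
      have "\<bar>g s - g u\<bar> < sqrt (e / (4 * C))"
        using d2(2)[OF that(2,1)] that(3) by (simp add: dist_real_def)
      then have "\<bar>g s - g u\<bar>\<^sup>2 < (sqrt (e / (4 * C)))\<^sup>2" by (rule power_strict_mono) auto
      then show "(g s - g u)\<^sup>2 < e / (4 * C)" using \<open>e > 0\<close> C(1) by simp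
    qed
    also have "e / (4 * C) * C = e / 4" using C by simp
    finally show ?thesis by simp
  qed
  then show "\<exists>d>0. \<forall>s\<in>{a..b}. \<forall>u\<in>{a..b}. \<bar>s - u\<bar> < d \<longrightarrow> (\<integral>\<omega>. (g s * \<xi> s \<omega> - g u * \<xi> u \<omega>)\<^sup>2 \<partial>M) < e"
    using d1(1) d2(1) by (intro exI[of _ "min d1 d2"]) simp
qed

lemma ennreal_pos_real_below:
  assumes "0 < (e::ennreal)"
  obtains r where "0 < r" "ennreal r < e"
proof (cases e)
  case (real x)
  then have "0 < x" using assms by simp
  then show thesis using real by (intro that[of "x / 2"]) (auto simp: ennreal_less_iff)
next
  case top
  then show thesis by (intro that[of 1]) auto
qed

text \<open>Written without a maximum, so that a partition with \<open>n N = 0\<close> subintervals,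
  as for \<open>a = b\<close>, needs no exception.\<close>

definition mesh_tendsto_0 :: "(nat \<Rightarrow> nat) \<Rightarrow> (nat \<Rightarrow> nat \<Rightarrow> real) \<Rightarrow> bool" where
  "mesh_tendsto_0 n \<tau> \<longleftrightarrow> (\<forall>d>0. \<exists>N0. \<forall>N\<ge>N0. \<forall>j<n N. \<tau> N (Suc j) - \<tau> N j < d)"

lemma uniform_partition_exists:
  fixes a b :: real
  assumes "a \<le> b"
  obtains n \<tau> where "\<And>N. partition_of a b (n N) (\<tau> N)" "mesh_tendsto_0 n \<tau>"
proof (cases "a = b")
  case True
  then have "partition_of a b 0 (\<lambda>j. a)" by (simp add: partition_of_def)
  then show thesis by (intro that[of "\<lambda>N. 0" "\<lambda>N j. a"]) (auto simp: mesh_tendsto_0_def)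
next
  case False
  with assms have "a < b" by simp
  define \<tau> where "\<tau> N j = a + (b - a) * real j / real (Suc N)" for N j
  have d: "\<tau> N (Suc j) - \<tau> N j = (b - a) / real (Suc N)" for N j
  proof -
    have "x * (1 + y) / c - x * y / c = x / c" for x y c :: real
      by (simp add: distrib_left add_divide_distrib)
    from this[of "b - a" "real j" "real (Suc N)"] show ?thesis
      unfolding \<tau>_def of_nat_Suc[of j] by linarith
  qed
  show thesis
  proof (rule that[of Suc \<tau>])
    have "\<tau> N j < \<tau> N (Suc j)" for N j
      using d[of N j] \<open>a < b\<close> by (smt (verit) divide_pos_pos of_nat_0_less_iff zero_less_Suc)
    moreover have "\<tau> N (Suc N) = b" for N
    proof -
      have "\<tau> N (Suc N) = a + (b - a) * (real (Suc N) / real (Suc N))"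
        unfolding \<tau>_def by (simp only: times_divide_eq_right)
      also have "real (Suc N) / real (Suc N) = 1" by (rule divide_self) simp
      finally show ?thesis by simp
    qed
    ultimately show "partition_of a b (Suc N) (\<tau> N)" for N
      by (simp add: partition_of_def \<tau>_def[of N 0])
    have lim: "(\<lambda>N. (b - a) / real (Suc N)) \<longlonglongrightarrow> 0"
      by (rule LIMSEQ_Suc) (rule lim_const_over_n)
    then have ev: "\<exists>N0. \<forall>N\<ge>N0. (b - a) / real (Suc N) < e" if "e > 0" for e
      using order_tendstoD(2)[OF lim that] by (simp only: eventually_sequentially)
    show "mesh_tendsto_0 Suc \<tau>"
      unfolding mesh_tendsto_0_def d using ev by meson
  qed
qed

section \<open>Integrands sampled at the left ends of partitions\<close>

context wiener_process begin

definition adapted_on :: "real \<Rightarrow> real \<Rightarrow> (real \<Rightarrow> 'a \<Rightarrow> real) \<Rightarrow> bool" where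
  "adapted_on a b \<xi> \<longleftrightarrow> (\<forall>s\<in>{a..b}. \<xi> s \<in> borel_measurable (F s))"

lemma step_data_sampled:
  assumes "0 \<le> a" "b \<le> T" "partition_of a b n \<tau>" "adapted_on a b \<xi>" "ms_ucont M {a..b} \<xi>"
  shows "step_data M F a b n \<tau> (\<lambda>j. \<xi> (\<tau> j))"
proof -
  have "\<tau> j \<in> {a..b}" if "j < n" for j
    using partition_ge[OF assms(3), of j] partition_le[OF assms(3), of j] that by auto
  then show ?thesis
    using assms ms_ucontD[OF assms(5)] by (auto simp: step_data_def adapted_on_def sq_integrable_def)
qed

lemma sampled_close:
  assumes part: "partition_of a b n \<tau>" and s: "s \<in> {a..<b}"
    and mesh: "\<And>j. j < n \<Longrightarrow> \<tau> (Suc j) - \<tau> j < d"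
    and d: "\<And>s u. s \<in> {a..b} \<Longrightarrow> u \<in> {a..b} \<Longrightarrow> \<bar>s - u\<bar> < d \<Longrightarrow> expectation (\<lambda>\<omega>. (\<xi> s \<omega> - \<xi> u \<omega>)\<^sup>2) < e"
  shows "expectation (\<lambda>\<omega>. (step_process n \<tau> (\<lambda>j. \<xi> (\<tau> j)) s \<omega> - \<xi> s \<omega>)\<^sup>2) < e"
proof -
  obtain j where j: "j < n" "\<tau> j \<le> s" "s < \<tau> (Suc j)"
    "\<And>(X::nat \<Rightarrow> 'a \<Rightarrow> real) \<omega>. step_process n \<tau> X s \<omega> = X j \<omega>"
    using partition_cover[OF part, of s] s by (metis atLeastLessThan_iff)
  have "\<tau> j \<in> {a..b}" using partition_ge[OF part, of j] partition_le[OF part, of j] j by auto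
  moreover have "\<bar>\<tau> j - s\<bar> < d" using mesh[OF j(1)] j by simp
  ultimately show ?thesis using d[of "\<tau> j" s] s by (simp add: j(4))
qed

text \<open>On each subinterval the distance is \<open>E ((X j - \<xi> s)\<^sup>2)\<close>,
  continuous in \<open>s\<close>. Mean-square continuity thus replaces joint measurability of
  \<open>\<xi>\<close> in time and \<omega>.\<close>

lemma distance_measurable:
  assumes part: "partition_of a b n \<tau>" and X: "\<And>j. j < n \<Longrightarrow> sq_integrable M (X j)"
    and \<xi>: "ms_ucont M {a..b} \<xi>"
  shows "(\<lambda>s. \<integral>\<^sup>+\<omega>. ennreal ((step_process n \<tau> X s \<omega> - \<xi> s \<omega>)\<^sup>2) \<partial>M) \<in> borel_measurable (restrict_space lborel {a..b})"
proof -
  define c where "c j s = expectation (\<lambda>\<omega>. (X j \<omega> - \<xi> s \<omega>)\<^sup>2)" for j s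
  \<comment> \<open>The half-open subintervals miss \<open>b\<close>, where the step process is 0;
    the last summand accounts for that point.\<close>
  define h where "h s = (\<Sum>j<n. c j s * indicator {\<tau> j..<\<tau> (Suc j)} s) + expectation (\<lambda>\<omega>. (\<xi> s \<omega>)\<^sup>2) * indicator {b} s" for s
  have "continuous_on {a..b} (c j)" if "j < n" for j
    using ms_ucont_continuous[OF ms_ucont_const_diff[OF X[OF that] \<xi>] ms_ucont_const_diff[OF X[OF that] \<xi>]]
    by (simp add: c_def[abs_def] power2_eq_square)
  then have cm: "c j \<in> borel_measurable (restrict_space borel {a..b})" if "j < n" for j
    using that by (intro borel_measurable_continuous_on_restrict)
  have "continuous_on {a..b} (\<lambda>s. expectation (\<lambda>\<omega>. (\<xi> s \<omega>)\<^sup>2))"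
    using ms_ucont_continuous[OF \<xi> \<xi>] by (simp add: power2_eq_square)
  then have xm: "(\<lambda>s. expectation (\<lambda>\<omega>. (\<xi> s \<omega>)\<^sup>2)) \<in> borel_measurable (restrict_space borel {a..b})"
    by (rule borel_measurable_continuous_on_restrict)
  have im: "(\<lambda>s. indicator A s :: real) \<in> borel_measurable (restrict_space borel {a..b})" if "A \<in> sets borel" for A :: "real set"
    by (rule measurable_restrict_space1) (use that in simp)
  have "h \<in> borel_measurable (restrict_space borel {a..b})"
    unfolding h_def[abs_def]
    by (intro borel_measurable_add borel_measurable_sum borel_measurable_times cm xm im) auto
  then have hm: "(\<lambda>s. ennreal (h s)) \<in> borel_measurable (restrict_space borel {a..b})" by measurable
  have eq: "(\<integral>\<^sup>+\<omega>. ennreal ((step_process n \<tau> X s \<omega> - \<xi> s \<omega>)\<^sup>2) \<partial>M) = ennreal (h s)" if s: "s \<in> {a..b}" for s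
  proof (cases "s = b")
    case True
    have z: "step_process n \<tau> Y b \<omega> = 0" for Y :: "nat \<Rightarrow> 'a \<Rightarrow> real" and \<omega>
      by (rule step_process_outside[OF part]) simp
    have "(\<Sum>j<n. c j b * indicator {\<tau> j..<\<tau> (Suc j)} b) = 0"
      using z[of "\<lambda>j \<omega>. c j b"] by (simp only: step_process_def)
    then show ?thesis using True s by (simp add: z h_def nn_integral_sq ms_ucontD[OF \<xi>])
  next
    case False
    then have "a \<le> s" "s < b" using s by auto
    from partition_cover[OF part this] obtain j where j: "j < n"
      "\<And>(X::nat \<Rightarrow> 'a \<Rightarrow> real) \<omega>. step_process n \<tau> X s \<omega> = X j \<omega>"
      by (metis (no_types))
    have "h s = c j s" using False j(2)[of "\<lambda>j \<omega>. c j s"] by (simp add: h_def step_process_def)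
    then show ?thesis by (simp add: j(2) c_def nn_integral_sq sq_integrable_diff X[OF j(1)] ms_ucontD[OF \<xi> s])
  qed
  have "(\<lambda>s. \<integral>\<^sup>+\<omega>. ennreal ((step_process n \<tau> X s \<omega> - \<xi> s \<omega>)\<^sup>2) \<partial>M) \<in> borel_measurable (restrict_space borel {a..b})"
    using hm by (rule measurable_cong[THEN iffD1, rotated]) (simp add: eq)
  then show ?thesis
    by (subst measurable_cong_sets[OF sets_restrict_space_cong refl]) auto
qed

text \<open>Frees the integral from its unknown witnesses: the partitions prescribed in the theorem
  may be used, and two integrals may be evaluated on common partitions. It follows from
  \<open>ito_step_bound\<close> with a constant majorant.\<close>

lemma sampled_ms_limit:
  assumes ito: "has_ito_integral M F (f i) a b \<xi> I" and i: "i \<in> {1..m}" and ab: "0 \<le> a" "a \<le> b" "b \<le> T"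
    and \<xi>: "adapted_on a b \<xi>" "ms_ucont M {a..b} \<xi>"
    and part: "\<And>N. partition_of a b (n N) (\<tau> N)" and mesh: "mesh_tendsto_0 n \<tau>"
  shows "has_ms_limit M (\<lambda>N. step_integral (f i) (n N) (\<tau> N) (\<lambda>j. \<xi> (\<tau> N j))) I"
proof -
  note sd = step_data_sampled[OF ab(1,3) part \<xi>]
  let ?S = "\<lambda>N. step_integral (f i) (n N) (\<tau> N) (\<lambda>j. \<xi> (\<tau> N j))"
  have sq: "sq_integrable M (?S N)" for N by (rule sq_integrable_step_integral[OF sd ab(1,3) i])
  have Im: "I \<in> borel_measurable M" using ito unfolding has_ito_integral_def has_ms_limit_def by blast
  have "(\<lambda>N. \<integral>\<^sup>+\<omega>. ennreal ((?S N \<omega> - I \<omega>)\<^sup>2) \<partial>M) \<longlonglongrightarrow> 0"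
  proof (rule order_tendstoI)
    fix e :: ennreal assume "0 < e"
    then obtain r where r: "0 < r" "ennreal r < e"
      by (rule ennreal_pos_real_below)
    \<comment> \<open>The 4 is the constant of \<open>ito_step_bound\<close>; the added 1 keeps the
      denominator positive when \<open>a = b\<close>.\<close>
    define e' where "e' = r / (4 * (b - a) + 1)"
    have e': "e' > 0" using r ab by (simp add: e'_def)
    obtain d where d: "d > 0"
      "\<And>s u. s \<in> {a..b} \<Longrightarrow> u \<in> {a..b} \<Longrightarrow> \<bar>s - u\<bar> < d \<Longrightarrow> expectation (\<lambda>\<omega>. (\<xi> s \<omega> - \<xi> u \<omega>)\<^sup>2) < e'"
      using ms_ucont_uniform[OF \<xi>(2) e'] by metis
    obtain N0 where N0: "\<And>N j. N \<ge> N0 \<Longrightarrow> j < n N \<Longrightarrow> \<tau> N (Suc j) - \<tau> N j < d"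
      using mesh d(1) unfolding mesh_tendsto_0_def by meson
    have "(\<integral>\<^sup>+\<omega>. ennreal ((?S N \<omega> - I \<omega>)\<^sup>2) \<partial>M) < e" if "N \<ge> N0" for N
    proof -
      have "(\<integral>\<^sup>+\<omega>. ennreal ((?S N \<omega> - I \<omega>)\<^sup>2) \<partial>M) \<le> 4 * (\<integral>\<^sup>+s. ennreal e' * indicator {a..<b} s \<partial>lborel)"
      proof (rule ito_step_bound[OF ito sd ab(1,3) i])
        fix s assume s: "s \<in> {a..<b}"
        have "expectation (\<lambda>\<omega>. (step_process (n N) (\<tau> N) (\<lambda>j. \<xi> (\<tau> N j)) s \<omega> - \<xi> s \<omega>)\<^sup>2) < e'"
          by (rule sampled_close[OF part s N0[OF that] d(2)])
        then show "(\<integral>\<^sup>+\<omega>. ennreal ((step_process (n N) (\<tau> N) (\<lambda>j. \<xi> (\<tau> N j)) s \<omega> - \<xi> s \<omega>)\<^sup>2) \<partial>M) \<le> ennreal e'"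
          using s by (subst nn_integral_sq)
            (auto intro!: sq_integrable_diff sq_integrable_step_process[OF sd ab(1,3)] ms_ucontD[OF \<xi>(2)] ennreal_leI)
      qed simp
      also have "\<dots> = ennreal (4 * (e' * (b - a)))"
        using e' ab by (simp add: nn_integral_cmult ennreal_mult)
      also have "\<dots> \<le> ennreal r"
      proof (rule ennreal_leI)
        have "4 * (e' * (b - a)) \<le> e' * (4 * (b - a) + 1)" using e' by (simp add: algebra_simps)
        also have "\<dots> = r" using ab by (simp add: e'_def)
        finally show "4 * (e' * (b - a)) \<le> r" .
      qed
      also have "\<dots> < e" by (rule r)
      finally show ?thesis .
    qed
    then show "\<forall>\<^sub>F N in sequentially. (\<integral>\<^sup>+\<omega>. ennreal ((?S N \<omega> - I \<omega>)\<^sup>2) \<partial>M) < e"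
      by (auto simp: eventually_sequentially)
  qed simp
  then show ?thesis using sq Im by (auto simp: has_ms_limit_def intro: sq_integrable_measurable)
qed

text \<open>Sampled step processes are uniformly close to \<open>\<xi>\<close> in mean square, so by
  the isometry their integrals form a Cauchy sequence; \<open>ms_complete\<close> gives a limit
  measurable for \<open>F b\<close>.\<close>

lemma ito_integral_exists:
  assumes i: "i \<in> {1..m}" and ab: "0 \<le> a" "a \<le> b" "b \<le> T"
    and \<xi>: "adapted_on a b \<xi>" "ms_ucont M {a..b} \<xi>"
  shows "\<exists>I. has_ito_integral M F (f i) a b \<xi> I"
proof -
  obtain n \<tau> where part: "\<And>N. partition_of a b (n N) (\<tau> N)" and mesh: "mesh_tendsto_0 n \<tau>"
    using uniform_partition_exists[OF ab(2)] by metis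
  note sd = step_data_sampled[OF ab(1,3) part \<xi>]
  let ?S = "\<lambda>N. step_integral (f i) (n N) (\<tau> N) (\<lambda>j. \<xi> (\<tau> N j))"
  let ?P = "\<lambda>N. step_process (n N) (\<tau> N) (\<lambda>j. \<xi> (\<tau> N j))"
  have sq: "sq_integrable M (?S N)" for N by (rule sq_integrable_step_integral[OF sd ab(1,3) i])
  have sqP: "sq_integrable M (?P N s)" for N s by (rule sq_integrable_step_process[OF sd ab(1,3)])
  have SF: "?S N \<in> borel_measurable (F b)" for N by (rule step_integral_measurable_F[OF sd ab(1,3) i])
  have close: "\<exists>N0. \<forall>N\<ge>N0. \<forall>s\<in>{a..<b}. expectation (\<lambda>\<omega>. (?P N s \<omega> - \<xi> s \<omega>)\<^sup>2) < e" if epos: "e > 0" for e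
  proof -
    obtain d where d: "d > 0"
      "\<And>s u. s \<in> {a..b} \<Longrightarrow> u \<in> {a..b} \<Longrightarrow> \<bar>s - u\<bar> < d \<Longrightarrow> expectation (\<lambda>\<omega>. (\<xi> s \<omega> - \<xi> u \<omega>)\<^sup>2) < e"
      using ms_ucont_uniform[OF \<xi>(2) epos] by metis
    obtain N0 where N0: "\<And>N j. N \<ge> N0 \<Longrightarrow> j < n N \<Longrightarrow> \<tau> N (Suc j) - \<tau> N j < d"
      using mesh d(1) unfolding mesh_tendsto_0_def by meson
    show ?thesis
      by (intro exI[of _ N0] allI impI ballI sampled_close[OF part _ N0 d(2)])
  qed
  have "\<exists>N0. \<forall>N\<ge>N0. \<forall>N'\<ge>N0. expectation (\<lambda>\<omega>. (?S N \<omega> - ?S N' \<omega>)\<^sup>2) < e" if "e > 0" for e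
  proof -
    \<comment> \<open>Two sampled processes are each within \<open>e'\<close> of
      \<open>\<xi>\<close>; the square inequality turns this into \<open>4 * e'\<close> for their
      difference.\<close>
    define e' where "e' = e / (4 * (b - a) + 1)"
    have e': "e' > 0" using that ab by (simp add: e'_def)
    from close[OF this] obtain N0 where
      N0: "\<And>N s. N \<ge> N0 \<Longrightarrow> s \<in> {a..<b} \<Longrightarrow> expectation (\<lambda>\<omega>. (?P N s \<omega> - \<xi> s \<omega>)\<^sup>2) < e'"
      by meson
    have "expectation (\<lambda>\<omega>. (?S N \<omega> - ?S N' \<omega>)\<^sup>2) < e" if N: "N \<ge> N0" "N' \<ge> N0" for N N'
    proof -
      have "ennreal (expectation (\<lambda>\<omega>. (?S N \<omega> - ?S N' \<omega>)\<^sup>2)) = (\<integral>\<^sup>+\<omega>. ennreal ((?S N \<omega> - ?S N' \<omega>)\<^sup>2) \<partial>M)"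
        by (rule nn_integral_sq[symmetric]) (intro sq_integrable_diff sq)
      also have "\<dots> = (\<integral>\<^sup>+s. (\<integral>\<^sup>+\<omega>. ennreal ((?P N s \<omega> - ?P N' s \<omega>)\<^sup>2) \<partial>M) \<partial>lborel)"
        by (rule step_integral_isometry[OF sd sd ab(1,3) i])
      also have "\<dots> \<le> (\<integral>\<^sup>+s. ennreal (4 * e') * indicator {a..<b} s \<partial>lborel)"
      proof (rule nn_integral_mono)
        fix s
        show "(\<integral>\<^sup>+\<omega>. ennreal ((?P N s \<omega> - ?P N' s \<omega>)\<^sup>2) \<partial>M) \<le> ennreal (4 * e') * indicator {a..<b} s"
        proof (cases "s \<in> {a..<b}")
          case True
          then have "s \<in> {a..b}" by simp
          note sx = ms_ucontD[OF \<xi>(2) this]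
          have "expectation (\<lambda>\<omega>. (?P N s \<omega> - ?P N' s \<omega>)\<^sup>2) \<le>
              2 * expectation (\<lambda>\<omega>. (?P N s \<omega> - \<xi> s \<omega>)\<^sup>2) + 2 * expectation (\<lambda>\<omega>. (?P N' s \<omega> - \<xi> s \<omega>)\<^sup>2)"
            using integral_square_diff_le[OF sqP sx sqP, of N s N' s] by (simp add: power2_commute[of "\<xi> s _"])
          also have "\<dots> \<le> 4 * e'" using N0[OF N(1) True] N0[OF N(2) True] by linarith
          finally show ?thesis using True by (simp add: nn_integral_sq sq_integrable_diff sqP ennreal_leI)
        next
          case False
          then show ?thesis by (simp add: step_process_outside[OF part])
        qed
      qed
      also have "\<dots> = ennreal (4 * (e' * (b - a)))"
        using e' ab by (simp add: nn_integral_cmult ennreal_mult flip: mult.assoc)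
      finally have "expectation (\<lambda>\<omega>. (?S N \<omega> - ?S N' \<omega>)\<^sup>2) \<le> 4 * (e' * (b - a))"
        using e' ab by (subst (asm) ennreal_le_iff) auto
      also have "\<dots> < e' * (4 * (b - a) + 1)" using e' by (simp add: algebra_simps)
      also have "\<dots> = e" using ab by (simp add: e'_def)
      finally show ?thesis .
    qed
    then show ?thesis by blast
  qed
  moreover have "subalgebra M (F b)" using ab by (intro subalg) auto
  ultimately obtain I where I: "I \<in> borel_measurable (F b)" "sq_integrable M I"
    "(\<lambda>N. expectation (\<lambda>\<omega>. (?S N \<omega> - I \<omega>)\<^sup>2)) \<longlonglongrightarrow> 0"
    using ms_complete[of "F b" ?S, OF _ SF sq] by blast
  have ms: "has_ms_limit M ?S I" using has_ms_limit_iff[OF sq I(2)] I(3) by simp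
  define D where "D N s = (\<integral>\<^sup>+\<omega>. ennreal ((?P N s \<omega> - \<xi> s \<omega>)\<^sup>2) \<partial>M)" for N s
  have meas: "D N \<in> borel_measurable (restrict_space lborel {a..b})" for N
    unfolding D_def[abs_def] by (rule distance_measurable[OF part _ \<xi>(2)]) (rule step_dataD(5)[OF sd ab(1,3)])
  have "(\<lambda>N. \<integral>\<^sup>+s. D N s \<partial>restrict_space lborel {a..b}) \<longlonglongrightarrow> 0"
  proof (rule order_tendstoI)
    fix e :: ennreal assume "0 < e"
    then obtain r where r: "0 < r" "ennreal r < e"
      by (rule ennreal_pos_real_below)
    define e' where "e' = r / ((b - a) + 1)"
    have e': "e' > 0" using r ab by (simp add: e'_def)
    from close[OF this] obtain N0 where
      N0: "\<And>N s. N \<ge> N0 \<Longrightarrow> s \<in> {a..<b} \<Longrightarrow> expectation (\<lambda>\<omega>. (?P N s \<omega> - \<xi> s \<omega>)\<^sup>2) < e'"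
      by meson
    have "(\<integral>\<^sup>+s. D N s \<partial>restrict_space lborel {a..b}) < e" if N: "N \<ge> N0" for N
    proof -
      have "(\<integral>\<^sup>+s. D N s \<partial>restrict_space lborel {a..b}) = (\<integral>\<^sup>+s. D N s * indicator {a..b} s \<partial>lborel)"
        by (simp add: nn_integral_restrict_space)
      also have "\<dots> \<le> (\<integral>\<^sup>+s. ennreal e' * indicator {a..b} s \<partial>lborel)"
      proof (rule nn_integral_mono_AE)
        \<comment> \<open>At \<open>s = b\<close> every step process vanishes and need not be close
          to \<open>\<xi> b\<close>, so one null point is discarded.\<close>
        have "AE s in lborel. s \<noteq> b" by (rule AE_lborel_singleton)
        then show "AE s in lborel. D N s * indicator {a..b} s \<le> ennreal e' * indicator {a..b} s"
        proof eventually_elim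
          case (elim s)
          show ?case
          proof (cases "s \<in> {a..b}")
            case True
            then have s: "s \<in> {a..<b}" using elim by auto
            have "D N s = ennreal (expectation (\<lambda>\<omega>. (?P N s \<omega> - \<xi> s \<omega>)\<^sup>2))"
              unfolding D_def by (intro nn_integral_sq sq_integrable_diff sqP ms_ucontD[OF \<xi>(2) True])
            also have "\<dots> \<le> ennreal e'" using N0[OF N s] by (intro ennreal_leI) simp
            finally show ?thesis using True by simp
          qed simp
        qed
      qed
      also have "\<dots> = ennreal (e' * (b - a))"
        using e' ab by (simp add: nn_integral_cmult ennreal_mult)
      also have "\<dots> \<le> ennreal r"
      proof (rule ennreal_leI)
        have "e' * (b - a) \<le> e' * ((b - a) + 1)" using e' by (simp add: algebra_simps)
        also have "\<dots> = r" using ab by (simp add: e'_def)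
        finally show "e' * (b - a) \<le> r" .
      qed
      also have "\<dots> < e" by (rule r)
      finally show ?thesis .
    qed
    then show "\<forall>\<^sub>F N in sequentially. (\<integral>\<^sup>+s. D N s \<partial>restrict_space lborel {a..b}) < e"
      by (auto simp: eventually_sequentially)
  qed simp
  with meas sd ms I(1) \<xi>(1) have "has_ito_integral M F (f i) a b \<xi> I"
    unfolding has_ito_integral_def adapted_on_def D_def[abs_def]
    by (intro conjI exI[of _ n] exI[of _ \<tau>] exI[of _ "\<lambda>N j. \<xi> (\<tau> N j)"]) simp_all
  then show ?thesis by (rule exI[of "has_ito_integral M F (f i) a b \<xi>"])
qed

end

section \<open>The Ito integral as a process\<close>

text \<open>Induction on the number of subintervals: over the first \<open>l\<close> of them the
  error is at most \<open>e' * (\<tau> N l - a)\<close>, with \<open>e'\<close> a bound on the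
  oscillation of \<open>g\<close> over one subinterval.\<close>

lemma riemann_sum_tendsto:
  fixes g :: "real \<Rightarrow> real"
  assumes g: "continuous_on {a..b} g" and part: "\<And>N. partition_of a b (n N) (\<tau> N)" and mesh: "mesh_tendsto_0 n \<tau>"
  shows "(\<lambda>N. \<Sum>j<n N. g (\<tau> N j) * (\<tau> N (Suc j) - \<tau> N j)) \<longlonglongrightarrow> integral {a..b} g"
proof (rule LIMSEQ_I)
  fix e :: real assume "e > 0"
  have ab: "a \<le> b" using partition_ge[OF part, of "n 0" 0] part[of 0] by (simp add: partition_of_def)
  define e' where "e' = e / (b - a + 1)"
  have e': "e' > 0" using \<open>e > 0\<close> ab by (simp add: e'_def)
  have "uniformly_continuous_on {a..b} g" by (rule compact_uniformly_continuous[OF g compact_Icc])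
  from uniformly_continuous_onE[OF this e'] obtain d where d: "d > 0"
    "\<And>x x'. x \<in> {a..b} \<Longrightarrow> x' \<in> {a..b} \<Longrightarrow> dist x' x < d \<Longrightarrow> dist (g x') (g x) < e'" by metis
  obtain N0 where N0: "\<And>N j. N \<ge> N0 \<Longrightarrow> j < n N \<Longrightarrow> \<tau> N (Suc j) - \<tau> N j < d"
    using mesh d(1) unfolding mesh_tendsto_0_def by meson
  have "norm ((\<Sum>j<n N. g (\<tau> N j) * (\<tau> N (Suc j) - \<tau> N j)) - integral {a..b} g) < e" if N: "N \<ge> N0" for N
  proof -
    note p = part[of N]
    have int: "g integrable_on {x..y}" if "a \<le> x" "y \<le> b" for x y
      by (rule integrable_continuous_interval) (rule continuous_on_subset[OF g], use that in auto)
    have "\<bar>(\<Sum>j<l. g (\<tau> N j) * (\<tau> N (Suc j) - \<tau> N j)) - integral {a..\<tau> N l} g\<bar> \<le> e' * (\<tau> N l - a)"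
      if "l \<le> n N" for l using that
    proof (induction l)
      case 0
      then show ?case using p by (simp add: partition_of_def)
    next
      case (Suc l)
      have le: "a \<le> \<tau> N l" "\<tau> N l \<le> \<tau> N (Suc l)" "\<tau> N (Suc l) \<le> b"
        using Suc.prems partition_ge[OF p, of l] partition_mono[OF p, of l "Suc l"] partition_le[OF p, of "Suc l"] by auto
      have split: "integral {a..\<tau> N (Suc l)} g = integral {a..\<tau> N l} g + integral {\<tau> N l..\<tau> N (Suc l)} g"
        by (rule Henstock_Kurzweil_Integration.integral_combine[symmetric]) (use le int in auto)
      have "norm (integral {\<tau> N l..\<tau> N (Suc l)} (\<lambda>x. g x - g (\<tau> N l))) \<le> e' * (\<tau> N (Suc l) - \<tau> N l)"
      proof (rule integral_bound)
        show "\<tau> N l \<le> \<tau> N (Suc l)" by (rule le)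
        show "continuous_on {\<tau> N l..\<tau> N (Suc l)} (\<lambda>x. g x - g (\<tau> N l))"
          by (intro continuous_intros continuous_on_subset[OF g]) (use le in auto)
        fix x assume x: "x \<in> {\<tau> N l..\<tau> N (Suc l)}"
        have "x - \<tau> N l < d" using x N0[OF N, of l] Suc.prems by auto
        then show "norm (g x - g (\<tau> N l)) \<le> e'"
          using d(2)[of "\<tau> N l" x] x le by (simp add: dist_real_def)
      qed
      moreover have "integral {\<tau> N l..\<tau> N (Suc l)} (\<lambda>x. g x - g (\<tau> N l))
          = integral {\<tau> N l..\<tau> N (Suc l)} g - g (\<tau> N l) * (\<tau> N (Suc l) - \<tau> N l)"
        using le by (subst Henstock_Kurzweil_Integration.integral_diff) (auto intro!: int)
      ultimately have "\<bar>g (\<tau> N l) * (\<tau> N (Suc l) - \<tau> N l) - integral {\<tau> N l..\<tau> N (Suc l)} g\<bar> \<le> e' * (\<tau> N (Suc l) - \<tau> N l)"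
        by simp
      moreover have "\<bar>(\<Sum>j<l. g (\<tau> N j) * (\<tau> N (Suc j) - \<tau> N j)) - integral {a..\<tau> N l} g\<bar> \<le> e' * (\<tau> N l - a)"
        using Suc by simp
      moreover have "e' * (\<tau> N (Suc l) - \<tau> N l) + e' * (\<tau> N l - a) = e' * (\<tau> N (Suc l) - a)"
        by (simp add: algebra_simps)
      ultimately show ?case unfolding split sum.lessThan_Suc by linarith
    qed
    from this[of "n N"] have "\<bar>(\<Sum>j<n N. g (\<tau> N j) * (\<tau> N (Suc j) - \<tau> N j)) - integral {a..b} g\<bar> \<le> e' * (b - a)"
      using p by (simp add: partition_of_def)
    also have "\<dots> < e' * (b - a + 1)" using e' by simp
    also have "\<dots> = e" using ab by (simp add: e'_def)
    finally show ?thesis by simp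
  qed
  then show "\<exists>N0. \<forall>N\<ge>N0. norm ((\<Sum>j<n N. g (\<tau> N j) * (\<tau> N (Suc j) - \<tau> N j)) - integral {a..b} g) < e" by blast
qed

text \<open>The deterministic counterpart of \<open>iterated_ito\<close>, with the same outermost
  variable, so that the isometry can be iterated level by level.\<close>

primrec iterated_integral :: "(nat \<Rightarrow> real \<Rightarrow> real) \<Rightarrow> real \<Rightarrow> nat \<Rightarrow> real \<Rightarrow> real" where
  "iterated_integral c t 0 s = 1"
| "iterated_integral c t (Suc k) s = integral {t..s} (\<lambda>u. c (Suc k) u * iterated_integral c t k u)"

text \<open>Unfolds to the sum over \<open>l_1 < ... < l_k < n\<close> of the products of the
  \<open>c q (l_q)\<close>: the discrete counterpart of an integral over a simplex.\<close>

primrec ordered_sum :: "(nat \<Rightarrow> nat \<Rightarrow> real) \<Rightarrow> nat \<Rightarrow> nat \<Rightarrow> real" where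
  "ordered_sum c 0 n = 1"
| "ordered_sum c (Suc k) n = (\<Sum>l<n. ordered_sum c k l * c (Suc k) l)"

context wiener_process begin

lemma adapted_on_subset: "adapted_on a b \<xi> \<Longrightarrow> b' \<le> b \<Longrightarrow> adapted_on a b' \<xi>"
  by (simp add: adapted_on_def)

lemma has_ito_integral_ito_integral:
  assumes "i \<in> {1..m}" "0 \<le> a" "a \<le> b" "b \<le> T" "adapted_on a b \<xi>" "ms_ucont M {a..b} \<xi>"
  shows "has_ito_integral M F (f i) a b \<xi> (ito_integral M F (f i) a b \<xi>)"
  unfolding ito_integral_def
  using ito_integral_exists[OF assms] by (rule someI_ex)

lemma has_ito_integral_measurable: "has_ito_integral M F (f i) a b \<xi> I \<Longrightarrow> I \<in> borel_measurable (F b)"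
  unfolding has_ito_integral_def by blast

lemma has_ito_integral_sq_integrable:
  assumes "has_ito_integral M F (f i) a b \<xi> I" "0 \<le> a" "b \<le> T" "i \<in> {1..m}"
  shows "sq_integrable M I"
proof -
  obtain n \<tau> X where X: "\<And>N. step_data M F a b (n N) (\<tau> N) (X N)"
    and ms: "has_ms_limit M (\<lambda>N. step_integral (f i) (n N) (\<tau> N) (X N)) I"
    using assms(1) unfolding has_ito_integral_def by blast
  show ?thesis
    by (rule has_ms_limit_sq_integrable[OF ms]) (rule sq_integrable_step_integral[OF X assms(2-4)])
qed

text \<open>The two integrals are separately chosen versions, and additivity over intervals is not
  at hand. Both are therefore compared with one step integral: \<open>\<xi>\<close> sampled up to
  \<open>u\<close>, continued by zero up to \<open>s\<close>. The error on \<open>{a..<u}\<close> is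
  absorbed in \<open>\<epsilon>\<close>, the missing part on \<open>{u..<s}\<close> costs at most
  \<open>C\<close> per unit of time, and 8 is 2 from the splitting times 4 from
  \<open>ito_step_bound\<close>.\<close>

lemma ito_integral_increment_bound:
  assumes I: "has_ito_integral M F (f i) a s \<xi> I" and J: "has_ito_integral M F (f i) a u \<xi> J"
    and i: "i \<in> {1..m}" and a: "0 \<le> a" "a \<le> u" "u < s" "s \<le> T"
    and \<xi>: "adapted_on a s \<xi>" "ms_ucont M {a..s} \<xi>"
    and C: "C \<ge> 0" "\<And>v. v \<in> {a..s} \<Longrightarrow> expectation (\<lambda>\<omega>. (\<xi> v \<omega>)\<^sup>2) \<le> C"
  shows "expectation (\<lambda>\<omega>. (I \<omega> - J \<omega>)\<^sup>2) \<le> 8 * C * (s - u)"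
proof (rule field_le_epsilon)
  fix \<epsilon> :: real assume "\<epsilon> > 0"
  \<comment> \<open>The error \<open>e * (u - a)\<close> enters both comparisons, each with weight
    \<open>2 * 4\<close>, which makes 16.\<close>
  define e where "e = \<epsilon> / (16 * (u - a) + 1)"
  have e: "e > 0" using \<open>\<epsilon> > 0\<close> a by (simp add: e_def)
  have uT: "u \<le> T" using a by simp
  have \<xi>u: "adapted_on a u \<xi>" "ms_ucont M {a..u} \<xi>"
    using adapted_on_subset[OF \<xi>(1)] ms_ucont_subset[OF \<xi>(2)] a by auto
  obtain d where d: "d > 0"
    "\<And>v w. v \<in> {a..u} \<Longrightarrow> w \<in> {a..u} \<Longrightarrow> \<bar>v - w\<bar> < d \<Longrightarrow> expectation (\<lambda>\<omega>. (\<xi> v \<omega> - \<xi> w \<omega>)\<^sup>2) < e"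
    using ms_ucont_uniform[OF \<xi>u(2) e] by metis
  obtain n' \<tau>' where part': "\<And>N. partition_of a u (n' N) (\<tau>' N)" and mesh: "mesh_tendsto_0 n' \<tau>'"
    using uniform_partition_exists[OF a(2)] by metis
  from mesh[unfolded mesh_tendsto_0_def, rule_format, OF d(1)]
  obtain N where "\<forall>N'\<ge>N. \<forall>j<n' N'. \<tau>' N' (Suc j) - \<tau>' N' j < d" by blast
  then have N: "\<And>j. j < n' N \<Longrightarrow> \<tau>' N (Suc j) - \<tau>' N j < d" by simp
  define n \<tau> where "n = n' N" and "\<tau> = \<tau>' N"
  have part: "partition_of a u n \<tau>" and fine: "\<And>j. j < n \<Longrightarrow> \<tau> (Suc j) - \<tau> j < d"
    using part' N by (auto simp: n_def \<tau>_def)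
  define X where "X j = \<xi> (\<tau> j)" for j
  have sd: "step_data M F a u n \<tau> X" unfolding X_def by (rule step_data_sampled[OF a(1) uT part \<xi>u])
  \<comment> \<open>One further subinterval from \<open>u\<close> to \<open>s\<close> carries the
    value 0, so the step integral is unchanged while its partition ends at \<open>s\<close>.\<close>
  define \<tau>2 where "\<tau>2 j = (if j \<le> n then \<tau> j else s)" for j
  define X2 where "X2 j = (if j < n then X j else (\<lambda>\<omega>. 0))" for j
  have sd2: "step_data M F a s (Suc n) \<tau>2 X2"
    using sd a(3) by (auto simp: step_data_def partition_of_def \<tau>2_def X2_def less_Suc_eq)
  have part2: "partition_of a s (Suc n) \<tau>2" using sd2 by (simp add: step_data_def)
  have SI: "step_integral (f i) (Suc n) \<tau>2 X2 \<omega> = step_integral (f i) n \<tau> X \<omega>" for \<omega>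
    unfolding step_integral_def by (simp add: X2_def \<tau>2_def)
  have SP1: "step_process (Suc n) \<tau>2 X2 v \<omega> = step_process n \<tau> X v \<omega>" for v \<omega>
    unfolding step_process_def by (simp add: X2_def \<tau>2_def)
  let ?S = "step_integral (f i) n \<tau> X"
  have close: "(\<integral>\<^sup>+\<omega>. ennreal ((step_process n \<tau> X v \<omega> - \<xi> v \<omega>)\<^sup>2) \<partial>M) \<le> ennreal e" if v: "v \<in> {a..<u}" for v
  proof -
    have "(\<integral>\<^sup>+\<omega>. ennreal ((step_process n \<tau> X v \<omega> - \<xi> v \<omega>)\<^sup>2) \<partial>M)
        = ennreal (expectation (\<lambda>\<omega>. (step_process n \<tau> X v \<omega> - \<xi> v \<omega>)\<^sup>2))"
      using v by (intro nn_integral_sq sq_integrable_diff sq_integrable_step_process[OF sd a(1) uT] ms_ucontD[OF \<xi>u(2)]) auto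
    also have "\<dots> \<le> ennreal e"
      unfolding X_def by (intro ennreal_leI less_imp_le sampled_close[OF part v fine d(2)])
    finally show ?thesis .
  qed
  have "(\<integral>\<^sup>+\<omega>. ennreal ((?S \<omega> - J \<omega>)\<^sup>2) \<partial>M) \<le> 4 * (\<integral>\<^sup>+v. ennreal e * indicator {a..<u} v \<partial>lborel)"
    by (rule ito_step_bound[OF J sd a(1) uT i _ close]) simp_all
  also have "\<dots> = ennreal (4 * (e * (u - a)))"
    using e a by (simp add: nn_integral_cmult ennreal_mult)
  finally have B1: "(\<integral>\<^sup>+\<omega>. ennreal ((?S \<omega> - J \<omega>)\<^sup>2) \<partial>M) \<le> ennreal (4 * (e * (u - a)))" .
  define G where "G v = ennreal e * indicator {a..<u} v + ennreal C * indicator {u..<s} v" for v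
  have Gm: "G \<in> borel_measurable borel" unfolding G_def[abs_def] by measurable
  have "(\<integral>\<^sup>+\<omega>. ennreal ((step_integral (f i) (Suc n) \<tau>2 X2 \<omega> - I \<omega>)\<^sup>2) \<partial>M) \<le> 4 * (\<integral>\<^sup>+v. G v * indicator {a..<s} v \<partial>lborel)"
  proof (rule ito_step_bound[OF I sd2 a(1,4) i Gm])
    fix v assume v: "v \<in> {a..<s}"
    show "(\<integral>\<^sup>+\<omega>. ennreal ((step_process (Suc n) \<tau>2 X2 v \<omega> - \<xi> v \<omega>)\<^sup>2) \<partial>M) \<le> G v"
    proof (cases "v < u")
      case True
      then show ?thesis using close[of v] v by (simp add: SP1 G_def)
    next
      case False
      then have "step_process n \<tau> X v \<omega> = 0" for \<omega> by (intro step_process_outside[OF part]) simp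
      moreover have "(\<integral>\<^sup>+\<omega>. ennreal ((\<xi> v \<omega>)\<^sup>2) \<partial>M) \<le> ennreal C"
        using v C(2)[of v] by (subst nn_integral_sq) (auto intro: ms_ucontD[OF \<xi>(2)] ennreal_leI)
      ultimately show ?thesis using False v by (simp add: SP1 G_def)
    qed
  qed
  also have "(\<integral>\<^sup>+v. G v * indicator {a..<s} v \<partial>lborel) \<le> (\<integral>\<^sup>+v. G v \<partial>lborel)"
    by (intro nn_integral_mono) (auto simp: indicator_def)
  also have "(\<integral>\<^sup>+v. G v \<partial>lborel) = ennreal (e * (u - a) + C * (s - u))"
    unfolding G_def using e a C by (simp add: nn_integral_add nn_integral_cmult ennreal_mult ennreal_plus)
  also have "4 * \<dots> = ennreal (4 * (e * (u - a) + C * (s - u)))"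
    using e a C by (simp add: ennreal_mult)
  finally have B2: "(\<integral>\<^sup>+\<omega>. ennreal ((?S \<omega> - I \<omega>)\<^sup>2) \<partial>M) \<le> ennreal (4 * (e * (u - a) + C * (s - u)))"
    by (simp add: SI mult_left_mono)
  have sq: "sq_integrable M I" "sq_integrable M J" "sq_integrable M ?S"
    using has_ito_integral_sq_integrable[OF I a(1,4) i] has_ito_integral_sq_integrable[OF J a(1) uT i]
      sq_integrable_step_integral[OF sd a(1) uT i] by auto
  have b1: "expectation (\<lambda>\<omega>. (?S \<omega> - J \<omega>)\<^sup>2) \<le> 4 * (e * (u - a))"
    using B1 e a by (simp add: nn_integral_sq sq_integrable_diff sq ennreal_le_iff)
  have b2: "expectation (\<lambda>\<omega>. (I \<omega> - ?S \<omega>)\<^sup>2) \<le> 4 * (e * (u - a) + C * (s - u))"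
  proof -
    have "0 \<le> 4 * (e * (u - a) + C * (s - u))" using e a C by simp
    with B2[unfolded nn_integral_sq[OF sq_integrable_diff[OF sq(3,1)]]] show ?thesis
      by (simp only: ennreal_le_iff power2_commute[of "I _"])
  qed
  have "expectation (\<lambda>\<omega>. (I \<omega> - J \<omega>)\<^sup>2) \<le> 2 * expectation (\<lambda>\<omega>. (I \<omega> - ?S \<omega>)\<^sup>2) + 2 * expectation (\<lambda>\<omega>. (?S \<omega> - J \<omega>)\<^sup>2)"
    by (intro integral_square_diff_le sq)
  also have "\<dots> \<le> 16 * (e * (u - a)) + 8 * C * (s - u)"
    using b1 b2 by (simp add: algebra_simps)
  also have "16 * (e * (u - a)) \<le> e * (16 * (u - a) + 1)" using e by (simp add: algebra_simps)
  also have "e * (16 * (u - a) + 1) = \<epsilon>" using a by (simp add: e_def)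
  finally show "expectation (\<lambda>\<omega>. (I \<omega> - J \<omega>)\<^sup>2) \<le> 8 * C * (s - u) + \<epsilon>" by simp
qed

text \<open>The closure property behind the recursion of \<open>iterated_ito\<close>. Continuity
  comes from the bound on squared increments, which is linear in the length of the time
  step.\<close>

lemma ito_integral_process:
  assumes i: "i \<in> {1..m}" and a: "0 \<le> a" "b \<le> T"
    and \<xi>: "adapted_on a b \<xi>" "ms_ucont M {a..b} \<xi>"
  shows "adapted_on a b (\<lambda>s. ito_integral M F (f i) a s \<xi>)"
    and "ms_ucont M {a..b} (\<lambda>s. ito_integral M F (f i) a s \<xi>)"
proof -
  let ?J = "\<lambda>s. ito_integral M F (f i) a s \<xi>"
  have sub: "adapted_on a s \<xi>" "ms_ucont M {a..s} \<xi>" if "s \<in> {a..b}" for s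
    using adapted_on_subset[OF \<xi>(1)] ms_ucont_subset[OF \<xi>(2)] that by auto
  have ito: "has_ito_integral M F (f i) a s \<xi> (?J s)" if "s \<in> {a..b}" for s
    using that a by (intro has_ito_integral_ito_integral i sub[OF that]) auto
  show "adapted_on a b ?J"
    unfolding adapted_on_def using has_ito_integral_measurable[OF ito] by blast
  obtain C where C: "C > 0" "\<And>s. s \<in> {a..b} \<Longrightarrow> expectation (\<lambda>\<omega>. (\<xi> s \<omega>)\<^sup>2) \<le> C"
    using ms_ucont_bounded[OF \<xi>(2)] by metis
  have inc: "expectation (\<lambda>\<omega>. (?J s \<omega> - ?J u \<omega>)\<^sup>2) \<le> 8 * C * (s - u)"
    if "s \<in> {a..b}" "u \<in> {a..b}" "u < s" for s u
    by (rule ito_integral_increment_bound[OF ito[OF that(1)] ito[OF that(2)] i a(1) _ that(3) _ sub[OF that(1)]])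
      (use that a C in auto)
  show "ms_ucont M {a..b} ?J"
    unfolding ms_ucont_def
  proof (intro conjI ballI allI impI)
    show "sq_integrable M (?J s)" if "s \<in> {a..b}" for s
      by (rule has_ito_integral_sq_integrable[OF ito[OF that] a(1) _ i]) (use that a in auto)
    fix e :: real assume e: "e > 0"
    have "expectation (\<lambda>\<omega>. (?J s \<omega> - ?J u \<omega>)\<^sup>2) < e"
      if su: "s \<in> {a..b}" "u \<in> {a..b}" "\<bar>s - u\<bar> < e / (8 * C)" for s u
    proof -
      have *: "8 * C * \<bar>s - u\<bar> < e" using su(3) C(1) by (simp add: pos_less_divide_eq mult.commute)
      consider "u < s" | "s < u" | "s = u" by linarith
      then show ?thesis
      proof cases
        case 1
        then show ?thesis using inc[OF su(1,2)] * by simp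
      next
        case 2
        then have "expectation (\<lambda>\<omega>. (?J u \<omega> - ?J s \<omega>)\<^sup>2) < e" using inc[OF su(2,1)] * by simp
        then show ?thesis by (simp add: power2_commute[of "?J s _"])
      next
        case 3
        then show ?thesis using e by simp
      qed
    qed
    then show "\<exists>d>0. \<forall>s\<in>{a..b}. \<forall>u\<in>{a..b}. \<bar>s - u\<bar> < d \<longrightarrow> expectation (\<lambda>\<omega>. (?J s \<omega> - ?J u \<omega>)\<^sup>2) < e"
      using e C by (intro exI[of _ "e / (8 * C)"]) auto
  qed
qed

text \<open>Here the exact identity is obtained, not just a bound: both integrals are sampled on the
  same partitions, where subintervals overlap only with themselves, and the diagonal terms form a
  Riemann sum of the covariance.\<close>

lemma ito_integral_inner:
  assumes I: "has_ito_integral M F (f i) a b \<xi> I" and J: "has_ito_integral M F (f j) a b \<eta> J"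
    and ij: "i \<in> {1..m}" "j \<in> {1..m}" and a: "0 \<le> a" "a \<le> b" "b \<le> T"
    and \<xi>: "adapted_on a b \<xi>" "ms_ucont M {a..b} \<xi>" and \<eta>: "adapted_on a b \<eta>" "ms_ucont M {a..b} \<eta>"
  shows "expectation (\<lambda>\<omega>. I \<omega> * J \<omega>) = (if i = j then integral {a..b} (\<lambda>s. expectation (\<lambda>\<omega>. \<xi> s \<omega> * \<eta> s \<omega>)) else 0)"
proof -
  obtain n \<tau> where part: "\<And>N. partition_of a b (n N) (\<tau> N)" and mesh: "mesh_tendsto_0 n \<tau>"
    using uniform_partition_exists[OF a(2)] by metis
  note sd\<xi> = step_data_sampled[OF a(1,3) part \<xi>] and sd\<eta> = step_data_sampled[OF a(1,3) part \<eta>]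
  let ?S = "\<lambda>N. step_integral (f i) (n N) (\<tau> N) (\<lambda>l. \<xi> (\<tau> N l))"
  let ?R = "\<lambda>N. step_integral (f j) (n N) (\<tau> N) (\<lambda>l. \<eta> (\<tau> N l))"
  have sqS: "sq_integrable M (?S N)" for N by (rule sq_integrable_step_integral[OF sd\<xi> a(1,3) ij(1)])
  have sqR: "sq_integrable M (?R N)" for N by (rule sq_integrable_step_integral[OF sd\<eta> a(1,3) ij(2)])
  have sqI: "sq_integrable M I" "sq_integrable M J"
    using has_ito_integral_sq_integrable[OF I a(1,3) ij(1)] has_ito_integral_sq_integrable[OF J a(1,3) ij(2)] by auto
  have limS: "(\<lambda>N. expectation (\<lambda>\<omega>. (?S N \<omega> - I \<omega>)\<^sup>2)) \<longlonglongrightarrow> 0"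
    using sampled_ms_limit[OF I ij(1) a \<xi> part mesh] has_ms_limit_iff[of M ?S I, OF sqS sqI(1)] by blast
  have limR: "(\<lambda>N. expectation (\<lambda>\<omega>. (?R N \<omega> - J \<omega>)\<^sup>2)) \<longlonglongrightarrow> 0"
    using sampled_ms_limit[OF J ij(2) a \<eta> part mesh] has_ms_limit_iff[of M ?R J, OF sqR sqI(2)] by blast
  have lim: "(\<lambda>N. expectation (\<lambda>\<omega>. ?S N \<omega> * ?R N \<omega>)) \<longlonglongrightarrow> expectation (\<lambda>\<omega>. I \<omega> * J \<omega>)"
    by (rule integral_mult_tendsto[OF sqS sqI(1) limS sqR sqI(2) limR])
  define g where "g s = expectation (\<lambda>\<omega>. \<xi> s \<omega> * \<eta> s \<omega>)" for s
  have g: "continuous_on {a..b} g" unfolding g_def[abs_def] by (rule ms_ucont_continuous[OF \<xi>(2) \<eta>(2)])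
  have eq: "expectation (\<lambda>\<omega>. ?S N \<omega> * ?R N \<omega>)
      = (if i = j then \<Sum>l<n N. g (\<tau> N l) * (\<tau> N (Suc l) - \<tau> N l) else 0)" for N
  proof -
    note p = part[of N]
    let ?X = "\<lambda>l \<omega>. \<xi> (\<tau> N l) \<omega> * incr i (\<tau> N l) (\<tau> N (Suc l)) \<omega>"
    let ?Y = "\<lambda>l \<omega>. \<eta> (\<tau> N l) \<omega> * incr j (\<tau> N l) (\<tau> N (Suc l)) \<omega>"
    have sqX: "sq_integrable M (?X l)" "sq_integrable M (?Y l)" if "l < n N" for l
      using step_dataD[OF sd\<xi> a(1,3) that] step_dataD[OF sd\<eta> a(1,3) that] ij
      by (auto intro!: sq_integrable_mult_incr)
    have "expectation (\<lambda>\<omega>. ?S N \<omega> * ?R N \<omega>) = expectation (\<lambda>\<omega>. \<Sum>l<n N. \<Sum>r<n N. ?X l \<omega> * ?Y r \<omega>)"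
      unfolding step_integral_def by (simp only: incr_def[symmetric] sum_product)
    also have "\<dots> = (\<Sum>l<n N. \<Sum>r<n N. expectation (\<lambda>\<omega>. ?X l \<omega> * ?Y r \<omega>))"
      by (subst Bochner_Integration.integral_sum)
        (auto intro!: Bochner_Integration.integrable_sum sq_integrable_mult sqX sum.cong Bochner_Integration.integral_sum)
    also have "\<dots> = (\<Sum>l<n N. \<Sum>r<n N. if r = l then (if i = j then g (\<tau> N l) * (\<tau> N (Suc l) - \<tau> N l) else 0) else 0)"
    proof (intro sum.cong refl)
      fix l r assume "l \<in> {..<n N}" "r \<in> {..<n N}"
      then have lr: "l < n N" "r < n N" by auto
      note dl = step_dataD[OF sd\<xi> a(1,3) lr(1)] and dr = step_dataD[OF sd\<eta> a(1,3) lr(2)]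
      have "expectation (\<lambda>\<omega>. ?X l \<omega> * ?Y r \<omega>) =
        (if i = j then expectation (\<lambda>\<omega>. \<xi> (\<tau> N l) \<omega> * \<eta> (\<tau> N r) \<omega>) * overlap (\<tau> N l) (\<tau> N (Suc l)) (\<tau> N r) (\<tau> N (Suc r)) else 0)"
        by (rule elementary_isometry[OF ij dl(1-3) dr(1-3) dl(4,5) dr(4,5)])
      moreover have "overlap (\<tau> N l) (\<tau> N (Suc l)) (\<tau> N r) (\<tau> N (Suc r)) = (if r = l then \<tau> N (Suc l) - \<tau> N l else 0)"
      proof -
        consider "r = l" | "Suc r \<le> l" | "Suc l \<le> r" by linarith
        then show ?thesis
        proof cases
          case 1 then show ?thesis using dl by (simp add: overlap_def)
        next
          case 2 then show ?thesis using partition_mono[OF p 2] lr by (simp add: overlap_def)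
        next
          case 3 then show ?thesis using partition_mono[OF p 3] lr by (simp add: overlap_def)
        qed
      qed
      ultimately show "expectation (\<lambda>\<omega>. ?X l \<omega> * ?Y r \<omega>) =
          (if r = l then (if i = j then g (\<tau> N l) * (\<tau> N (Suc l) - \<tau> N l) else 0) else 0)"
        by (cases "r = l"; cases "i = j") (auto simp: g_def)
    qed
    also have "\<dots> = (\<Sum>l<n N. if i = j then g (\<tau> N l) * (\<tau> N (Suc l) - \<tau> N l) else 0)"
      by (intro sum.cong refl) simp
    finally show ?thesis by simp
  qed
  show ?thesis
  proof (cases "i = j")
    case True
    then have eqT: "expectation (\<lambda>\<omega>. ?S N \<omega> * ?R N \<omega>) = (\<Sum>l<n N. g (\<tau> N l) * (\<tau> N (Suc l) - \<tau> N l))" for N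
      using eq[of N] by presburger
    have "(\<lambda>N. expectation (\<lambda>\<omega>. ?S N \<omega> * ?R N \<omega>)) \<longlonglongrightarrow> integral {a..b} g"
      unfolding eqT by (rule riemann_sum_tendsto[OF g part mesh])
    from LIMSEQ_unique[OF lim this] True show ?thesis by (simp add: g_def[abs_def])
  next
    case False
    then have "(\<lambda>N. expectation (\<lambda>\<omega>. ?S N \<omega> * ?R N \<omega>)) \<longlonglongrightarrow> 0" by (simp add: eq)
    from LIMSEQ_unique[OF lim this] False show ?thesis by simp
  qed
qed

lemma adapted_on_scale: "adapted_on a b \<xi> \<Longrightarrow> adapted_on a b (\<lambda>s \<omega>. g s * \<xi> s \<omega>)"
  by (auto simp: adapted_on_def)

section \<open>Iterated stochastic integrals and their inner products\<close>

lemma iterated_ito_process: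
  assumes "0 \<le> t" "\<And>l. l \<in> {1..k} \<Longrightarrow> i l \<in> {1..m}" "\<And>l. l \<in> {1..k} \<Longrightarrow> continuous_on {t..T} (\<psi> l)"
  shows "adapted_on t T (iterated_ito M F f t \<psi> i k) \<and> ms_ucont M {t..T} (iterated_ito M F f t \<psi> i k)"
  using assms(2,3)
proof (induction k)
  case 0
  then show ?case by (simp add: adapted_on_def ms_ucont_const sq_integrable_const)
next
  case (Suc k)
  let ?\<xi> = "\<lambda>u \<omega>. \<psi> (Suc k) u * iterated_ito M F f t \<psi> i k u \<omega>"
  have IH: "adapted_on t T (iterated_ito M F f t \<psi> i k)" "ms_ucont M {t..T} (iterated_ito M F f t \<psi> i k)"
    using Suc by auto
  have "adapted_on t T ?\<xi>" by (rule adapted_on_scale[OF IH(1)])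
  moreover have "ms_ucont M {t..T} ?\<xi>" by (rule ms_ucont_scale[OF _ IH(2)]) (use Suc.prems in auto)
  ultimately show ?case
    using ito_integral_process[of "i (Suc k)" t T ?\<xi>] Suc.prems assms(1) by simp
qed

lemma iterated_ito_integrand:
  assumes "0 \<le> t" "\<And>l. l \<in> {1..Suc k} \<Longrightarrow> i l \<in> {1..m}" "\<And>l. l \<in> {1..Suc k} \<Longrightarrow> continuous_on {t..T} (\<psi> l)"
    and s: "s \<in> {t..T}"
  shows "adapted_on t s (\<lambda>u \<omega>. \<psi> (Suc k) u * iterated_ito M F f t \<psi> i k u \<omega>)"
    and "ms_ucont M {t..s} (\<lambda>u \<omega>. \<psi> (Suc k) u * iterated_ito M F f t \<psi> i k u \<omega>)"
    and "has_ito_integral M F (f (i (Suc k))) t s (\<lambda>u \<omega>. \<psi> (Suc k) u * iterated_ito M F f t \<psi> i k u \<omega>)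
      (iterated_ito M F f t \<psi> i (Suc k) s)"
proof -
  let ?\<xi> = "\<lambda>u \<omega>. \<psi> (Suc k) u * iterated_ito M F f t \<psi> i k u \<omega>"
  have p: "adapted_on t T (iterated_ito M F f t \<psi> i k)" "ms_ucont M {t..T} (iterated_ito M F f t \<psi> i k)"
    using iterated_ito_process[of t k i \<psi>] assms by auto
  have "adapted_on t T ?\<xi>" by (rule adapted_on_scale[OF p(1)])
  then show 1: "adapted_on t s ?\<xi>" using s by (rule_tac adapted_on_subset) auto
  have "ms_ucont M {t..T} ?\<xi>" by (rule ms_ucont_scale[OF _ p(2)]) (use assms in auto)
  then show 2: "ms_ucont M {t..s} ?\<xi>" using s by (rule_tac ms_ucont_subset) auto
  show "has_ito_integral M F (f (i (Suc k))) t s ?\<xi> (iterated_ito M F f t \<psi> i (Suc k) s)"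
    unfolding iterated_ito.simps by (rule has_ito_integral_ito_integral[OF _ _ _ _ 1 2]) (use assms in auto)
qed

text \<open>One application of \<open>ito_integral_inner\<close> removes the outermost level on both
  sides; a single level with different components makes the whole inner product vanish. The end time
  \<open>s\<close> varies in the induction because the inner integrals are evaluated at every
  \<open>u\<close>.\<close>

lemma iterated_ito_inner:
  assumes "0 \<le> t" and s: "s \<in> {t..T}"
    and "\<And>l. l \<in> {1..k} \<Longrightarrow> i l \<in> {1..m}" "\<And>l. l \<in> {1..k} \<Longrightarrow> continuous_on {t..T} (\<psi> l)"
    and "\<And>l. l \<in> {1..k} \<Longrightarrow> i' l \<in> {1..m}" "\<And>l. l \<in> {1..k} \<Longrightarrow> continuous_on {t..T} (\<psi>' l)"
  shows "expectation (\<lambda>\<omega>. iterated_ito M F f t \<psi> i k s \<omega> * iterated_ito M F f t \<psi>' i' k s \<omega>)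
    = (if \<forall>l\<in>{1..k}. i l = i' l then iterated_integral (\<lambda>l u. \<psi> l u * \<psi>' l u) t k s else 0)"
  using assms(2-)
proof (induction k arbitrary: s)
  case 0
  then show ?case by (simp add: prob_space)
next
  case (Suc k)
  let ?J = "iterated_ito M F f t \<psi> i k" and ?J' = "iterated_ito M F f t \<psi>' i' k"
  note A = iterated_ito_integrand[OF \<open>0 \<le> t\<close> Suc.prems(2,3,1)]
  note B = iterated_ito_integrand[OF \<open>0 \<le> t\<close> Suc.prems(4,5,1)]
  have "expectation (\<lambda>\<omega>. iterated_ito M F f t \<psi> i (Suc k) s \<omega> * iterated_ito M F f t \<psi>' i' (Suc k) s \<omega>)
     = (if i (Suc k) = i' (Suc k) then integral {t..s}
         (\<lambda>u. expectation (\<lambda>\<omega>. (\<psi> (Suc k) u * ?J u \<omega>) * (\<psi>' (Suc k) u * ?J' u \<omega>))) else 0)"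
    by (rule ito_integral_inner[OF A(3) B(3) _ _ \<open>0 \<le> t\<close> _ _ A(1,2) B(1,2)]) (use Suc.prems in auto)
  also have "integral {t..s} (\<lambda>u. expectation (\<lambda>\<omega>. (\<psi> (Suc k) u * ?J u \<omega>) * (\<psi>' (Suc k) u * ?J' u \<omega>)))
     = integral {t..s} (\<lambda>u. (\<psi> (Suc k) u * \<psi>' (Suc k) u) *
        (if \<forall>l\<in>{1..k}. i l = i' l then iterated_integral (\<lambda>l u. \<psi> l u * \<psi>' l u) t k u else 0))"
  proof (rule integral_cong)
    fix u assume u: "u \<in> {t..s}"
    have "expectation (\<lambda>\<omega>. (\<psi> (Suc k) u * ?J u \<omega>) * (\<psi>' (Suc k) u * ?J' u \<omega>))
        = expectation (\<lambda>\<omega>. (\<psi> (Suc k) u * \<psi>' (Suc k) u) * (?J u \<omega> * ?J' u \<omega>))"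
      by (simp add: mult_ac)
    also have "\<dots> = (\<psi> (Suc k) u * \<psi>' (Suc k) u) * expectation (\<lambda>\<omega>. ?J u \<omega> * ?J' u \<omega>)"
      by (rule integral_mult_right_zero)
    also have "expectation (\<lambda>\<omega>. ?J u \<omega> * ?J' u \<omega>)
        = (if \<forall>l\<in>{1..k}. i l = i' l then iterated_integral (\<lambda>l u. \<psi> l u * \<psi>' l u) t k u else 0)"
      by (rule Suc.IH) (use Suc.prems u in auto)
    finally show "expectation (\<lambda>\<omega>. (\<psi> (Suc k) u * ?J u \<omega>) * (\<psi>' (Suc k) u * ?J' u \<omega>))
      = (\<psi> (Suc k) u * \<psi>' (Suc k) u) * (if \<forall>l\<in>{1..k}. i l = i' l then iterated_integral (\<lambda>l u. \<psi> l u * \<psi>' l u) t k u else 0)" .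
  qed
  finally have *: "expectation (\<lambda>\<omega>. iterated_ito M F f t \<psi> i (Suc k) s \<omega> * iterated_ito M F f t \<psi>' i' (Suc k) s \<omega>)
     = (if i (Suc k) = i' (Suc k) then integral {t..s} (\<lambda>u. (\<psi> (Suc k) u * \<psi>' (Suc k) u) *
        (if \<forall>l\<in>{1..k}. i l = i' l then iterated_integral (\<lambda>l u. \<psi> l u * \<psi>' l u) t k u else 0)) else 0)" .
  define P where "P \<longleftrightarrow> (\<forall>l\<in>{1..k}. i l = i' l)"
  have P': "(\<forall>l\<in>{1..Suc k}. i l = i' l) \<longleftrightarrow> i (Suc k) = i' (Suc k) \<and> P"
    by (auto simp: P_def atLeastAtMostSuc_conv)
  show ?case unfolding * P_def[symmetric] P' by (cases P) simp_all
qed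

end

section \<open>Ordered sums and iterated integrals\<close>

lemma partition_of_initial: "partition_of a b n \<tau> \<Longrightarrow> j \<le> n \<Longrightarrow> partition_of a (\<tau> j) j \<tau>"
  by (auto simp: partition_of_def)

text \<open>For sequences of partitions that start at \<open>N = 1\<close>. The term with index 0
  does not affect the limit, but \<open>has_ms_limit\<close> asks for its measurability.\<close>

lemma has_ms_limit_SucI:
  assumes "has_ms_limit M (\<lambda>n. X (Suc n)) Y" "X 0 \<in> borel_measurable M"
  shows "has_ms_limit M X Y"
proof -
  have "X n \<in> borel_measurable M" for n
    using assms by (cases n) (auto simp: has_ms_limit_def)
  then show ?thesis using assms(1) unfolding has_ms_limit_def
    by (subst filterlim_sequentially_Suc[symmetric]) simp
qed

context wiener_process begin

definition weighted_incr :: "(nat \<Rightarrow> real \<Rightarrow> real) \<Rightarrow> (nat \<Rightarrow> nat) \<Rightarrow> (nat \<Rightarrow> real) \<Rightarrow> 'a \<Rightarrow> nat \<Rightarrow> nat \<Rightarrow> real" where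
  "weighted_incr \<psi> i \<tau> \<omega> q l = \<psi> q (\<tau> l) * incr (i q) (\<tau> l) (\<tau> (Suc l)) \<omega>"

text \<open>The integrand on the right is an ordered sum of lower order, frozen at the left ends. So
  the bounds for step integrals apply at every level.\<close>

lemma ordered_sum_step_integral:
  "ordered_sum (weighted_incr \<psi> i \<tau> \<omega>) (Suc k) n =
    step_integral (f (i (Suc k))) n \<tau> (\<lambda>l \<omega>. \<psi> (Suc k) (\<tau> l) * ordered_sum (weighted_incr \<psi> i \<tau> \<omega>) k l) \<omega>"
  by (simp add: step_integral_def weighted_incr_def incr_def mult_ac)

lemma ordered_sum_adapted:
  assumes "0 \<le> a" "b \<le> T" "partition_of a b n \<tau>" "\<And>l. l \<in> {1..k} \<Longrightarrow> i l \<in> {1..m}" "j \<le> n"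
  shows "(\<lambda>\<omega>. ordered_sum (weighted_incr \<psi> i \<tau> \<omega>) k j) \<in> borel_measurable (F (\<tau> j)) \<and>
    sq_integrable M (\<lambda>\<omega>. ordered_sum (weighted_incr \<psi> i \<tau> \<omega>) k j)"
  using assms(4,5)
proof (induction k arbitrary: j)
  case 0
  then show ?case by (simp add: sq_integrable_const)
next
  case (Suc k)
  have "\<tau> j \<le> b" using partition_le[OF assms(3)] Suc.prems by simp
  then have T: "\<tau> j \<le> T" using assms by simp
  have IH: "(\<lambda>\<omega>. ordered_sum (weighted_incr \<psi> i \<tau> \<omega>) k l) \<in> borel_measurable (F (\<tau> l))"
    "sq_integrable M (\<lambda>\<omega>. ordered_sum (weighted_incr \<psi> i \<tau> \<omega>) k l)" if "l < j" for l
    using Suc.IH[of l] Suc.prems that by auto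
  have "step_data M F a (\<tau> j) j \<tau> (\<lambda>l \<omega>. \<psi> (Suc k) (\<tau> l) * ordered_sum (weighted_incr \<psi> i \<tau> \<omega>) k l)"
    unfolding step_data_def
    using partition_of_initial[OF assms(3) Suc.prems(2)] IH(1) sq_integrable_cmult[OF IH(2)]
    by (auto simp: sq_integrable_def)
  from step_integral_measurable_F[OF this assms(1) T, of "i (Suc k)"]
    sq_integrable_step_integral[OF this assms(1) T, of "i (Suc k)"]
  show ?case unfolding ordered_sum_step_integral using Suc.prems(1)[of "Suc k"] by simp
qed

text \<open>The approximation has to be uniform in the end index \<open>j\<close>, since at the next
  level the inner sum is used at all partition points at once.\<close>

lemma ordered_sum_uniform_limit:
  assumes t: "0 \<le> t" "t \<le> T" and i: "\<And>l. l \<in> {1..k} \<Longrightarrow> i l \<in> {1..m}"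
    and \<psi>: "\<And>l. l \<in> {1..k} \<Longrightarrow> continuous_on {t..T} (\<psi> l)"
    and part: "\<And>N. partition_of t T (n N) (\<tau> N)" and mesh: "mesh_tendsto_0 n \<tau>" and e: "e > 0"
  shows "\<exists>N0. \<forall>N\<ge>N0. \<forall>j\<le>n N. expectation (\<lambda>\<omega>. (ordered_sum (weighted_incr \<psi> i (\<tau> N) \<omega>) k j
    - iterated_ito M F f t \<psi> i k (\<tau> N j) \<omega>)\<^sup>2) < e"
  using i \<psi> e
proof (induction k arbitrary: e)
  case 0
  then show ?case by simp
next
  case (Suc k)
  let ?D = "\<lambda>N j \<omega>. ordered_sum (weighted_incr \<psi> i (\<tau> N) \<omega>) k j"
  let ?J = "iterated_ito M F f t \<psi> i k"
  define L where "L = T - t + 1"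
  have L: "L > 0" using t by (simp add: L_def)
  define \<xi> where "\<xi> u \<omega> = \<psi> (Suc k) u * ?J u \<omega>" for u \<omega>
  have ts: "T \<in> {t..T}" using t by simp
  have \<xi>: "ms_ucont M {t..T} \<xi>"
    using iterated_ito_integrand(2)[OF t(1) Suc.prems(1,2) ts] unfolding \<xi>_def[abs_def] by simp
  have J: "ms_ucont M {t..T} ?J" using iterated_ito_process[of t k i \<psi>] t Suc.prems by auto
  obtain B where B: "B > 0" "\<And>s. s \<in> {t..T} \<Longrightarrow> (\<psi> (Suc k) s)\<^sup>2 \<le> B"
  proof -
    have "continuous_on {t..T} (\<psi> (Suc k))" by (rule Suc.prems(2)) simp
    from continuous_on_bounded_sq[OF this] show ?thesis using that by metis
  qed
  \<comment> \<open>These make \<open>4 * (2 * (B * e1) + 2 * e2) * L = e / 2\<close>: 4 from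
    \<open>ito_step_bound\<close>, the inner 2s from splitting the distance into the error of the
    inner sum and the oscillation of \<open>\<xi>\<close>, and \<open>L\<close> bounds the length of
    the interval.\<close>
  define e1 e2 where "e1 = e / (32 * B * L)" and "e2 = e / (32 * L)"
  have e12: "e1 > 0" "e2 > 0" using Suc.prems(3) B L by (auto simp: e1_def e2_def)
  have "\<exists>N0. \<forall>N\<ge>N0. \<forall>j\<le>n N. expectation (\<lambda>\<omega>. (?D N j \<omega> - ?J (\<tau> N j) \<omega>)\<^sup>2) < e1"
    by (rule Suc.IH) (use Suc.prems e12 in auto)
  then obtain N1 where N1: "\<And>N j. N \<ge> N1 \<Longrightarrow> j \<le> n N \<Longrightarrow> expectation (\<lambda>\<omega>. (?D N j \<omega> - ?J (\<tau> N j) \<omega>)\<^sup>2) < e1"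
    by blast
  obtain d where d: "d > 0"
    "\<And>s u. s \<in> {t..T} \<Longrightarrow> u \<in> {t..T} \<Longrightarrow> \<bar>s - u\<bar> < d \<Longrightarrow> expectation (\<lambda>\<omega>. (\<xi> s \<omega> - \<xi> u \<omega>)\<^sup>2) < e2"
    using ms_ucont_uniform[OF \<xi> e12(2)] by metis
  from mesh[unfolded mesh_tendsto_0_def, rule_format, OF d(1)]
  obtain N2 where N2: "\<And>N j. N \<ge> N2 \<Longrightarrow> j < n N \<Longrightarrow> \<tau> N (Suc j) - \<tau> N j < d" by blast
  have "expectation (\<lambda>\<omega>. (ordered_sum (weighted_incr \<psi> i (\<tau> N) \<omega>) (Suc k) j
      - iterated_ito M F f t \<psi> i (Suc k) (\<tau> N j) \<omega>)\<^sup>2) < e" if N: "N \<ge> max N1 N2" "j \<le> n N" for N j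
  proof -
    note p = part[of N]
    have \<tau>j: "\<tau> N j \<in> {t..T}" using partition_ge[OF p N(2)] partition_le[OF p N(2)] by simp
    have \<tau>jT: "\<tau> N j \<le> T" and ij: "i (Suc k) \<in> {1..m}" using \<tau>j Suc.prems(1)[of "Suc k"] by auto
    note pj = partition_of_initial[OF p N(2)]
    define X where "X l \<omega> = \<psi> (Suc k) (\<tau> N l) * ?D N l \<omega>" for l \<omega>
    have Dm: "?D N l \<in> borel_measurable (F (\<tau> N l))" "sq_integrable M (?D N l)" if "l \<le> n N" for l
      using ordered_sum_adapted[OF t(1) order_refl p _ that, of k i \<psi>] Suc.prems(1) by auto
    have sd: "step_data M F t (\<tau> N j) j (\<tau> N) X"
      unfolding step_data_def X_def[abs_def]
      using pj Dm N(2) sq_integrable_cmult[OF Dm(2)] by (auto simp: sq_integrable_def)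
    have ito: "has_ito_integral M F (f (i (Suc k))) t (\<tau> N j) \<xi> (iterated_ito M F f t \<psi> i (Suc k) (\<tau> N j))"
      using iterated_ito_integrand(3)[OF t(1) Suc.prems(1,2) \<tau>j] unfolding \<xi>_def[abs_def] by simp
    define C where "C = 2 * (B * e1) + 2 * e2"
    have C: "C \<ge> 0" using e12 B by (simp add: C_def)
    have close: "(\<integral>\<^sup>+\<omega>. ennreal ((step_process j (\<tau> N) X s \<omega> - \<xi> s \<omega>)\<^sup>2) \<partial>M) \<le> ennreal C"
      if s: "s \<in> {t..<\<tau> N j}" for s
    proof -
      obtain l where l: "l < j" "\<tau> N l \<le> s" "s < \<tau> N (Suc l)"
        "\<And>(X::nat \<Rightarrow> 'a \<Rightarrow> real) \<omega>. step_process j (\<tau> N) X s \<omega> = X l \<omega>"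
        using partition_cover[OF pj, of s] s by (metis atLeastLessThan_iff)
      have ln: "l \<le> n N" "l < n N" using l N by auto
      have \<tau>l: "\<tau> N l \<in> {t..T}" using partition_ge[OF p ln(1)] partition_le[OF p ln(1)] by simp
      have s': "s \<in> {t..T}" using s \<tau>j by auto
      have sq: "sq_integrable M (X l)" "sq_integrable M (\<xi> (\<tau> N l))" "sq_integrable M (\<xi> s)"
        using sq_integrable_cmult[OF Dm(2)[OF ln(1)]] ms_ucontD[OF \<xi> \<tau>l] ms_ucontD[OF \<xi> s'] by (auto simp: X_def[abs_def])
      have "expectation (\<lambda>\<omega>. (X l \<omega> - \<xi> s \<omega>)\<^sup>2) \<le>
          2 * expectation (\<lambda>\<omega>. (X l \<omega> - \<xi> (\<tau> N l) \<omega>)\<^sup>2) + 2 * expectation (\<lambda>\<omega>. (\<xi> (\<tau> N l) \<omega> - \<xi> s \<omega>)\<^sup>2)"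
        by (rule integral_square_diff_le[OF sq])
      also have "expectation (\<lambda>\<omega>. (X l \<omega> - \<xi> (\<tau> N l) \<omega>)\<^sup>2)
          = (\<psi> (Suc k) (\<tau> N l))\<^sup>2 * expectation (\<lambda>\<omega>. (?D N l \<omega> - ?J (\<tau> N l) \<omega>)\<^sup>2)"
        unfolding X_def \<xi>_def by (simp add: power_mult_distrib flip: right_diff_distrib)
      also have "\<dots> \<le> B * e1"
        using B(2)[OF \<tau>l] N1[of N l] N ln B(1) by (intro mult_mono) auto
      also have "expectation (\<lambda>\<omega>. (\<xi> (\<tau> N l) \<omega> - \<xi> s \<omega>)\<^sup>2) \<le> e2"
        using N2[of N l] N ln l by (intro less_imp_le d(2)[OF \<tau>l s']) auto
      finally have "expectation (\<lambda>\<omega>. (X l \<omega> - \<xi> s \<omega>)\<^sup>2) \<le> C" by (simp add: C_def)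
      then show ?thesis by (simp add: l(4) nn_integral_sq sq_integrable_diff sq ennreal_leI)
    qed
    let ?S = "step_integral (f (i (Suc k))) j (\<tau> N) X" and ?I = "iterated_ito M F f t \<psi> i (Suc k) (\<tau> N j)"
    have "(\<integral>\<^sup>+\<omega>. ennreal ((?S \<omega> - ?I \<omega>)\<^sup>2) \<partial>M) \<le> 4 * (\<integral>\<^sup>+s. ennreal C * indicator {t..<\<tau> N j} s \<partial>lborel)"
      by (rule ito_step_bound[OF ito sd t(1) \<tau>jT ij _ close]) simp_all
    also have "\<dots> = ennreal (4 * (C * (\<tau> N j - t)))"
      using C \<tau>j by (simp add: nn_integral_cmult ennreal_mult)
    finally have b: "(\<integral>\<^sup>+\<omega>. ennreal ((?S \<omega> - ?I \<omega>)\<^sup>2) \<partial>M) \<le> ennreal (4 * (C * (\<tau> N j - t)))" .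
    have sqd: "sq_integrable M (\<lambda>\<omega>. ?S \<omega> - ?I \<omega>)"
      by (rule sq_integrable_diff[OF sq_integrable_step_integral[OF sd t(1) \<tau>jT ij]
          has_ito_integral_sq_integrable[OF ito t(1) \<tau>jT ij]])
    have "0 \<le> 4 * (C * (\<tau> N j - t))" using C \<tau>j by simp
    with b[unfolded nn_integral_sq[OF sqd]] have "expectation (\<lambda>\<omega>. (?S \<omega> - ?I \<omega>)\<^sup>2) \<le> 4 * (C * (\<tau> N j - t))"
      by (simp only: ennreal_le_iff)
    also have "\<dots> \<le> 4 * (C * L)" using C \<tau>j by (intro mult_left_mono) (auto simp: L_def)
    also have "4 * (C * L) = e / 2"
    proof -
      have "B * e1 * L = e / 32" "e2 * L = e / 32" using B(1) L by (auto simp: e1_def e2_def)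
      then show ?thesis by (simp add: C_def algebra_simps)
    qed
    also have "e / 2 < e" using Suc.prems(3) by simp
    finally show ?thesis unfolding ordered_sum_step_integral X_def[abs_def] .
  qed
  then show ?case by blast
qed

lemma ordered_sum_ms_limit:
  assumes t: "0 \<le> t" "t \<le> T" and i: "\<And>l. l \<in> {1..k} \<Longrightarrow> i l \<in> {1..m}"
    and \<psi>: "\<And>l. l \<in> {1..k} \<Longrightarrow> continuous_on {t..T} (\<psi> l)"
    and part: "\<And>N. partition_of t T (n N) (\<tau> N)" and mesh: "mesh_tendsto_0 n \<tau>"
  shows "(\<lambda>N. expectation (\<lambda>\<omega>. (ordered_sum (weighted_incr \<psi> i (\<tau> N) \<omega>) k (n N)
    - iterated_ito M F f t \<psi> i k T \<omega>)\<^sup>2)) \<longlonglongrightarrow> 0"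
proof (rule LIMSEQ_I)
  fix e :: real assume "e > 0"
  from ordered_sum_uniform_limit[where k = k and i = i and \<psi> = \<psi>, OF assms \<open>e > 0\<close>] obtain N0 where N0: "\<And>N j. N \<ge> N0 \<Longrightarrow> j \<le> n N \<Longrightarrow>
      expectation (\<lambda>\<omega>. (ordered_sum (weighted_incr \<psi> i (\<tau> N) \<omega>) k j - iterated_ito M F f t \<psi> i k (\<tau> N j) \<omega>)\<^sup>2) < e"
    by blast
  have "norm (expectation (\<lambda>\<omega>. (ordered_sum (weighted_incr \<psi> i (\<tau> N) \<omega>) k (n N)
    - iterated_ito M F f t \<psi> i k T \<omega>)\<^sup>2) - 0) < e" if "N \<ge> N0" for N
  proof -
    have "\<tau> N (n N) = T" using part[of N] by (simp add: partition_of_def)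
    with N0[OF that order_refl] show ?thesis by simp
  qed
  then show "\<exists>N0. \<forall>N\<ge>N0. norm (expectation (\<lambda>\<omega>. (ordered_sum (weighted_incr \<psi> i (\<tau> N) \<omega>) k (n N)
    - iterated_ito M F f t \<psi> i k T \<omega>)\<^sup>2) - 0) < e" by blast
qed

section \<open>Characteristic functions of linear functionals of the increments\<close>

text \<open>\<open>Z\<close> stands for the exponential of everything before time \<open>s\<close>;
  it factors off by independence of the future, and the remaining exponential factors over the
  components.\<close>

lemma char_incr_vector:
  fixes Z :: "'a \<Rightarrow> complex"
  assumes s: "0 \<le> s" "s \<le> u" "u \<le> T" and Z: "Z \<in> borel_measurable (F s)" "integrable M Z"
  shows "(CLINT \<omega>|M. Z \<omega> * iexp (\<Sum>q\<in>{1..m}. c q * incr q s u \<omega>))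
    = (CLINT \<omega>|M. Z \<omega>) * exp (- ((\<Sum>q\<in>{1..m}. (c q)\<^sup>2) * (u - s)) / 2)"
proof (cases "s = u")
  case True
  then show ?thesis by simp
next
  case False
  then have "s < u" using s by simp
  define g where "g x = iexp (\<Sum>q\<in>{1..m}. c q * x q)" for x :: "nat \<Rightarrow> real"
  have gm: "g \<in> borel_measurable (\<Pi>\<^sub>M i\<in>{1..m}. (borel :: real measure))"
    unfolding g_def[abs_def] by measurable
  have g: "g (\<lambda>i\<in>{1..m}. incr i s u \<omega>) = iexp (\<Sum>q\<in>{1..m}. c q * incr q s u \<omega>)" for \<omega>
  proof -
    have "(\<Sum>q\<in>{1..m}. c q * (\<lambda>i\<in>{1..m}. incr i s u \<omega>) q) = (\<Sum>q\<in>{1..m}. c q * incr q s u \<omega>)"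
      by (intro sum.cong) auto
    then show ?thesis unfolding g_def by (simp only:)
  qed
  have im [measurable]: "q \<in> {1..m} \<Longrightarrow> incr q s u \<in> borel_measurable M" for q
    using incr_measurable s by blast
  have "integrable M (\<lambda>\<omega>. g (\<lambda>i\<in>{1..m}. incr i s u \<omega>))"
    unfolding g by (rule integrable_const_bound[of _ 1]) auto
  then have "(CLINT \<omega>|M. Z \<omega> * g (\<lambda>i\<in>{1..m}. incr i s u \<omega>))
      = (CLINT \<omega>|M. Z \<omega>) * (CLINT \<omega>|M. g (\<lambda>i\<in>{1..m}. incr i s u \<omega>))"
    by (rule indep_var_lebesgue_integral[OF indep_incr_vector[OF s(1) \<open>s < u\<close> s(3) Z(1) gm] Z(2)])
  also have "(CLINT \<omega>|M. g (\<lambda>i\<in>{1..m}. incr i s u \<omega>)) = (CLINT \<omega>|M. \<Prod>q\<in>{1..m}. iexp (c q * incr q s u \<omega>))"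
    unfolding g by (simp add: exp_sum sum_distrib_left)
  also have "\<dots> = (\<Prod>q\<in>{1..m}. CLINT \<omega>|M. iexp (c q * incr q s u \<omega>))"
  proof (rule indep_vars_lebesgue_integral)
    show "indep_vars (\<lambda>_. borel) (\<lambda>q \<omega>. iexp (c q * incr q s u \<omega>)) {1..m}"
      by (rule indep_vars_compose2[OF indep_vars_incr[OF s], of "\<lambda>q x. iexp (c q * x)"]) measurable
    show "integrable M (\<lambda>\<omega>. iexp (c q * incr q s u \<omega>))" if "q \<in> {1..m}" for q
      by (rule integrable_const_bound[of _ 1]) (use that in auto)
  qed simp
  also have "\<dots> = (\<Prod>q\<in>{1..m}. of_real (exp (- ((c q)\<^sup>2 * (u - s)) / 2)))"
    by (intro prod.cong refl char_incr[OF _ s])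
  also have "\<dots> = of_real (exp (\<Sum>q\<in>{1..m}. - ((c q)\<^sup>2 * (u - s)) / 2))"
    by (simp add: exp_sum)
  also have "(\<Sum>q\<in>{1..m}. - ((c q)\<^sup>2 * (u - s)) / 2) = - ((\<Sum>q\<in>{1..m}. (c q)\<^sup>2) * (u - s)) / 2"
    by (simp add: sum_distrib_right sum_negf sum_divide_distrib)
  finally show ?thesis unfolding g .
qed

text \<open>A linear functional of the increments of all components. Joint characteristic functions
  of several Riemann sums are obtained from it by a suitable choice of \<open>h\<close>.\<close>

definition noise_sum :: "(nat \<Rightarrow> real \<Rightarrow> real) \<Rightarrow> (nat \<Rightarrow> real) \<Rightarrow> nat \<Rightarrow> 'a \<Rightarrow> real" where
  "noise_sum h \<tau> n \<omega> = (\<Sum>l<n. \<Sum>q\<in>{1..m}. h q (\<tau> l) * incr q (\<tau> l) (\<tau> (Suc l)) \<omega>)"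

text \<open>Induction over the partition points, with \<open>char_incr_vector\<close> splitting off
  the next increment. Measurability for \<open>F (\<tau> j)\<close> is proved along with the formula
  because that step relies on it.\<close>

lemma char_noise_sum:
  assumes part: "partition_of a b n \<tau>" and ab: "0 \<le> a" "b \<le> T" and "j \<le> n"
  shows "noise_sum h \<tau> j \<in> borel_measurable (F (\<tau> j)) \<and>
    (CLINT \<omega>|M. iexp (noise_sum h \<tau> j \<omega>))
      = exp (- (\<Sum>q\<in>{1..m}. \<Sum>l<j. (h q (\<tau> l))\<^sup>2 * (\<tau> (Suc l) - \<tau> l)) / 2)"
  using \<open>j \<le> n\<close>
proof (induction j)
  case 0
  then show ?case by (simp add: noise_sum_def[abs_def] prob_space)
next
  case (Suc j)
  then have IH: "noise_sum h \<tau> j \<in> borel_measurable (F (\<tau> j))"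
    "(CLINT \<omega>|M. iexp (noise_sum h \<tau> j \<omega>))
      = exp (- (\<Sum>q\<in>{1..m}. \<Sum>l<j. (h q (\<tau> l))\<^sup>2 * (\<tau> (Suc l) - \<tau> l)) / 2)" by auto
  have \<tau>: "0 \<le> \<tau> j" "\<tau> j \<le> \<tau> (Suc j)" "\<tau> (Suc j) \<le> T"
    using partition_ge[OF part, of j] partition_mono[OF part, of j "Suc j"] partition_le[OF part, of "Suc j"] Suc.prems ab
    by auto
  let ?D = "\<lambda>\<omega>. \<Sum>q\<in>{1..m}. h q (\<tau> j) * incr q (\<tau> j) (\<tau> (Suc j)) \<omega>"
  have step: "noise_sum h \<tau> (Suc j) \<omega> = noise_sum h \<tau> j \<omega> + ?D \<omega>" for \<omega>
    by (simp add: noise_sum_def)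
  have "noise_sum h \<tau> j \<in> borel_measurable (F (\<tau> (Suc j)))" by (rule F_measurable_mono[OF \<tau> IH(1)])
  moreover have "?D \<in> borel_measurable (F (\<tau> (Suc j)))"
    using incr_measurable_F[OF _ \<tau>] by (intro borel_measurable_sum borel_measurable_times) auto
  ultimately have m: "noise_sum h \<tau> (Suc j) \<in> borel_measurable (F (\<tau> (Suc j)))"
    unfolding step[abs_def] by (rule borel_measurable_add)
  have \<tau>jT: "\<tau> j \<le> T" using \<tau> by simp
  have Zm: "(\<lambda>\<omega>. iexp (noise_sum h \<tau> j \<omega>)) \<in> borel_measurable (F (\<tau> j))" using IH(1) by measurable
  have "integrable M (\<lambda>\<omega>. iexp (noise_sum h \<tau> j \<omega>))"
    by (rule integrable_const_bound[of _ 1]) (use F_measurable_M[OF \<tau>(1) \<tau>jT Zm] in auto)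
  from char_incr_vector[OF \<tau> Zm this, of "\<lambda>q. h q (\<tau> j)"]
  have "(CLINT \<omega>|M. iexp (noise_sum h \<tau> (Suc j) \<omega>)) =
      exp (- (\<Sum>q\<in>{1..m}. \<Sum>l<j. (h q (\<tau> l))\<^sup>2 * (\<tau> (Suc l) - \<tau> l)) / 2) *
      exp (- ((\<Sum>q\<in>{1..m}. (h q (\<tau> j))\<^sup>2) * (\<tau> (Suc j) - \<tau> j)) / 2)"
    unfolding step IH(2) by (simp add: distrib_left exp_add)
  also have "\<dots> = exp (- (\<Sum>q\<in>{1..m}. \<Sum>l<Suc j. (h q (\<tau> l))\<^sup>2 * (\<tau> (Suc l) - \<tau> l)) / 2)"
  proof -
    have "- (\<Sum>q\<in>{1..m}. \<Sum>l<Suc j. (h q (\<tau> l))\<^sup>2 * (\<tau> (Suc l) - \<tau> l)) / 2 =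
      - (\<Sum>q\<in>{1..m}. \<Sum>l<j. (h q (\<tau> l))\<^sup>2 * (\<tau> (Suc l) - \<tau> l)) / 2
      + - ((\<Sum>q\<in>{1..m}. (h q (\<tau> j))\<^sup>2) * (\<tau> (Suc j) - \<tau> j)) / 2"
      by (simp only: sum.lessThan_Suc sum.distrib sum_distrib_right minus_add_distrib add_divide_distrib)
    then show ?thesis by (simp only: exp_add of_real_mult)
  qed
  finally show ?case using m by blast
qed

end

section \<open>Sequences with bounded moments\<close>

text \<open>Uniform bounds on all even moments. Unlike a bound on second moments this property is
  stable under products; even exponents avoid absolute values.\<close>

definition bounded_moments :: "'a measure \<Rightarrow> (nat \<Rightarrow> 'a \<Rightarrow> real) \<Rightarrow> bool" where
  "bounded_moments M X \<longleftrightarrow> (\<forall>N. X N \<in> borel_measurable M) \<and>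
     (\<forall>p. \<exists>C. \<forall>N. integrable M (\<lambda>\<omega>. X N \<omega> ^ (2 * p)) \<and> (\<integral>\<omega>. X N \<omega> ^ (2 * p) \<partial>M) \<le> C)"

lemma bounded_moments_measurable: "bounded_moments M X \<Longrightarrow> X N \<in> borel_measurable M"
  by (simp add: bounded_moments_def)

lemma bounded_momentsE:
  assumes "bounded_moments M X"
  obtains C where "\<And>N. integrable M (\<lambda>\<omega>. X N \<omega> ^ (2 * p))" "\<And>N. (\<integral>\<omega>. X N \<omega> ^ (2 * p) \<partial>M) \<le> C"
proof -
  have "\<exists>C. \<forall>N. integrable M (\<lambda>\<omega>. X N \<omega> ^ (2 * p)) \<and> (\<integral>\<omega>. X N \<omega> ^ (2 * p) \<partial>M) \<le> C"
    using assms by (simp add: bounded_moments_def)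
  then show thesis using that by blast
qed

lemma bounded_moments_sq_integrable:
  assumes "bounded_moments M X"
  shows "sq_integrable M (X N)"
proof -
  obtain C where "\<And>N. integrable M (\<lambda>\<omega>. X N \<omega> ^ (2 * 1))" using bounded_momentsE[OF assms, of 1] by metis
  then show ?thesis using bounded_moments_measurable[OF assms] by (simp add: sq_integrable_def)
qed

text \<open>\<open>k p\<close> may exceed \<open>p\<close>, since a product needs moments of twice
  the order of its factors.\<close>

lemma bounded_momentsI_dominated:
  assumes X: "bounded_moments M X" and Y: "bounded_moments M Y" and Z: "\<And>N. Z N \<in> borel_measurable M"
    and le: "\<And>N \<omega> p. Z N \<omega> ^ (2 * p) \<le> c p * (X N \<omega> ^ (2 * k p) + Y N \<omega> ^ (2 * k p))"
    and c: "\<And>p. c p \<ge> (0::real)"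
  shows "bounded_moments M Z"
  unfolding bounded_moments_def
proof (intro conjI allI Z)
  fix p
  obtain C where C: "\<And>N. integrable M (\<lambda>\<omega>. X N \<omega> ^ (2 * k p))" "\<And>N. (\<integral>\<omega>. X N \<omega> ^ (2 * k p) \<partial>M) \<le> C"
    using bounded_momentsE[OF X, of "k p"] by metis
  obtain D where D: "\<And>N. integrable M (\<lambda>\<omega>. Y N \<omega> ^ (2 * k p))" "\<And>N. (\<integral>\<omega>. Y N \<omega> ^ (2 * k p) \<partial>M) \<le> D"
    using bounded_momentsE[OF Y, of "k p"] by metis
  have int: "integrable M (\<lambda>\<omega>. c p * (X N \<omega> ^ (2 * k p) + Y N \<omega> ^ (2 * k p)))" for N
    using C(1) D(1) by simp
  have Zi: "integrable M (\<lambda>\<omega>. Z N \<omega> ^ (2 * p))" for N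
  proof (rule Bochner_Integration.integrable_bound[OF int[of N]])
    show "(\<lambda>\<omega>. Z N \<omega> ^ (2 * p)) \<in> borel_measurable M" using Z by measurable
    have "norm (Z N \<omega> ^ (2 * p)) \<le> norm (c p * (X N \<omega> ^ (2 * k p) + Y N \<omega> ^ (2 * k p)))" for \<omega>
      using le[of N \<omega> p] by (simp add: power_mult)
    then show "AE \<omega> in M. norm (Z N \<omega> ^ (2 * p)) \<le> norm (c p * (X N \<omega> ^ (2 * k p) + Y N \<omega> ^ (2 * k p)))"
      by simp
  qed
  have "(\<integral>\<omega>. Z N \<omega> ^ (2 * p) \<partial>M) \<le> c p * (C + D)" for N
  proof -
    have "(\<integral>\<omega>. Z N \<omega> ^ (2 * p) \<partial>M) \<le> (\<integral>\<omega>. c p * (X N \<omega> ^ (2 * k p) + Y N \<omega> ^ (2 * k p)) \<partial>M)"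
      by (rule integral_mono[OF Zi int le])
    also have "\<dots> = c p * ((\<integral>\<omega>. X N \<omega> ^ (2 * k p) \<partial>M) + (\<integral>\<omega>. Y N \<omega> ^ (2 * k p) \<partial>M))"
      using C(1) D(1) by simp
    also have "\<dots> \<le> c p * (C + D)"
      by (intro mult_left_mono add_mono C D c)
    finally show ?thesis .
  qed
  with Zi show "\<exists>B. \<forall>N. integrable M (\<lambda>\<omega>. Z N \<omega> ^ (2 * p)) \<and> (\<integral>\<omega>. Z N \<omega> ^ (2 * p) \<partial>M) \<le> B"
    by blast
qed

lemma even_power_diff_le: "(x - y :: real) ^ (2 * p) \<le> 2 ^ (2 * p) * (x ^ (2 * p) + y ^ (2 * p))"
proof -
  define z where "z = max \<bar>x\<bar> \<bar>y\<bar>"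
  have ev: "w ^ (2 * p) = \<bar>w\<bar> ^ (2 * p)" for w :: real by (simp add: power_even_abs)
  have "(x - y) ^ (2 * p) = \<bar>x - y\<bar> ^ (2 * p)" by (rule ev)
  also have "\<dots> \<le> (2 * z) ^ (2 * p)" by (intro power_mono) (auto simp: z_def)
  also have "\<dots> = 2 ^ (2 * p) * z ^ (2 * p)" by (rule power_mult_distrib)
  also have "z ^ (2 * p) \<le> x ^ (2 * p) + y ^ (2 * p)"
    unfolding ev[of x] ev[of y] z_def by (cases "\<bar>x\<bar> \<le> \<bar>y\<bar>") auto
  finally show ?thesis by simp
qed

text \<open>The factor 1 and the exponents fit the domination scheme of
  \<open>bounded_momentsI_dominated\<close> with \<open>k p = 2 * p\<close>.\<close>

lemma even_power_mult_le: "(x * y :: real) ^ (2 * p) \<le> 1 * (x ^ (2 * (2 * p)) + y ^ (2 * (2 * p)))"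
proof -
  have sq: "w ^ (2 * (2 * p)) = (w ^ (2 * p))\<^sup>2" for w :: real
    by (simp add: power_mult[symmetric] mult.commute)
  have "0 \<le> x ^ (2 * p) * y ^ (2 * p)" by (simp add: power_mult)
  moreover have "2 * (x ^ (2 * p) * y ^ (2 * p)) \<le> (x ^ (2 * p))\<^sup>2 + (y ^ (2 * p))\<^sup>2"
    using sum_squares_bound[of "x ^ (2 * p)" "y ^ (2 * p)"] by (simp only: mult.assoc)
  ultimately show ?thesis unfolding power_mult_distrib sq mult_1 by linarith
qed

lemma bounded_moments_diff:
  assumes "bounded_moments M X" "bounded_moments M Y"
  shows "bounded_moments M (\<lambda>N \<omega>. X N \<omega> - Y N \<omega>)"
  by (rule bounded_momentsI_dominated[OF assms _ even_power_diff_le])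
    (use assms in \<open>auto intro: bounded_moments_measurable borel_measurable_diff\<close>)

lemma bounded_moments_mult:
  assumes "bounded_moments M X" "bounded_moments M Y"
  shows "bounded_moments M (\<lambda>N \<omega>. X N \<omega> * Y N \<omega>)"
  by (rule bounded_momentsI_dominated[OF assms _ even_power_mult_le])
    (use assms in \<open>auto intro: bounded_moments_measurable borel_measurable_times\<close>)

text \<open>Cauchy-Schwarz for \<open>W\<close> and \<open>W * V\<^sup>2\<close>: their product is
  \<open>(W * V)\<^sup>2\<close>, the second moment of the first tends to 0 and that of the second
  stays bounded.\<close>

lemma bounded_moments_mult_tendsto_0:
  assumes W: "bounded_moments M W" and V: "bounded_moments M V"
    and lim: "(\<lambda>N. \<integral>\<omega>. (W N \<omega>)\<^sup>2 \<partial>M) \<longlonglongrightarrow> 0"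
  shows "(\<lambda>N. \<integral>\<omega>. (W N \<omega> * V N \<omega>)\<^sup>2 \<partial>M) \<longlonglongrightarrow> 0"
proof -
  have bm: "bounded_moments M (\<lambda>N \<omega>. W N \<omega> * (V N \<omega> * V N \<omega>))"
    by (intro bounded_moments_mult W V)
  obtain C where C: "\<And>N. (\<integral>\<omega>. (W N \<omega> * (V N \<omega> * V N \<omega>)) ^ (2 * 1) \<partial>M) \<le> C"
    using bounded_momentsE[OF bm, of 1] by metis
  have bound: "(\<integral>\<omega>. (W N \<omega> * V N \<omega>)\<^sup>2 \<partial>M) \<le> sqrt ((\<integral>\<omega>. (W N \<omega>)\<^sup>2 \<partial>M) * C)" for N
  proof -
    have "(\<integral>\<omega>. W N \<omega> * (W N \<omega> * (V N \<omega> * V N \<omega>)) \<partial>M)\<^sup>2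
        \<le> (\<integral>\<omega>. (W N \<omega>)\<^sup>2 \<partial>M) * (\<integral>\<omega>. (W N \<omega> * (V N \<omega> * V N \<omega>))\<^sup>2 \<partial>M)"
      by (rule Cauchy_Schwarz_integral[OF bounded_moments_sq_integrable[OF W] bounded_moments_sq_integrable[OF bm]])
    also have "\<dots> \<le> (\<integral>\<omega>. (W N \<omega>)\<^sup>2 \<partial>M) * C"
      using C[of N] by (intro mult_left_mono) auto
    also have "(\<lambda>\<omega>. W N \<omega> * (W N \<omega> * (V N \<omega> * V N \<omega>))) = (\<lambda>\<omega>. (W N \<omega> * V N \<omega>)\<^sup>2)"
      by (simp add: power2_eq_square mult_ac)
    finally show ?thesis by (rule real_le_rsqrt)
  qed
  have "(\<lambda>N. sqrt ((\<integral>\<omega>. (W N \<omega>)\<^sup>2 \<partial>M) * C)) \<longlonglongrightarrow> sqrt (0 * C)"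
    by (intro tendsto_intros lim)
  then have l: "(\<lambda>N. sqrt ((\<integral>\<omega>. (W N \<omega>)\<^sup>2 \<partial>M) * C)) \<longlonglongrightarrow> 0" by simp
  show ?thesis
    by (rule tendsto_sandwich[OF _ _ tendsto_const l]) (simp_all add: bound)
qed

text \<open>The factors are exchanged one at a time, each time keeping one difference next to
  factors with bounded moments. The hypothesis \<open>one\<close> serves the empty product.\<close>

lemma bounded_moments_prod_ms_limit:
  assumes Q: "finite Q" and one: "bounded_moments M (\<lambda>N \<omega>. 1)"
    and R: "\<And>q. q \<in> Q \<Longrightarrow> bounded_moments M (R q)" and Z: "\<And>q. q \<in> Q \<Longrightarrow> bounded_moments M (\<lambda>N. Z q)"
    and lim: "\<And>q. q \<in> Q \<Longrightarrow> (\<lambda>N. \<integral>\<omega>. (R q N \<omega> - Z q \<omega>)\<^sup>2 \<partial>M) \<longlonglongrightarrow> 0"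
  shows "bounded_moments M (\<lambda>N \<omega>. \<Prod>q\<in>Q. R q N \<omega>) \<and> bounded_moments M (\<lambda>N \<omega>. \<Prod>q\<in>Q. Z q \<omega>) \<and>
    (\<lambda>N. \<integral>\<omega>. ((\<Prod>q\<in>Q. R q N \<omega>) - (\<Prod>q\<in>Q. Z q \<omega>))\<^sup>2 \<partial>M) \<longlonglongrightarrow> 0"
  using Q R Z lim
proof (induction Q rule: finite_induct)
  case empty
  then show ?case using one by simp
next
  case (insert q Q)
  let ?P = "\<lambda>N \<omega>. \<Prod>q\<in>Q. R q N \<omega>" and ?L = "\<lambda>\<omega>. \<Prod>q\<in>Q. Z q \<omega>"
  have IH: "bounded_moments M ?P" "bounded_moments M (\<lambda>N. ?L)" "(\<lambda>N. \<integral>\<omega>. (?P N \<omega> - ?L \<omega>)\<^sup>2 \<partial>M) \<longlonglongrightarrow> 0"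
    using insert by auto
  have Rq: "bounded_moments M (R q)" "bounded_moments M (\<lambda>N. Z q)" "(\<lambda>N. \<integral>\<omega>. (R q N \<omega> - Z q \<omega>)\<^sup>2 \<partial>M) \<longlonglongrightarrow> 0"
    using insert.prems by auto
  have bR: "bounded_moments M (\<lambda>N \<omega>. R q N \<omega> * ?P N \<omega>)" and bm: "bounded_moments M (\<lambda>N \<omega>. Z q \<omega> * ?P N \<omega>)"
    and bZ: "bounded_moments M (\<lambda>N \<omega>. Z q \<omega> * ?L \<omega>)"
    by (intro bounded_moments_mult IH Rq)+
  have l1: "(\<lambda>N. \<integral>\<omega>. ((R q N \<omega> - Z q \<omega>) * ?P N \<omega>)\<^sup>2 \<partial>M) \<longlonglongrightarrow> 0"
    by (rule bounded_moments_mult_tendsto_0[OF bounded_moments_diff[OF Rq(1,2)] IH(1) Rq(3)])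
  have l2: "(\<lambda>N. \<integral>\<omega>. ((?P N \<omega> - ?L \<omega>) * Z q \<omega>)\<^sup>2 \<partial>M) \<longlonglongrightarrow> 0"
    by (rule bounded_moments_mult_tendsto_0[OF bounded_moments_diff[OF IH(1,2)] Rq(2) IH(3)])
  have le: "(\<integral>\<omega>. (R q N \<omega> * ?P N \<omega> - Z q \<omega> * ?L \<omega>)\<^sup>2 \<partial>M) \<le>
      2 * (\<integral>\<omega>. ((R q N \<omega> - Z q \<omega>) * ?P N \<omega>)\<^sup>2 \<partial>M) + 2 * (\<integral>\<omega>. ((?P N \<omega> - ?L \<omega>) * Z q \<omega>)\<^sup>2 \<partial>M)" for N
    using integral_square_diff_le[OF bounded_moments_sq_integrable[OF bR] bounded_moments_sq_integrable[OF bm]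
      bounded_moments_sq_integrable[OF bZ], of N N]
    by (simp add: left_diff_distrib right_diff_distrib mult.commute)
  have "(\<lambda>N. 2 * (\<integral>\<omega>. ((R q N \<omega> - Z q \<omega>) * ?P N \<omega>)\<^sup>2 \<partial>M) + 2 * (\<integral>\<omega>. ((?P N \<omega> - ?L \<omega>) * Z q \<omega>)\<^sup>2 \<partial>M)) \<longlonglongrightarrow> 2 * 0 + 2 * 0"
    by (intro tendsto_intros l1 l2)
  then have l: "(\<lambda>N. 2 * (\<integral>\<omega>. ((R q N \<omega> - Z q \<omega>) * ?P N \<omega>)\<^sup>2 \<partial>M) + 2 * (\<integral>\<omega>. ((?P N \<omega> - ?L \<omega>) * Z q \<omega>)\<^sup>2 \<partial>M)) \<longlonglongrightarrow> 0"
    by simp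
  have "(\<lambda>N. \<integral>\<omega>. (R q N \<omega> * ?P N \<omega> - Z q \<omega> * ?L \<omega>)\<^sup>2 \<partial>M) \<longlonglongrightarrow> 0"
    by (rule tendsto_sandwich[OF _ _ tendsto_const l]) (simp_all only: le integral_nonneg_AE AE_I2 zero_le_power2 eventually_True simp_thms)
  with bR bZ show ?case using insert.hyps by simp
qed

section \<open>Characteristic functions, normality and independence\<close>

lemma iexp_diff_le: "cmod (iexp x - iexp y) \<le> \<bar>x - y\<bar>"
proof -
  have "iexp x - iexp y = iexp y * (iexp (x - y) - 1)"
    by (simp add: right_diff_distrib flip: exp_add)
  then have "cmod (iexp x - iexp y) = cmod (iexp (x - y) - 1)" by (simp add: norm_mult)
  also have "\<dots> \<le> \<bar>x - y\<bar>" using iexp_approx1[of "x - y" 0] by simp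
  finally show ?thesis .
qed

context prob_space begin

text \<open>\<open>iexp\<close> is Lipschitz with constant 1, so the two expectations differ by at
  most the root of the mean-square error.\<close>

lemma char_ms_limit:
  assumes X: "\<And>n. sq_integrable M (X n)" and Y: "sq_integrable M Y"
    and lim: "(\<lambda>n. expectation (\<lambda>\<omega>. (X n \<omega> - Y \<omega>)\<^sup>2)) \<longlonglongrightarrow> 0"
  shows "(\<lambda>n. CLINT \<omega>|M. iexp (X n \<omega>)) \<longlonglongrightarrow> (CLINT \<omega>|M. iexp (Y \<omega>))"
proof -
  note [measurable] = sq_integrable_measurable[OF X] sq_integrable_measurable[OF Y]
  have int: "integrable M (\<lambda>\<omega>. iexp (X n \<omega>))" "integrable M (\<lambda>\<omega>. iexp (Y \<omega>))" for n
    by (rule integrable_const_bound[of _ 1]; auto)+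
  have le: "norm ((CLINT \<omega>|M. iexp (X n \<omega>)) - (CLINT \<omega>|M. iexp (Y \<omega>))) \<le> sqrt (expectation (\<lambda>\<omega>. (X n \<omega> - Y \<omega>)\<^sup>2))" for n
  proof -
    note sq = sq_integrable_diff[OF X[of n] Y]
    have "(CLINT \<omega>|M. iexp (X n \<omega>)) - (CLINT \<omega>|M. iexp (Y \<omega>)) = (CLINT \<omega>|M. iexp (X n \<omega>) - iexp (Y \<omega>))"
      by (rule Bochner_Integration.integral_diff[OF int, symmetric])
    also have "norm \<dots> \<le> expectation (\<lambda>\<omega>. \<bar>X n \<omega> - Y \<omega>\<bar>)"
      by (rule order_trans[OF integral_norm_bound integral_mono])
        (use int abs_expectation_le_sq(2)[OF sq] in \<open>auto intro: iexp_diff_le\<close>)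
    also have "\<dots> \<le> sqrt (expectation (\<lambda>\<omega>. (X n \<omega> - Y \<omega>)\<^sup>2))" by (rule abs_expectation_le_sq(1)[OF sq])
    finally show ?thesis .
  qed
  have "(\<lambda>n. sqrt (expectation (\<lambda>\<omega>. (X n \<omega> - Y \<omega>)\<^sup>2))) \<longlonglongrightarrow> sqrt 0"
    by (intro tendsto_real_sqrt lim)
  then have "(\<lambda>n. (CLINT \<omega>|M. iexp (X n \<omega>)) - (CLINT \<omega>|M. iexp (Y \<omega>))) \<longlonglongrightarrow> 0"
    by (intro Lim_null_comparison[OF always_eventually[OF allI, OF le]]) simp
  then show ?thesis by (simp add: LIM_zero_iff)
qed

lemma distr_eq_if_char_eq:
  assumes [measurable]: "X \<in> borel_measurable M" and P: "real_distribution P"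
    and char: "\<And>c. (CLINT \<omega>|M. iexp (c * X \<omega>)) = char P c"
  shows "distr M borel X = P"
proof (rule Levy_uniqueness[OF _ P])
  show "real_distribution (distr M borel X)" by (rule real_distribution_distr) simp
  show "char (distr M borel X) = char P"
  proof
    fix c
    have "char (distr M borel X) c = (CLINT \<omega>|M. iexp (c * X \<omega>))"
      unfolding char_def by (rule integral_distr) auto
    then show "char (distr M borel X) c = char P c" by (simp only: char)
  qed
qed

text \<open>The law is given as an image of the standard normal law and not by a density, so that
  \<open>v = 0\<close> is included; the variance of a Riemann sum may vanish.\<close>

lemma normal_if_char:
  assumes [measurable]: "X \<in> borel_measurable M" and v: "v \<ge> 0"
    and char: "\<And>c. (CLINT \<omega>|M. iexp (c * X \<omega>)) = exp (- (c\<^sup>2 * v) / 2)"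
  shows "distr M borel X = distr std_normal_distribution borel (\<lambda>x. sqrt v * x)"
proof (rule distr_eq_if_char_eq)
  interpret N: real_distribution std_normal_distribution by (rule real_dist_normal_dist)
  show "real_distribution (distr std_normal_distribution borel (\<lambda>x. sqrt v * x))"
    by (rule N.real_distribution_distr) simp
  fix c
  have "char (distr std_normal_distribution borel (\<lambda>x. sqrt v * x)) c
     = (CLINT x|std_normal_distribution. iexp (c * (sqrt v * x)))"
    unfolding char_def by (rule integral_distr) auto
  also have "\<dots> = char std_normal_distribution (c * sqrt v)"
    unfolding char_def by (simp add: mult.assoc)
  also have "\<dots> = exp (- (c\<^sup>2 * v) / 2)"
    using v by (simp add: char_std_normal_distribution power_mult_distrib)
  finally show "(CLINT \<omega>|M. iexp (c * X \<omega>)) = char (distr std_normal_distribution borel (\<lambda>x. sqrt v * x)) c"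
    using char by simp
qed simp

text \<open>Scaling separates the variance from a universal constant, so bounded variances give
  bounded moments.\<close>

lemma normal_moments:
  assumes X [measurable]: "X \<in> borel_measurable M" and v: "v \<ge> 0"
    and char: "\<And>c. (CLINT \<omega>|M. iexp (c * X \<omega>)) = exp (- (c\<^sup>2 * v) / 2)"
  shows "integrable M (\<lambda>\<omega>. X \<omega> ^ (2 * p))"
    and "expectation (\<lambda>\<omega>. X \<omega> ^ (2 * p)) = v ^ p * (\<integral>x. x ^ (2 * p) \<partial>std_normal_distribution)"
proof -
  note d = normal_if_char[OF assms]
  have pw: "(sqrt v * x) ^ (2 * p) = v ^ p * x ^ (2 * p)" for x
    using v by (simp add: power_mult_distrib power_mult)
  have "integrable M (\<lambda>\<omega>. X \<omega> ^ (2 * p)) \<longleftrightarrow> integrable (distr M borel X) (\<lambda>x. x ^ (2 * p))"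
    by (rule integrable_distr_eq[symmetric]) auto
  also have "\<dots> \<longleftrightarrow> integrable std_normal_distribution (\<lambda>x. (sqrt v * x) ^ (2 * p))"
    unfolding d by (rule integrable_distr_eq) auto
  also have "\<dots>" unfolding pw
    by (intro integrable_mult_right integrable_std_normal_distribution_moment)
  finally show "integrable M (\<lambda>\<omega>. X \<omega> ^ (2 * p))" by simp
  have "expectation (\<lambda>\<omega>. X \<omega> ^ (2 * p)) = (\<integral>x. x ^ (2 * p) \<partial>distr M borel X)"
    by (rule integral_distr[symmetric]) auto
  also have "\<dots> = (\<integral>x. (sqrt v * x) ^ (2 * p) \<partial>std_normal_distribution)"
    unfolding d by (rule integral_distr) auto
  also have "\<dots> = v ^ p * (\<integral>x. x ^ (2 * p) \<partial>std_normal_distribution)"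
    unfolding pw by (rule integral_mult_right_zero)
  finally show "expectation (\<lambda>\<omega>. X \<omega> ^ (2 * p)) = v ^ p * (\<integral>x. x ^ (2 * p) \<partial>std_normal_distribution)" .
qed

text \<open>
  Weighting by the bounded positive density \<open>2 + R\<close> turns the claim into the uniqueness
  theorem for characteristic functions of probability measures.
\<close>

lemma real_weight_char_independent:
  assumes R [measurable]: "R \<in> borel_measurable M" and bd: "\<And>\<omega>. \<bar>R \<omega>\<bar> \<le> 1"
    and Z [measurable]: "Z \<in> borel_measurable M" and S [measurable]: "S \<in> sets borel"
    and char: "\<And>c. (CLINT \<omega>|M. of_real (R \<omega>) * iexp (c * Z \<omega>)) = of_real (expectation R) * (CLINT \<omega>|M. iexp (c * Z \<omega>))"
  shows "expectation (\<lambda>\<omega>. R \<omega> * indicat_real S (Z \<omega>)) = expectation R * prob (Z -` S \<inter> space M)"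
proof -
  have Ri: "integrable M R" by (rule integrable_const_bound[of _ 1]) (use bd in auto)
  define w where "w = 2 + expectation R"
  have "\<bar>expectation R\<bar> \<le> 1"
  proof -
    have "norm (expectation R) \<le> expectation (\<lambda>\<omega>. 1)"
      by (rule order_trans[OF integral_norm_bound integral_mono]) (use Ri bd in auto)
    then show ?thesis by (simp add: prob_space)
  qed
  then have w: "w > 0" by (simp add: w_def)
  define D where "D \<omega> = (2 + R \<omega>) / w" for \<omega>
  have Dm [measurable]: "D \<in> borel_measurable M" unfolding D_def[abs_def] by measurable
  have D0: "0 \<le> D \<omega>" for \<omega> using bd[of \<omega>] w by (auto simp: D_def)
  have Di: "integrable M D" unfolding D_def[abs_def] using Ri by simp
  have "expectation D = 1" unfolding D_def using Ri w by (simp add: prob_space w_def)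
  then have D1: "(\<integral>\<^sup>+\<omega>. ennreal (D \<omega>) \<partial>M) = 1"
    using nn_integral_eq_integral[OF Di] D0 by simp
  define K where "K = density M (\<lambda>\<omega>. ennreal (D \<omega>))"
  have KZ [measurable]: "Z \<in> borel_measurable K" by (simp add: K_def)
  interpret K: prob_space K
    by (rule prob_spaceI) (simp add: K_def emeasure_density D1 cong: nn_integral_cong)
  \<comment> \<open>Under the hypothesis \<open>char\<close> the weight factors out of every
    characteristic function, so reweighting leaves the law of \<open>Z\<close> unchanged.\<close>
  have "distr K borel Z = distr M borel Z"
  proof (rule K.distr_eq_if_char_eq)
    show "real_distribution (distr M borel Z)" by (rule real_distribution_distr) simp
    fix c
    have zi: "integrable M (\<lambda>\<omega>. iexp (c * Z \<omega>))" by (rule integrable_const_bound[of _ 1]) auto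
    have rzi: "integrable M (\<lambda>\<omega>. of_real (R \<omega>) * iexp (c * Z \<omega>))"
      by (rule integrable_const_bound[of _ 1]) (use bd in \<open>auto simp: norm_mult\<close>)
    have "(CLINT \<omega>|K. iexp (c * Z \<omega>)) = (CLINT \<omega>|M. D \<omega> *\<^sub>R iexp (c * Z \<omega>))"
      unfolding K_def by (rule integral_density) (use D0 in auto)
    also have "\<dots> = (CLINT \<omega>|M. (2 * iexp (c * Z \<omega>) + of_real (R \<omega>) * iexp (c * Z \<omega>)) / w)"
      by (simp add: D_def scaleR_conv_of_real distrib_right)
    also have "\<dots> = (2 * (CLINT \<omega>|M. iexp (c * Z \<omega>)) + (CLINT \<omega>|M. of_real (R \<omega>) * iexp (c * Z \<omega>))) / w"
      using zi rzi by simp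
    also have "\<dots> = (CLINT \<omega>|M. iexp (c * Z \<omega>)) * (2 + of_real (expectation R)) / w"
      unfolding char by (simp add: algebra_simps)
    also have "2 + of_real (expectation R) = (of_real w :: complex)" by (simp add: w_def)
    also have "(CLINT \<omega>|M. iexp (c * Z \<omega>)) * of_real w / of_real w = (CLINT \<omega>|M. iexp (c * Z \<omega>))" using w by simp
    also have "\<dots> = char (distr M borel Z) c" unfolding char_def by (rule integral_distr[symmetric]) auto
    finally show "(CLINT \<omega>|K. iexp (c * Z \<omega>)) = char (distr M borel Z) c" .
  qed simp
  note d = this
  have "(\<integral>\<omega>. indicat_real S (Z \<omega>) \<partial>K) = (\<integral>x. indicat_real S x \<partial>distr K borel Z)"
    by (rule integral_distr[symmetric]) auto
  also have "\<dots> = expectation (\<lambda>\<omega>. indicat_real S (Z \<omega>))"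
    unfolding d by (rule integral_distr) auto
  finally have "(\<integral>\<omega>. indicat_real S (Z \<omega>) \<partial>K) = expectation (\<lambda>\<omega>. indicat_real S (Z \<omega>))" .
  moreover have "(\<integral>\<omega>. indicat_real S (Z \<omega>) \<partial>K) = expectation (\<lambda>\<omega>. D \<omega> * indicat_real S (Z \<omega>))"
    unfolding K_def by (subst integral_density) (use D0 in auto)
  moreover have "\<dots> = (2 * expectation (\<lambda>\<omega>. indicat_real S (Z \<omega>)) + expectation (\<lambda>\<omega>. R \<omega> * indicat_real S (Z \<omega>))) / w"
  proof -
    have i1: "integrable M (\<lambda>\<omega>. indicat_real S (Z \<omega>) :: real)"
      by (rule integrable_const_bound[of _ 1]) (auto simp: indicator_def)
    have i2: "integrable M (\<lambda>\<omega>. R \<omega> * indicat_real S (Z \<omega>) :: real)"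
      by (rule integrable_const_bound[of _ 1]) (use bd in \<open>auto simp: indicator_def\<close>)
    have "D \<omega> * indicat_real S (Z \<omega>) = (2 * indicat_real S (Z \<omega>) + R \<omega> * indicat_real S (Z \<omega>)) / w" for \<omega>
      by (simp add: D_def distrib_right)
    then show ?thesis using i1 i2 by simp
  qed
  ultimately have "2 * expectation (\<lambda>\<omega>. indicat_real S (Z \<omega>)) + expectation (\<lambda>\<omega>. R \<omega> * indicat_real S (Z \<omega>))
      = expectation (\<lambda>\<omega>. indicat_real S (Z \<omega>)) * w"
    using w by (simp add: field_simps)
  then have "expectation (\<lambda>\<omega>. R \<omega> * indicat_real S (Z \<omega>)) = expectation R * expectation (\<lambda>\<omega>. indicat_real S (Z \<omega>))"
    by (simp add: w_def algebra_simps)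
  also have "expectation (\<lambda>\<omega>. indicat_real S (Z \<omega>)) = prob (Z -` S \<inter> space M)"
  proof -
    have "expectation (\<lambda>\<omega>. indicat_real S (Z \<omega>)) = expectation (indicat_real (Z -` S \<inter> space M))"
      by (rule Bochner_Integration.integral_cong) (auto simp: indicator_def)
    then show ?thesis by simp
  qed
  finally show ?thesis .
qed

text \<open>Real and imaginary parts of \<open>H\<close> are combinations of \<open>H\<close> and
  its conjugate, and the factorization for the conjugate follows by conjugating the one at
  \<open>- c\<close>. This reduces the claim to real weights.\<close>

lemma complex_weight_char_independent:
  fixes H :: "'a \<Rightarrow> complex"
  assumes H [measurable]: "H \<in> borel_measurable M" and bd: "\<And>\<omega>. cmod (H \<omega>) \<le> 1"
    and Z [measurable]: "Z \<in> borel_measurable M" and S [measurable]: "S \<in> sets borel"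
    and char: "\<And>c. (CLINT \<omega>|M. H \<omega> * iexp (c * Z \<omega>)) = (CLINT \<omega>|M. H \<omega>) * (CLINT \<omega>|M. iexp (c * Z \<omega>))"
  shows "(CLINT \<omega>|M. H \<omega> * of_real (indicator S (Z \<omega>))) = (CLINT \<omega>|M. H \<omega>) * of_real (prob (Z -` S \<inter> space M))"
proof -
  have [measurable]: "(\<lambda>\<omega>. cnj (H \<omega>)) \<in> borel_measurable M"
    by (rule measurable_compose[OF H borel_measurable_continuous_onI[OF continuous_on_cnj[OF continuous_on_id]]])
  have Hi: "integrable M H" by (rule integrable_const_bound[of _ 1]) (use bd in auto)
  have Hzi: "integrable M (\<lambda>\<omega>. H \<omega> * iexp (c * Z \<omega>))" for c
    by (rule integrable_const_bound[of _ 1]) (use bd in \<open>auto simp: norm_mult\<close>)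
  have cHzi: "integrable M (\<lambda>\<omega>. cnj (H \<omega>) * iexp (c * Z \<omega>))" for c
    by (rule integrable_const_bound[of _ 1]) (use bd in \<open>auto simp: norm_mult\<close>)
  have iexp_cnj: "cnj (iexp x) = iexp (- x)" for x by (simp add: exp_cnj)
  have cchar: "(CLINT \<omega>|M. cnj (H \<omega>) * iexp (c * Z \<omega>)) = cnj (CLINT \<omega>|M. H \<omega>) * (CLINT \<omega>|M. iexp (c * Z \<omega>))" for c
  proof -
    have "(CLINT \<omega>|M. cnj (H \<omega>) * iexp (c * Z \<omega>)) = (CLINT \<omega>|M. cnj (H \<omega> * iexp (- c * Z \<omega>)))"
      unfolding complex_cnj_mult iexp_cnj by simp
    also have "\<dots> = cnj (CLINT \<omega>|M. H \<omega> * iexp (- c * Z \<omega>))"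
      by (rule Bochner_Integration.integral_cnj)
    also have "\<dots> = cnj (CLINT \<omega>|M. H \<omega>) * cnj (CLINT \<omega>|M. iexp (- c * Z \<omega>))"
      unfolding char complex_cnj_mult ..
    also have "cnj (CLINT \<omega>|M. iexp (- c * Z \<omega>)) = (CLINT \<omega>|M. cnj (iexp (- c * Z \<omega>)))"
      by (rule Bochner_Integration.integral_cnj[symmetric])
    also have "\<dots> = (CLINT \<omega>|M. iexp (c * Z \<omega>))"
      unfolding iexp_cnj by simp
    finally show ?thesis .
  qed
  have re: "of_real (Re z) = (z + cnj z) / 2" and im: "of_real (Im z) = (z - cnj z) / (2 * \<i>)" for z
    by (simp_all add: complex_eq_iff)
  have ReE: "expectation (\<lambda>\<omega>. Re (H \<omega>)) = Re (CLINT \<omega>|M. H \<omega>)" and ImE: "expectation (\<lambda>\<omega>. Im (H \<omega>)) = Im (CLINT \<omega>|M. H \<omega>)"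
    using Hi by simp_all
  have rbd: "\<bar>Re (H \<omega>)\<bar> \<le> 1" "\<bar>Im (H \<omega>)\<bar> \<le> 1" for \<omega>
    using bd[of \<omega>] abs_Re_le_cmod[of "H \<omega>"] abs_Im_le_cmod[of "H \<omega>"] by linarith+
  have R: "expectation (\<lambda>\<omega>. Re (H \<omega>) * indicator S (Z \<omega>)) = expectation (\<lambda>\<omega>. Re (H \<omega>)) * prob (Z -` S \<inter> space M)"
  proof (rule real_weight_char_independent[OF _ rbd(1) Z S])
    fix c
    have "(CLINT \<omega>|M. of_real (Re (H \<omega>)) * iexp (c * Z \<omega>))
       = (CLINT \<omega>|M. (H \<omega> * iexp (c * Z \<omega>) + cnj (H \<omega>) * iexp (c * Z \<omega>)) / 2)"
      unfolding re by (simp add: distrib_right)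
    also have "\<dots> = ((CLINT \<omega>|M. H \<omega> * iexp (c * Z \<omega>)) + (CLINT \<omega>|M. cnj (H \<omega>) * iexp (c * Z \<omega>))) / 2"
      using Hzi cHzi by simp
    also have "\<dots> = (((CLINT \<omega>|M. H \<omega>) + cnj (CLINT \<omega>|M. H \<omega>)) / 2) * (CLINT \<omega>|M. iexp (c * Z \<omega>))"
      unfolding char cchar by (simp add: distrib_right)
    finally show "(CLINT \<omega>|M. of_real (Re (H \<omega>)) * iexp (c * Z \<omega>))
        = of_real (expectation (\<lambda>\<omega>. Re (H \<omega>))) * (CLINT \<omega>|M. iexp (c * Z \<omega>))"
      unfolding ReE re .
  qed measurable
  have I: "expectation (\<lambda>\<omega>. Im (H \<omega>) * indicator S (Z \<omega>)) = expectation (\<lambda>\<omega>. Im (H \<omega>)) * prob (Z -` S \<inter> space M)"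
  proof (rule real_weight_char_independent[OF _ rbd(2) Z S])
    fix c
    have "(CLINT \<omega>|M. of_real (Im (H \<omega>)) * iexp (c * Z \<omega>))
       = (CLINT \<omega>|M. (H \<omega> * iexp (c * Z \<omega>) - cnj (H \<omega>) * iexp (c * Z \<omega>)) / (2 * \<i>))"
      unfolding im by (simp only: times_divide_eq_left left_diff_distrib)
    also have "\<dots> = ((CLINT \<omega>|M. H \<omega> * iexp (c * Z \<omega>)) - (CLINT \<omega>|M. cnj (H \<omega>) * iexp (c * Z \<omega>))) / (2 * \<i>)"
      using Hzi cHzi by simp
    also have "\<dots> = (((CLINT \<omega>|M. H \<omega>) - cnj (CLINT \<omega>|M. H \<omega>)) / (2 * \<i>)) * (CLINT \<omega>|M. iexp (c * Z \<omega>))"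
      unfolding char cchar by (simp add: left_diff_distrib)
    finally show "(CLINT \<omega>|M. of_real (Im (H \<omega>)) * iexp (c * Z \<omega>))
        = of_real (expectation (\<lambda>\<omega>. Im (H \<omega>))) * (CLINT \<omega>|M. iexp (c * Z \<omega>))"
      unfolding ImE im .
  qed measurable
  have Hsi: "integrable M (\<lambda>\<omega>. H \<omega> * of_real (indicator S (Z \<omega>)))"
    by (rule integrable_const_bound[of _ 1]) (use bd in \<open>auto simp: norm_mult indicator_def\<close>)
  show ?thesis
  proof (rule complex_eqI)
    have "Re (CLINT \<omega>|M. H \<omega> * of_real (indicator S (Z \<omega>))) = expectation (\<lambda>\<omega>. Re (H \<omega> * of_real (indicator S (Z \<omega>))))"
      by (rule integral_Re[OF Hsi, symmetric])
    then show "Re (CLINT \<omega>|M. H \<omega> * of_real (indicator S (Z \<omega>))) = Re ((CLINT \<omega>|M. H \<omega>) * of_real (prob (Z -` S \<inter> space M)))"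
      using R ReE by simp
    have "Im (CLINT \<omega>|M. H \<omega> * of_real (indicator S (Z \<omega>))) = expectation (\<lambda>\<omega>. Im (H \<omega> * of_real (indicator S (Z \<omega>))))"
      by (rule integral_Im[OF Hsi, symmetric])
    then show "Im (CLINT \<omega>|M. H \<omega> * of_real (indicator S (Z \<omega>))) = Im ((CLINT \<omega>|M. H \<omega>) * of_real (prob (Z -` S \<inter> space M)))"
      using I ImE by simp
  qed
qed

end

section \<open>The integrals of the orthonormal system\<close>

lemma ms_tendsto_sum:
  assumes K: "finite K" and X: "\<And>k n. k \<in> K \<Longrightarrow> sq_integrable M (X k n)" and Y: "\<And>k. k \<in> K \<Longrightarrow> sq_integrable M (Y k)"
    and lim: "\<And>k. k \<in> K \<Longrightarrow> (\<lambda>n. \<integral>\<omega>. (X k n \<omega> - Y k \<omega>)\<^sup>2 \<partial>M) \<longlonglongrightarrow> 0"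
  shows "(\<lambda>n. \<integral>\<omega>. ((\<Sum>k\<in>K. c k * X k n \<omega>) - (\<Sum>k\<in>K. c k * Y k \<omega>))\<^sup>2 \<partial>M) \<longlonglongrightarrow> 0"
  using K X Y lim
proof (induction K rule: finite_induct)
  case empty
  then show ?case by simp
next
  case (insert k K)
  let ?S = "\<lambda>n \<omega>. \<Sum>k\<in>K. c k * X k n \<omega>" and ?L = "\<lambda>\<omega>. \<Sum>k\<in>K. c k * Y k \<omega>"
  have IH: "(\<lambda>n. \<integral>\<omega>. (?S n \<omega> - ?L \<omega>)\<^sup>2 \<partial>M) \<longlonglongrightarrow> 0" using insert by simp
  have sq: "sq_integrable M (X k n)" "sq_integrable M (Y k)" "sq_integrable M (?S n)" "sq_integrable M ?L" for n
    using insert.prems by (auto intro!: sq_integrable_sum sq_integrable_cmult)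
  have le: "(\<integral>\<omega>. ((c k * X k n \<omega> + ?S n \<omega>) - (c k * Y k \<omega> + ?L \<omega>))\<^sup>2 \<partial>M)
      \<le> 2 * (c k)\<^sup>2 * (\<integral>\<omega>. (X k n \<omega> - Y k \<omega>)\<^sup>2 \<partial>M) + 2 * (\<integral>\<omega>. (?S n \<omega> - ?L \<omega>)\<^sup>2 \<partial>M)" for n
  proof -
    have "(\<integral>\<omega>. ((c k * X k n \<omega> + ?S n \<omega>) - (c k * Y k \<omega> + ?L \<omega>))\<^sup>2 \<partial>M)
      \<le> 2 * (\<integral>\<omega>. ((c k * X k n \<omega> + ?S n \<omega>) - (c k * Y k \<omega> + ?S n \<omega>))\<^sup>2 \<partial>M)
        + 2 * (\<integral>\<omega>. ((c k * Y k \<omega> + ?S n \<omega>) - (c k * Y k \<omega> + ?L \<omega>))\<^sup>2 \<partial>M)"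
      by (intro integral_square_diff_le sq_integrable_add sq_integrable_cmult sq)
    also have "(\<lambda>\<omega>. ((c k * X k n \<omega> + ?S n \<omega>) - (c k * Y k \<omega> + ?S n \<omega>))\<^sup>2) = (\<lambda>\<omega>. (c k)\<^sup>2 * (X k n \<omega> - Y k \<omega>)\<^sup>2)"
      by (simp add: power_mult_distrib[symmetric] right_diff_distrib)
    also have "(\<lambda>\<omega>. ((c k * Y k \<omega> + ?S n \<omega>) - (c k * Y k \<omega> + ?L \<omega>))\<^sup>2) = (\<lambda>\<omega>. (?S n \<omega> - ?L \<omega>)\<^sup>2)"
      by simp
    finally show ?thesis by (simp add: mult.assoc)
  qed
  have "(\<lambda>n. 2 * (c k)\<^sup>2 * (\<integral>\<omega>. (X k n \<omega> - Y k \<omega>)\<^sup>2 \<partial>M) + 2 * (\<integral>\<omega>. (?S n \<omega> - ?L \<omega>)\<^sup>2 \<partial>M)) \<longlonglongrightarrow> 2 * (c k)\<^sup>2 * 0 + 2 * 0"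
    using insert.prems(3)[of k] by (intro tendsto_add tendsto_mult tendsto_const IH) simp
  then have l: "(\<lambda>n. 2 * (c k)\<^sup>2 * (\<integral>\<omega>. (X k n \<omega> - Y k \<omega>)\<^sup>2 \<partial>M) + 2 * (\<integral>\<omega>. (?S n \<omega> - ?L \<omega>)\<^sup>2 \<partial>M)) \<longlonglongrightarrow> 0"
    by simp
  have "(\<lambda>n. \<integral>\<omega>. ((c k * X k n \<omega> + ?S n \<omega>) - (c k * Y k \<omega> + ?L \<omega>))\<^sup>2 \<partial>M) \<longlonglongrightarrow> 0"
    by (rule tendsto_sandwich[OF _ _ tendsto_const l]) (simp_all only: le integral_nonneg_AE AE_I2 zero_le_power2 eventually_True simp_thms)
  then show ?case using insert.hyps by simp
qed

context prob_space begin

text \<open>Exchanges exponentials for indicators one index at a time; \<open>B\<close> collects the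
  indices already treated. Each exchange regards the remaining factors as a bounded complex weight
  that is uncorrelated with every \<open>iexp (r * Z x)\<close>.\<close>

lemma prod_indicator_iexp_expectation:
  assumes A: "finite A" and Z: "\<And>a. a \<in> A \<Longrightarrow> Z a \<in> borel_measurable M"
    and char: "\<And>c. (CLINT \<omega>|M. \<Prod>a\<in>A. iexp (c a * Z a \<omega>)) = (\<Prod>a\<in>A. CLINT \<omega>|M. iexp (c a * Z a \<omega>))"
    and S: "\<And>a. S a \<in> sets borel" and B: "B \<subseteq> A"
  shows "(CLINT \<omega>|M. (\<Prod>b\<in>B. of_real (indicat_real (S b) (Z b \<omega>))) * (\<Prod>a\<in>A - B. iexp (c a * Z a \<omega>)))
    = (\<Prod>b\<in>B. of_real (prob (Z b -` S b \<inter> space M))) * (\<Prod>a\<in>A - B. CLINT \<omega>|M. iexp (c a * Z a \<omega>))"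
  using finite_subset[OF B A] B
proof (induction B arbitrary: c rule: finite_induct)
  case empty
  then show ?case using char by simp
next
  case (insert x B)
  let ?C = "A - insert x B"
  have x: "x \<in> A" "x \<notin> B" "B \<subseteq> A" using insert by auto
  have AB: "A - B = insert x ?C" "finite ?C" "x \<notin> ?C" using x A by auto
  define H where "H \<omega> = (\<Prod>b\<in>B. of_real (indicat_real (S b) (Z b \<omega>))) * (\<Prod>a\<in>?C. iexp (c a * Z a \<omega>))" for \<omega>
  define P where "P = (\<Prod>b\<in>B. complex_of_real (prob (Z b -` S b \<inter> space M))) * (\<Prod>a\<in>?C. CLINT \<omega>|M. iexp (c a * Z a \<omega>))"
  have m [measurable]: "Z b \<in> borel_measurable M" if "b \<in> A" for b using Z that by blast
  have S' [measurable]: "S b \<in> sets borel" for b by (rule S)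
  have H [measurable]: "H \<in> borel_measurable M"
  proof -
    have "(\<lambda>\<omega>. complex_of_real (indicat_real (S b) (Z b \<omega>))) \<in> borel_measurable M" if "b \<in> B" for b
    proof -
      have "b \<in> A" using that x by blast
      note [measurable] = Z[OF this]
      show ?thesis by measurable
    qed
    moreover have "(\<lambda>\<omega>. iexp (c a * Z a \<omega>)) \<in> borel_measurable M" if "a \<in> ?C" for a
    proof -
      have "a \<in> A" using that by blast
      note [measurable] = Z[OF this]
      show ?thesis by measurable
    qed
    ultimately show ?thesis unfolding H_def[abs_def]
      by (intro borel_measurable_times borel_measurable_prod) auto
  qed
  have bd: "cmod (H \<omega>) \<le> 1" for \<omega>
  proof -
    have "cmod (\<Prod>b\<in>B. of_real (indicat_real (S b) (Z b \<omega>))) \<le> 1"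
      unfolding prod_norm[symmetric] by (rule prod_le_1) (auto simp: indicator_def)
    moreover have "cmod (\<Prod>a\<in>?C. iexp (c a * Z a \<omega>)) \<le> 1"
      unfolding prod_norm[symmetric] by (rule prod_le_1) auto
    ultimately show ?thesis unfolding H_def norm_mult by (intro mult_le_one norm_ge_zero)
  qed
  \<comment> \<open>The coefficient of the index \<open>x\<close> is free in the induction
    hypothesis, so it is set to an arbitrary \<open>r\<close>.\<close>
  have key: "(CLINT \<omega>|M. H \<omega> * iexp (r * Z x \<omega>)) = P * (CLINT \<omega>|M. iexp (r * Z x \<omega>))" for r
  proof -
    let ?c = "c(x := r)"
    have eqC: "(\<Prod>a\<in>?C. g (?c a) a) = (\<Prod>a\<in>?C. g (c a) a)" for g :: "real \<Rightarrow> 'b \<Rightarrow> complex"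
      by (rule prod.cong) auto
    have split: "(\<Prod>a\<in>A - B. g (?c a) a) = g r x * (\<Prod>a\<in>?C. g (c a) a)" for g :: "real \<Rightarrow> 'b \<Rightarrow> complex"
      unfolding AB(1) prod.insert[OF AB(2,3)] eqC by simp
    have ac: "u * v * w = u * (w * v)" for u v w :: complex by simp
    have "(CLINT \<omega>|M. H \<omega> * iexp (r * Z x \<omega>)) =
      (CLINT \<omega>|M. (\<Prod>b\<in>B. of_real (indicat_real (S b) (Z b \<omega>))) * (\<Prod>a\<in>A - B. iexp (?c a * Z a \<omega>)))"
    proof (rule Bochner_Integration.integral_cong[OF refl])
      fix \<omega>
      show "H \<omega> * iexp (r * Z x \<omega>) = (\<Prod>b\<in>B. of_real (indicat_real (S b) (Z b \<omega>))) * (\<Prod>a\<in>A - B. iexp (?c a * Z a \<omega>))"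
        unfolding H_def split[of "\<lambda>r a. iexp (r * Z a \<omega>)"] by (rule ac)
    qed
    also have "\<dots> = (\<Prod>b\<in>B. of_real (prob (Z b -` S b \<inter> space M))) * (\<Prod>a\<in>A - B. CLINT \<omega>|M. iexp (?c a * Z a \<omega>))"
      by (rule insert.IH[OF x(3)])
    also have "\<dots> = P * (CLINT \<omega>|M. iexp (r * Z x \<omega>))"
      unfolding P_def split[of "\<lambda>r a. CLINT \<omega>|M. iexp (r * Z a \<omega>)"] by (rule ac[symmetric])
    finally show ?thesis .
  qed
  \<comment> \<open>At \<open>r = 0\<close> the exponential is 1 and only the weight
    remains.\<close>
  have HP: "(CLINT \<omega>|M. H \<omega>) = P" using key[of 0] by (simp add: prob_space)
  have "(CLINT \<omega>|M. H \<omega> * of_real (indicat_real (S x) (Z x \<omega>))) = (CLINT \<omega>|M. H \<omega>) * of_real (prob (Z x -` S x \<inter> space M))"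
    by (rule complex_weight_char_independent[OF H bd m[OF x(1)] S]) (simp only: HP key)
  then have "(CLINT \<omega>|M. of_real (indicat_real (S x) (Z x \<omega>)) * H \<omega>) = of_real (prob (Z x -` S x \<inter> space M)) * P"
    by (simp only: HP mult.commute)
  then show ?case unfolding prod.insert[OF insert.hyps(1,2)] mult.assoc H_def P_def .
qed

text \<open>For \<open>B = A\<close> in \<open>prod_indicator_iexp_expectation\<close> all
  exponentials have become indicators, and expectations of products of indicators are probabilities
  of intersections.\<close>

lemma indep_vars_if_char:
  assumes A: "finite A" and Z: "\<And>a. a \<in> A \<Longrightarrow> Z a \<in> borel_measurable M"
    and char: "\<And>c. (CLINT \<omega>|M. \<Prod>a\<in>A. iexp (c a * Z a \<omega>)) = (\<Prod>a\<in>A. CLINT \<omega>|M. iexp (c a * Z a \<omega>))"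
  shows "indep_vars (\<lambda>_. borel) Z A"
  unfolding indep_vars_def2
proof (intro conjI ballI Z indep_setsI)
  show "{Z a -` B \<inter> space M |B. B \<in> sets borel} \<subseteq> events" if "a \<in> A" for a
    using measurable_sets[OF Z[OF that]] by auto
  fix E J assume J: "J \<noteq> {}" "J \<subseteq> A" "finite J" "\<forall>j\<in>J. E j \<in> {Z j -` B \<inter> space M |B. B \<in> sets borel}"
  then have "\<forall>j\<in>J. \<exists>B. B \<in> sets borel \<and> E j = Z j -` B \<inter> space M" by blast
  then obtain S0 where S0: "\<forall>j\<in>J. S0 j \<in> sets borel \<and> E j = Z j -` S0 j \<inter> space M" by (rule bchoice[THEN exE])
  \<comment> \<open>Indices outside \<open>J\<close> get the trivial event, so a product over
    \<open>A\<close> reduces to one over \<open>J\<close>.\<close>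
  define S where "S j = (if j \<in> J then S0 j else UNIV)" for j
  have S: "S j \<in> sets borel" for j using S0 by (simp add: S_def)
  have m: "Z b \<in> borel_measurable M" if "b \<in> J" for b using Z that J by blast
  have "(CLINT \<omega>|M. \<Prod>b\<in>A. of_real (indicat_real (S b) (Z b \<omega>))) = (\<Prod>b\<in>A. complex_of_real (prob (Z b -` S b \<inter> space M)))"
    using prod_indicator_iexp_expectation[OF A Z char S order_refl] by simp
  also have "\<dots> = of_real (\<Prod>b\<in>A. prob (Z b -` S b \<inter> space M))" by simp
  also have "(\<Prod>b\<in>A. prob (Z b -` S b \<inter> space M)) = (\<Prod>b\<in>J. prob (E b))"
    by (rule prod.mono_neutral_cong_right) (use A J S0 in \<open>auto simp: S_def prob_space\<close>)
  also have "(CLINT \<omega>|M. \<Prod>b\<in>A. of_real (indicat_real (S b) (Z b \<omega>))) = (CLINT \<omega>|M. of_real (indicat_real (\<Inter>j\<in>J. E j) \<omega>))"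
  proof (rule Bochner_Integration.integral_cong[OF refl])
    fix \<omega> assume \<omega>: "\<omega> \<in> space M"
    have "(\<Prod>b\<in>A. complex_of_real (indicat_real (S b) (Z b \<omega>))) = (\<Prod>b\<in>J. of_real (indicat_real (E b) \<omega>))"
      by (rule prod.mono_neutral_cong_right) (use A J S0 \<omega> in \<open>auto simp: S_def indicator_def\<close>)
    also have "\<dots> = of_real (indicat_real (\<Inter>j\<in>J. E j) \<omega>)"
    proof (cases "\<omega> \<in> (\<Inter>j\<in>J. E j)")
      case True
      then show ?thesis by simp
    next
      case False
      then obtain j where "j \<in> J" "\<omega> \<notin> E j" by blast
      then have "\<exists>b\<in>J. complex_of_real (indicat_real (E b) \<omega>) = 0" by (intro bexI[of _ j]) (simp_all add: indicator_def)
      then have "(\<Prod>b\<in>J. complex_of_real (indicat_real (E b) \<omega>)) = 0" using J(3) by (rule prod_zero[rotated])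
      then show ?thesis using False by simp
    qed
    finally show "(\<Prod>b\<in>A. complex_of_real (indicat_real (S b) (Z b \<omega>))) = of_real (indicat_real (\<Inter>j\<in>J. E j) \<omega>)" .
  qed
  also have "\<dots> = of_real (prob (\<Inter>j\<in>J. E j))"
  proof -
    have "E j \<in> events" if "j \<in> J" for j using S0 m[OF that] that by (auto intro: measurable_sets)
    then have "(\<Inter>j\<in>J. E j) \<in> events" using J by (intro sets.finite_INT) auto
    moreover then have "(\<Inter>j\<in>J. E j) \<inter> space M = (\<Inter>j\<in>J. E j)" by (rule sets.Int_space_eq2)
    ultimately show ?thesis by simp
  qed
  finally show "prob (\<Inter>j\<in>J. E j) = (\<Prod>j\<in>J. prob (E j))" using of_real_eq_iff by blast
qed

end

section \<open>Riemann sums for a single component\<close>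

context wiener_process begin

definition riemann_noise :: "(real \<Rightarrow> real) \<Rightarrow> nat \<Rightarrow> (nat \<Rightarrow> real) \<Rightarrow> nat \<Rightarrow> 'a \<Rightarrow> real" where
  "riemann_noise g q \<tau> n \<omega> = (\<Sum>l<n. g (\<tau> l) * incr q (\<tau> l) (\<tau> (Suc l)) \<omega>)"

lemma char_riemann_noise:
  assumes "q \<in> {1..m}" "partition_of a b n \<tau>" "0 \<le> a" "b \<le> T"
  shows "(CLINT \<omega>|M. iexp (c * riemann_noise g q \<tau> n \<omega>)) = exp (- (c\<^sup>2 * (\<Sum>l<n. (g (\<tau> l))\<^sup>2 * (\<tau> (Suc l) - \<tau> l))) / 2)"
proof -
  \<comment> \<open>Concentrating \<open>h\<close> on the component \<open>q\<close> makes
    \<open>noise_sum\<close> a multiple of one Riemann sum.\<close>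
  define h where "h r s = (if r = q then c * g s else 0)" for r s
  have "noise_sum h \<tau> n \<omega> = c * riemann_noise g q \<tau> n \<omega>" for \<omega>
  proof -
    have "(\<Sum>r\<in>{1..m}. h r (\<tau> l) * incr r (\<tau> l) (\<tau> (Suc l)) \<omega>) = c * (g (\<tau> l) * incr q (\<tau> l) (\<tau> (Suc l)) \<omega>)" for l
    proof -
      have "(\<Sum>r\<in>{1..m}. h r (\<tau> l) * incr r (\<tau> l) (\<tau> (Suc l)) \<omega>)
         = (\<Sum>r\<in>{1..m}. if r = q then c * (g (\<tau> l) * incr q (\<tau> l) (\<tau> (Suc l)) \<omega>) else 0)"
        by (intro sum.cong) (auto simp: h_def)
      also have "\<dots> = c * (g (\<tau> l) * incr q (\<tau> l) (\<tau> (Suc l)) \<omega>)" using assms(1) by simp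
      finally show ?thesis .
    qed
    then show ?thesis by (simp add: noise_sum_def riemann_noise_def sum_distrib_left)
  qed
  moreover have "(\<Sum>r\<in>{1..m}. \<Sum>l<n. (h r (\<tau> l))\<^sup>2 * (\<tau> (Suc l) - \<tau> l)) = c\<^sup>2 * (\<Sum>l<n. (g (\<tau> l))\<^sup>2 * (\<tau> (Suc l) - \<tau> l))"
  proof -
    have "(\<Sum>r\<in>{1..m}. \<Sum>l<n. (h r (\<tau> l))\<^sup>2 * (\<tau> (Suc l) - \<tau> l))
      = (\<Sum>r\<in>{1..m}. if r = q then c\<^sup>2 * (\<Sum>l<n. (g (\<tau> l))\<^sup>2 * (\<tau> (Suc l) - \<tau> l)) else 0)"
      by (intro sum.cong) (auto simp: h_def power_mult_distrib sum_distrib_left mult.assoc)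
    also have "\<dots> = c\<^sup>2 * (\<Sum>l<n. (g (\<tau> l))\<^sup>2 * (\<tau> (Suc l) - \<tau> l))" using assms(1) by simp
    finally show ?thesis .
  qed
  ultimately show ?thesis using char_noise_sum[OF assms(2-4) order_refl, of h] by simp
qed

end

text \<open>Orthonormality is stated with the gauge integral, which is the limit in
  \<open>riemann_sum_tendsto\<close>. The number \<open>n N\<close> of subintervals is kept general
  because the given partitions are used with a shifted index.\<close>

locale wiener_orthonormal = wiener_process +
  fixes t :: real and \<phi> :: "nat \<Rightarrow> real \<Rightarrow> real" and n :: "nat \<Rightarrow> nat" and \<tau> :: "nat \<Rightarrow> nat \<Rightarrow> real"
  assumes t: "0 \<le> t" "t < T"
    and \<phi>_cont: "continuous_on {t..T} (\<phi> j)"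
    and \<phi>_orth: "integral {t..T} (\<lambda>s. \<phi> j s * \<phi> l s) = (if j = l then 1 else 0)"
    and part: "partition_of t T (n N) (\<tau> N)" and mesh: "mesh_tendsto_0 n \<tau>"
begin

abbreviation \<zeta> :: "nat \<Rightarrow> nat \<Rightarrow> 'a \<Rightarrow> real" where "\<zeta> \<equiv> zeta M F f t T \<phi>"

abbreviation R :: "nat \<Rightarrow> nat \<Rightarrow> nat \<Rightarrow> 'a \<Rightarrow> real" where "R q j N \<equiv> riemann_noise (\<phi> j) q (\<tau> N) (n N)"

lemma zeta_ito:
  assumes q: "q \<in> {1..m}"
  shows "sq_integrable M (\<zeta> q j)" "(\<lambda>N. expectation (\<lambda>\<omega>. (R q j N \<omega> - \<zeta> q j \<omega>)\<^sup>2)) \<longlonglongrightarrow> 0"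
    "sq_integrable M (R q j N)"
proof -
  have uc: "ms_ucont M {t..T} (\<lambda>s \<omega>. \<phi> j s)"
    using ms_ucont_scale[OF \<phi>_cont[of j] ms_ucont_const[OF sq_integrable_const[of 1]]] by simp
  have ad: "adapted_on t T (\<lambda>s \<omega>. \<phi> j s)" by (simp add: adapted_on_def)
  have tT: "t \<le> T" using t by simp
  have ito: "has_ito_integral M F (f q) t T (\<lambda>s \<omega>. \<phi> j s) (\<zeta> q j)"
    unfolding zeta_def by (rule has_ito_integral_ito_integral[OF q t(1) tT order_refl ad uc])
  show sqz: "sq_integrable M (\<zeta> q j)" by (rule has_ito_integral_sq_integrable[OF ito t(1) order_refl q])
  have R: "R q j N = step_integral (f q) (n N) (\<tau> N) (\<lambda>l \<omega>. \<phi> j (\<tau> N l))" for N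
    by (simp add: fun_eq_iff riemann_noise_def step_integral_def incr_def)
  show sqR: "sq_integrable M (R q j N)" for N
    unfolding R by (rule sq_integrable_step_integral[OF step_data_sampled[OF t(1) order_refl part ad uc] t(1) order_refl q])
  show "(\<lambda>N. expectation (\<lambda>\<omega>. (R q j N \<omega> - \<zeta> q j \<omega>)\<^sup>2)) \<longlonglongrightarrow> 0"
    using sampled_ms_limit[OF ito q t(1) tT order_refl ad uc part mesh] has_ms_limit_iff[of M "R q j" "\<zeta> q j", OF sqR sqz]
    unfolding R by blast
qed

lemma riemann_norm_tendsto: "(\<lambda>N. \<Sum>l<n N. (\<phi> j (\<tau> N l))\<^sup>2 * (\<tau> N (Suc l) - \<tau> N l)) \<longlonglongrightarrow> 1"
proof -
  have "continuous_on {t..T} (\<lambda>s. \<phi> j s * \<phi> j s)" by (intro continuous_intros \<phi>_cont)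
  from riemann_sum_tendsto[OF this part mesh] show ?thesis by (simp add: \<phi>_orth power2_eq_square)
qed

text \<open>A linear combination of the \<zeta> is the mean-square limit of \<open>noise_sum\<close>
  with \<open>h q\<close> the same combination of the \<phi>. The limit variance is the sum over
  \<open>q\<close> of the integrals of \<open>(h q)\<^sup>2\<close>, and orthonormality turns it
  into the sum of the squared coefficients. Law and independence can both be read off from the
  result.\<close>

lemma char_zeta_combination:
  "(CLINT \<omega>|M. iexp (\<Sum>q\<in>{1..m}. \<Sum>j<K. c q j * \<zeta> q j \<omega>)) = exp (- (\<Sum>q\<in>{1..m}. \<Sum>j<K. (c q j)\<^sup>2) / 2)"
proof -
  define h where "h q s = (\<Sum>j<K. c q j * \<phi> j s)" for q s
  let ?A = "{1..m} \<times> {..<K}"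
  have noise: "noise_sum h (\<tau> N) (n N) \<omega> = (\<Sum>(q, j)\<in>?A. c q j * R q j N \<omega>)" for N \<omega>
  proof -
    have "noise_sum h (\<tau> N) (n N) \<omega> = (\<Sum>q\<in>{1..m}. \<Sum>l<n N. h q (\<tau> N l) * incr q (\<tau> N l) (\<tau> N (Suc l)) \<omega>)"
      unfolding noise_sum_def by (rule sum.swap)
    also have "\<dots> = (\<Sum>q\<in>{1..m}. \<Sum>j<K. c q j * R q j N \<omega>)"
    proof (rule sum.cong[OF refl])
      fix q
      have "(\<Sum>l<n N. h q (\<tau> N l) * incr q (\<tau> N l) (\<tau> N (Suc l)) \<omega>)
        = (\<Sum>l<n N. \<Sum>j<K. c q j * (\<phi> j (\<tau> N l) * incr q (\<tau> N l) (\<tau> N (Suc l)) \<omega>))"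
        by (simp add: h_def sum_distrib_right mult.assoc)
      also have "\<dots> = (\<Sum>j<K. \<Sum>l<n N. c q j * (\<phi> j (\<tau> N l) * incr q (\<tau> N l) (\<tau> N (Suc l)) \<omega>))" by (rule sum.swap)
      finally show "(\<Sum>l<n N. h q (\<tau> N l) * incr q (\<tau> N l) (\<tau> N (Suc l)) \<omega>) = (\<Sum>j<K. c q j * R q j N \<omega>)"
        by (simp add: riemann_noise_def sum_distrib_left)
    qed
    finally show ?thesis by (simp add: sum.cartesian_product)
  qed
  let ?Y = "\<lambda>\<omega>. \<Sum>(q, j)\<in>?A. c q j * \<zeta> q j \<omega>"
  have lim: "(\<lambda>N. expectation (\<lambda>\<omega>. (noise_sum h (\<tau> N) (n N) \<omega> - ?Y \<omega>)\<^sup>2)) \<longlonglongrightarrow> 0"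
    unfolding noise using ms_tendsto_sum[of ?A M "\<lambda>(q, j). R q j" "\<lambda>(q, j). \<zeta> q j" "\<lambda>(q, j). c q j"] zeta_ito
    by (simp add: case_prod_beta mem_Times_iff)
  have sqN: "sq_integrable M (noise_sum h (\<tau> N) (n N))" for N
    unfolding noise[abs_def] by (rule sq_integrable_sum) (use zeta_ito(3) in \<open>auto intro!: sq_integrable_cmult\<close>)
  have sqY: "sq_integrable M ?Y"
    by (rule sq_integrable_sum) (use zeta_ito(1) in \<open>auto intro!: sq_integrable_cmult\<close>)
  have lim1: "(\<lambda>N. CLINT \<omega>|M. iexp (noise_sum h (\<tau> N) (n N) \<omega>)) \<longlonglongrightarrow> (CLINT \<omega>|M. iexp (?Y \<omega>))"
    by (rule char_ms_limit[OF sqN sqY lim])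
  have hc: "continuous_on {t..T} (\<lambda>s. (h q s)\<^sup>2)" for q
    unfolding h_def by (intro continuous_intros \<phi>_cont)
  have hi: "integral {t..T} (\<lambda>s. (h q s)\<^sup>2) = (\<Sum>j<K. (c q j)\<^sup>2)" for q
  proof -
    have int: "(\<lambda>s. (c q j * c q l) * (\<phi> j s * \<phi> l s)) integrable_on {t..T}" for j l
      by (intro integrable_continuous_interval continuous_intros \<phi>_cont)
    have "integral {t..T} (\<lambda>s. (h q s)\<^sup>2) = integral {t..T} (\<lambda>s. \<Sum>j<K. \<Sum>l<K. (c q j * c q l) * (\<phi> j s * \<phi> l s))"
      by (simp add: h_def power2_eq_square sum_product mult_ac)
    also have "\<dots> = (\<Sum>j<K. \<Sum>l<K. integral {t..T} (\<lambda>s. (c q j * c q l) * (\<phi> j s * \<phi> l s)))"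
      by (simp add: Henstock_Kurzweil_Integration.integral_sum integrable_sum int)
    also have "\<dots> = (\<Sum>j<K. \<Sum>l<K. if l = j then (c q j)\<^sup>2 else 0)"
      by (intro sum.cong refl) (auto simp: \<phi>_orth power2_eq_square)
    finally show ?thesis by simp
  qed
  have "(\<lambda>N. complex_of_real (exp (- (\<Sum>q\<in>{1..m}. \<Sum>l<n N. (h q (\<tau> N l))\<^sup>2 * (\<tau> N (Suc l) - \<tau> N l)) / 2)))
      \<longlonglongrightarrow> complex_of_real (exp (- (\<Sum>q\<in>{1..m}. integral {t..T} (\<lambda>s. (h q s)\<^sup>2)) / 2))"
    by (intro tendsto_of_real tendsto_exp tendsto_divide tendsto_minus tendsto_sum tendsto_const
        riemann_sum_tendsto[OF hc part mesh]) simp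
  then have lim2: "(\<lambda>N. CLINT \<omega>|M. iexp (noise_sum h (\<tau> N) (n N) \<omega>))
      \<longlonglongrightarrow> complex_of_real (exp (- (\<Sum>q\<in>{1..m}. \<Sum>j<K. (c q j)\<^sup>2) / 2))"
    unfolding hi using char_noise_sum[OF part t(1) order_refl order_refl, where h = h] by simp
  have "?Y \<omega> = (\<Sum>q\<in>{1..m}. \<Sum>j<K. c q j * \<zeta> q j \<omega>)" for \<omega> by (simp add: sum.cartesian_product)
  with LIMSEQ_unique[OF lim1 lim2] show ?thesis by (simp only:)
qed

text \<open>The factor \<open>* 1\<close> is the variance \<open>v\<close> in the form expected by
  \<open>normal_if_char\<close> and \<open>normal_moments\<close>.\<close>

lemma char_zeta:
  assumes q: "q \<in> {1..m}"
  shows "(CLINT \<omega>|M. iexp (c * \<zeta> q j \<omega>)) = exp (- (c\<^sup>2 * 1) / 2)"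
proof -
  define d where "d r l = (if r = q then if l = j then c else 0 else 0)" for r l
  have "(\<Sum>r\<in>{1..m}. \<Sum>l<Suc j. d r l * \<zeta> r l \<omega>) = c * \<zeta> q j \<omega>" for \<omega>
  proof -
    have "(\<Sum>r\<in>{1..m}. \<Sum>l<Suc j. d r l * \<zeta> r l \<omega>) = (\<Sum>r\<in>{1..m}. if r = q then \<Sum>l<Suc j. (if l = j then c * \<zeta> q j \<omega> else 0) else 0)"
      by (intro sum.cong refl) (auto simp: d_def intro!: sum.cong)
    then show ?thesis using q by (simp del: sum.lessThan_Suc)
  qed
  moreover have "(\<Sum>r\<in>{1..m}. \<Sum>l<Suc j. (d r l)\<^sup>2) = c\<^sup>2"
  proof -
    have "(\<Sum>r\<in>{1..m}. \<Sum>l<Suc j. (d r l)\<^sup>2) = (\<Sum>r\<in>{1..m}. if r = q then \<Sum>l<Suc j. (if l = j then c\<^sup>2 else 0) else 0)"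
      by (intro sum.cong refl) (auto simp: d_def intro!: sum.cong)
    then show ?thesis using q by (simp del: sum.lessThan_Suc)
  qed
  ultimately show ?thesis using char_zeta_combination[of d "Suc j"] by simp
qed

lemma zeta_distributed:
  assumes q: "q \<in> {1..m}"
  shows "distributed M lborel (\<zeta> q j) std_normal_density"
proof -
  have m: "\<zeta> q j \<in> borel_measurable M" by (rule sq_integrable_measurable[OF zeta_ito(1)[OF q]])
  have "distr M borel (\<zeta> q j) = distr std_normal_distribution borel (\<lambda>x. sqrt 1 * x)"
    by (rule normal_if_char[OF m zero_le_one char_zeta[OF q]])
  also have "\<dots> = std_normal_distribution" by (simp add: distr_id2)
  finally have "distr M lborel (\<zeta> q j) = density lborel std_normal_density"
    by (simp cong: distr_cong)
  then show ?thesis using m by (simp add: distributed_def)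
qed

lemma zeta_indep: "indep_vars (\<lambda>_. borel) (\<lambda>(q, j). \<zeta> q j) ({1..m} \<times> UNIV)"
proof -
  have fin: "indep_vars (\<lambda>_. borel) (\<lambda>(q, j). \<zeta> q j) ({1..m} \<times> {..<K})" for K
  proof (rule indep_vars_if_char)
    show "(case a of (q, j) \<Rightarrow> \<zeta> q j) \<in> borel_measurable M" if "a \<in> {1..m} \<times> {..<K}" for a
      using that sq_integrable_measurable[OF zeta_ito(1)] by auto
    fix c :: "nat \<times> nat \<Rightarrow> real"
    let ?A = "{1..m} \<times> {..<K}"
    have "(CLINT \<omega>|M. \<Prod>a\<in>?A. iexp (c a * (case a of (q, j) \<Rightarrow> \<zeta> q j) \<omega>))
       = (CLINT \<omega>|M. iexp (\<Sum>q\<in>{1..m}. \<Sum>j<K. c (q, j) * \<zeta> q j \<omega>))"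
    proof (rule Bochner_Integration.integral_cong[OF refl])
      fix \<omega>
      have "(\<Prod>a\<in>?A. iexp (c a * (case a of (q, j) \<Rightarrow> \<zeta> q j) \<omega>)) = iexp (\<Sum>a\<in>?A. c a * (case a of (q, j) \<Rightarrow> \<zeta> q j) \<omega>)"
        by (simp add: exp_sum sum_distrib_left)
      also have "(\<Sum>a\<in>?A. c a * (case a of (q, j) \<Rightarrow> \<zeta> q j) \<omega>) = (\<Sum>q\<in>{1..m}. \<Sum>j<K. c (q, j) * \<zeta> q j \<omega>)"
        unfolding sum.cartesian_product by (intro sum.cong) auto
      finally show "(\<Prod>a\<in>?A. iexp (c a * (case a of (q, j) \<Rightarrow> \<zeta> q j) \<omega>)) = iexp (\<Sum>q\<in>{1..m}. \<Sum>j<K. c (q, j) * \<zeta> q j \<omega>)" .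
    qed
    also have "\<dots> = exp (- (\<Sum>q\<in>{1..m}. \<Sum>j<K. (c (q, j))\<^sup>2) / 2)" by (rule char_zeta_combination)
    also have "\<dots> = of_real (\<Prod>a\<in>?A. exp (- ((c a)\<^sup>2 * 1) / 2))"
    proof -
      have "(\<Prod>a\<in>?A. exp (- ((c a)\<^sup>2 * 1) / 2)) = exp (\<Sum>a\<in>?A. - ((c a)\<^sup>2 * 1) / 2)"
        by (rule exp_sum[symmetric]) simp
      also have "(\<Sum>a\<in>?A. - ((c a)\<^sup>2 * 1) / 2) = - (\<Sum>a\<in>?A. (c a)\<^sup>2) / 2"
        by (simp only: sum_divide_distrib[symmetric] sum_negf mult_1_right)
      also have "(\<Sum>a\<in>?A. (c a)\<^sup>2) = (\<Sum>q\<in>{1..m}. \<Sum>j<K. (c (q, j))\<^sup>2)"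
        unfolding sum.cartesian_product by (intro sum.cong refl) auto
      finally show ?thesis by (simp only:)
    qed
    also have "\<dots> = (\<Prod>a\<in>?A. CLINT \<omega>|M. iexp (c a * (case a of (q, j) \<Rightarrow> \<zeta> q j) \<omega>))"
      unfolding of_real_prod by (intro prod.cong refl) (use char_zeta in auto)
    finally show "(CLINT \<omega>|M. \<Prod>a\<in>?A. iexp (c a * (case a of (q, j) \<Rightarrow> \<zeta> q j) \<omega>))
      = (\<Prod>a\<in>?A. CLINT \<omega>|M. iexp (c a * (case a of (q, j) \<Rightarrow> \<zeta> q j) \<omega>))" .
  qed simp
  show ?thesis
    unfolding indep_vars_def2
  proof
    show "\<forall>a\<in>{1..m} \<times> UNIV. (case a of (q, j) \<Rightarrow> \<zeta> q j) \<in> borel_measurable M"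
      using sq_integrable_measurable[OF zeta_ito(1)] by auto
    show "indep_sets (\<lambda>a. {(case a of (q, j) \<Rightarrow> \<zeta> q j) -` A \<inter> space M |A. A \<in> sets borel}) ({1..m} \<times> UNIV)"
    proof (subst indep_sets_finite_index_sets, intro allI impI)
      fix J :: "(nat \<times> nat) set" assume J: "J \<subseteq> {1..m} \<times> UNIV" "J \<noteq> {}" "finite J"
      \<comment> \<open>Independence of an infinite family concerns finite subfamilies;
        \<open>K\<close> exceeds all second indices that occur in \<open>J\<close>.\<close>
      define K where "K = Suc (Max (snd ` J))"
      have "snd a < K" if "a \<in> J" for a
        unfolding K_def less_Suc_eq_le by (rule Max_ge) (use that J in auto)
      then have "J \<subseteq> {1..m} \<times> {..<K}" using J(1) by auto
      then show "indep_sets (\<lambda>a. {(case a of (q, j) \<Rightarrow> \<zeta> q j) -` A \<inter> space M |A. A \<in> sets borel}) J"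
        using fin[of K] unfolding indep_vars_def2 by (blast intro: indep_sets_mono_index)
    qed
  qed
qed

text \<open>A Riemann sum with nonrandom weights is exactly normal, and its variances
  \<open>v N\<close> converge, hence are bounded. Its moments are fixed multiples of powers of this
  bounded sequence.\<close>

lemma bounded_moments_riemann_noise:
  assumes q: "q \<in> {1..m}"
  shows "bounded_moments M (R q j)"
proof -
  define v where "v N = (\<Sum>l<n N. (\<phi> j (\<tau> N l))\<^sup>2 * (\<tau> N (Suc l) - \<tau> N l))" for N
  have v: "v N \<ge> 0" for N unfolding v_def
  proof (intro sum_nonneg mult_nonneg_nonneg)
    fix l assume "l \<in> {..<n N}"
    then show "0 \<le> \<tau> N (Suc l) - \<tau> N l" using partition_mono[OF part, of l "Suc l" N] by simp
  qed simp
  have "Bseq v" using riemann_norm_tendsto[of j] unfolding v_def[symmetric] by (intro convergent_imp_Bseq convergentI)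
  then obtain B where B: "B > 0" "\<And>N. norm (v N) \<le> B" unfolding Bseq_def by blast
  have m: "R q j N \<in> borel_measurable M" for N by (rule sq_integrable_measurable[OF zeta_ito(3)[OF q]])
  have char: "(CLINT \<omega>|M. iexp (c * R q j N \<omega>)) = exp (- (c\<^sup>2 * v N) / 2)" for c N
    unfolding v_def by (rule char_riemann_noise[OF q part t(1) order_refl])
  show ?thesis
    unfolding bounded_moments_def
  proof (intro conjI allI m)
    fix p
    define c where "c = (\<integral>x. x ^ (2 * p) \<partial>std_normal_distribution)"
    have c: "0 \<le> c" unfolding c_def by (rule Bochner_Integration.integral_nonneg) (rule zero_le_even_power')
    have "integrable M (\<lambda>\<omega>. R q j N \<omega> ^ (2 * p)) \<and> expectation (\<lambda>\<omega>. R q j N \<omega> ^ (2 * p)) \<le> B ^ p * c" for N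
    proof
      show "integrable M (\<lambda>\<omega>. R q j N \<omega> ^ (2 * p))" by (rule normal_moments(1)[OF m v char])
      have "expectation (\<lambda>\<omega>. R q j N \<omega> ^ (2 * p)) = v N ^ p * c"
        unfolding c_def by (rule normal_moments(2)[OF m v char])
      also have "\<dots> \<le> B ^ p * c"
        using v[of N] B(2)[of N] c by (intro mult_right_mono power_mono) simp_all
      finally show "expectation (\<lambda>\<omega>. R q j N \<omega> ^ (2 * p)) \<le> B ^ p * c" .
    qed
    then show "\<exists>C. \<forall>N. integrable M (\<lambda>\<omega>. R q j N \<omega> ^ (2 * p)) \<and> expectation (\<lambda>\<omega>. R q j N \<omega> ^ (2 * p)) \<le> C"
      by (intro exI allI)
  qed
qed

lemma bounded_moments_zeta:
  assumes q: "q \<in> {1..m}"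
  shows "bounded_moments M (\<lambda>N. \<zeta> q j)"
proof -
  have m: "\<zeta> q j \<in> borel_measurable M" by (rule sq_integrable_measurable[OF zeta_ito(1)[OF q]])
  show ?thesis unfolding bounded_moments_def
    using m normal_moments(1)[OF m zero_le_one char_zeta[OF q]] by auto
qed

lemma prod_riemann_noise_ms_limit:
  fixes k :: nat
  assumes i: "\<And>l. l \<in> {1..k} \<Longrightarrow> i l \<in> {1..m}"
  shows "sq_integrable M (\<lambda>\<omega>. \<Prod>l\<in>{1..k}. R (i l) (j l) N \<omega>)"
    and "sq_integrable M (\<lambda>\<omega>. \<Prod>l\<in>{1..k}. \<zeta> (i l) (j l) \<omega>)"
    and "(\<lambda>N. expectation (\<lambda>\<omega>. ((\<Prod>l\<in>{1..k}. R (i l) (j l) N \<omega>) - (\<Prod>l\<in>{1..k}. \<zeta> (i l) (j l) \<omega>))\<^sup>2)) \<longlonglongrightarrow> 0"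
proof -
  have one: "bounded_moments M (\<lambda>N \<omega>. 1)" by (auto simp: bounded_moments_def prob_space)
  have *: "bounded_moments M (\<lambda>N \<omega>. \<Prod>l\<in>{1..k}. R (i l) (j l) N \<omega>) \<and>
    bounded_moments M (\<lambda>N \<omega>. \<Prod>l\<in>{1..k}. \<zeta> (i l) (j l) \<omega>) \<and>
    (\<lambda>N. expectation (\<lambda>\<omega>. ((\<Prod>l\<in>{1..k}. R (i l) (j l) N \<omega>) - (\<Prod>l\<in>{1..k}. \<zeta> (i l) (j l) \<omega>))\<^sup>2)) \<longlonglongrightarrow> 0"
    by (rule bounded_moments_prod_ms_limit[of "{1..k}" M "\<lambda>l. R (i l) (j l)" "\<lambda>l. \<zeta> (i l) (j l)", OF _ one])
      (use i zeta_ito(2) in \<open>auto intro: bounded_moments_riemann_noise bounded_moments_zeta\<close>)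
  from * show "sq_integrable M (\<lambda>\<omega>. \<Prod>l\<in>{1..k}. R (i l) (j l) N \<omega>)"
    using bounded_moments_sq_integrable[of M "\<lambda>N \<omega>. \<Prod>l\<in>{1..k}. R (i l) (j l) N \<omega>"] by blast
  from * show "sq_integrable M (\<lambda>\<omega>. \<Prod>l\<in>{1..k}. \<zeta> (i l) (j l) \<omega>)"
    using bounded_moments_sq_integrable[of M "\<lambda>N \<omega>. \<Prod>l\<in>{1..k}. \<zeta> (i l) (j l) \<omega>"] by blast
  from * show "(\<lambda>N. expectation (\<lambda>\<omega>. ((\<Prod>l\<in>{1..k}. R (i l) (j l) N \<omega>) - (\<Prod>l\<in>{1..k}. \<zeta> (i l) (j l) \<omega>))\<^sup>2)) \<longlonglongrightarrow> 0"
    by blast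
qed

end

section \<open>Sums over permutations\<close>

text \<open>Lists name the variables from the outermost inwards. The head can then be any element of
  an index set, which makes a recursion over all permutations of an arbitrary finite set
  possible.\<close>

primrec list_ordered_sum :: "('b \<Rightarrow> nat \<Rightarrow> real) \<Rightarrow> 'b list \<Rightarrow> nat \<Rightarrow> real" where
  "list_ordered_sum c [] n = 1"
| "list_ordered_sum c (a # xs) n = (\<Sum>l<n. list_ordered_sum c xs l * c a l)"

primrec list_iterated_integral :: "('b \<Rightarrow> real \<Rightarrow> real) \<Rightarrow> real \<Rightarrow> 'b list \<Rightarrow> real \<Rightarrow> real" where
  "list_iterated_integral g t [] s = 1"
| "list_iterated_integral g t (a # xs) s = integral {t..s} (\<lambda>u. g a u * list_iterated_integral g t xs u)"

lemma rev_upt_Suc: "rev [1..<Suc (Suc k)] = Suc k # rev [1..<Suc k]"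
  by simp

text \<open>The list runs downwards since the variable \<open>k\<close> is the outermost one in
  \<open>ordered_sum\<close>.\<close>

lemma ordered_sum_eq_list: "ordered_sum (\<lambda>q. c (\<sigma> q)) k n = list_ordered_sum c (map \<sigma> (rev [1..<Suc k])) n"
proof (induction k arbitrary: n)
  case (Suc k)
  show ?case unfolding rev_upt_Suc by (simp only: ordered_sum.simps list.map list_ordered_sum.simps Suc)
qed simp

lemma iterated_integral_eq_list:
  "iterated_integral (\<lambda>q. g (\<sigma> q)) t k s = list_iterated_integral g t (map \<sigma> (rev [1..<Suc k])) s"
proof (induction k arbitrary: s)
  case (Suc k)
  show ?case unfolding rev_upt_Suc by (simp only: iterated_integral.simps list.map list_iterated_integral.simps Suc)
qed simp

lemma sum_permutations_of_set_Cons: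
  assumes "finite A" "A \<noteq> {}"
  shows "(\<Sum>xs\<in>permutations_of_set A. h xs) = (\<Sum>a\<in>A. \<Sum>ys\<in>permutations_of_set (A - {a}). h (a # ys))"
proof -
  have "(\<Sum>xs\<in>permutations_of_set A. h xs) = (\<Sum>a\<in>A. sum h ((#) a ` permutations_of_set (A - {a})))"
    unfolding permutations_of_set_nonempty[OF assms(2)] using assms(1) by (intro sum.UNION_disjoint) auto
  also have "\<dots> = (\<Sum>a\<in>A. \<Sum>ys\<in>permutations_of_set (A - {a}). h (a # ys))"
    by (rule sum.cong[OF refl], subst sum.reindex) (auto simp: comp_def inj_on_def)
  finally show ?thesis .
qed

text \<open>A permutation is determined by its values along \<open>xs\<close>; surjectivity follows
  by counting.\<close>

lemma bij_betw_permutes_permutations_of_set: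
  assumes "distinct xs" "set xs = A"
  shows "bij_betw (\<lambda>\<sigma>. map \<sigma> xs) {\<sigma>. \<sigma> permutes A} (permutations_of_set A)"
proof -
  have fin: "finite A" using assms by auto
  have inj: "inj_on (\<lambda>\<sigma>. map \<sigma> xs) {\<sigma>. \<sigma> permutes A}"
  proof (rule inj_onI)
    fix \<sigma> \<rho> assume *: "\<sigma> \<in> {\<sigma>. \<sigma> permutes A}" "\<rho> \<in> {\<sigma>. \<sigma> permutes A}" "map \<sigma> xs = map \<rho> xs"
    show "\<sigma> = \<rho>"
    proof
      fix x
      show "\<sigma> x = \<rho> x"
      proof (cases "x \<in> A")
        case True then show ?thesis using *(3) assms(2) by auto
      next
        case False then show ?thesis using * by (auto simp: permutes_def)
      qed
    qed
  qed
  have sub: "(\<lambda>\<sigma>. map \<sigma> xs) ` {\<sigma>. \<sigma> permutes A} \<subseteq> permutations_of_set A"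
    using assms by (auto simp: permutations_of_set_def permutes_image distinct_map intro: inj_on_subset permutes_inj_on)
  have "card ((\<lambda>\<sigma>. map \<sigma> xs) ` {\<sigma>. \<sigma> permutes A}) = card (permutations_of_set A)"
    using fin by (simp add: card_image[OF inj] card_permutations)
  then have "(\<lambda>\<sigma>. map \<sigma> xs) ` {\<sigma>. \<sigma> permutes A} = permutations_of_set A"
    by (intro card_subset_eq sub) auto
  with inj show ?thesis by (simp add: bij_betw_def)
qed

lemma sum_permutes_eq_permutations_of_set:
  "(\<Sum>\<sigma> | \<sigma> permutes {1..k}. h (map \<sigma> (rev [1..<Suc k]))) = (\<Sum>xs\<in>permutations_of_set {1..k}. h xs)"
  by (rule sum.reindex_bij_betw[OF bij_betw_permutes_permutations_of_set]) (auto simp del: upt_Suc)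

section \<open>Multi-indices with distinct entries\<close>

definition inj_index :: "'b set \<Rightarrow> nat \<Rightarrow> ('b \<Rightarrow> nat) set" where
  "inj_index A n = {l \<in> A \<rightarrow>\<^sub>E {..<n}. inj_on l A}"

lemma finite_inj_index: "finite A \<Longrightarrow> finite (inj_index A n)"
  unfolding inj_index_def by (rule finite_subset[of _ "A \<rightarrow>\<^sub>E {..<n}"]) (auto intro: finite_PiE)

text \<open>The new value \<open>n\<close> is attained at no argument or at exactly one
  \<open>a\<close>; removing \<open>a\<close> from the domain leaves an injective map with values
  below \<open>n\<close>.\<close>

lemma inj_index_Suc:
  "inj_index A (Suc n) = inj_index A n \<union> (\<Union>a\<in>A. (\<lambda>l. l(a := n)) ` inj_index (A - {a}) n)"
proof (intro equalityI subsetI)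
  fix l assume l: "l \<in> inj_index A (Suc n)"
  show "l \<in> inj_index A n \<union> (\<Union>a\<in>A. (\<lambda>l. l(a := n)) ` inj_index (A - {a}) n)"
  proof (cases "\<exists>a\<in>A. l a = n")
    case False
    then have "l \<in> inj_index A n" using l by (auto simp: inj_index_def PiE_iff less_Suc_eq)
    then show ?thesis by simp
  next
    case True
    then obtain a where a: "a \<in> A" "l a = n" by blast
    have "l b \<noteq> n" if "b \<in> A - {a}" for b
    proof
      assume "l b = n"
      then have "l b = l a" using a by simp
      then have "b = a" using l that a by (auto simp: inj_index_def dest: inj_onD)
      then show False using that by simp
    qed
    \<comment> \<open>Resetting the value at \<open>a\<close> to \<open>undefined\<close> makes the
      map extensional on the smaller domain.\<close>
    then have "l(a := undefined) \<in> inj_index (A - {a}) n"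
      using l by (auto simp: inj_index_def PiE_iff less_Suc_eq extensional_def inj_on_def)
    moreover have "l = (l(a := undefined))(a := n)" using a by (auto simp: fun_eq_iff)
    ultimately show ?thesis using a(1) by blast
  qed
next
  fix l assume "l \<in> inj_index A n \<union> (\<Union>a\<in>A. (\<lambda>l. l(a := n)) ` inj_index (A - {a}) n)"
  then show "l \<in> inj_index A (Suc n)"
  proof
    assume "l \<in> inj_index A n"
    then show ?thesis by (auto simp: inj_index_def PiE_iff less_Suc_eq)
  next
    assume "l \<in> (\<Union>a\<in>A. (\<lambda>l. l(a := n)) ` inj_index (A - {a}) n)"
    then obtain a l' where a: "a \<in> A" "l' \<in> inj_index (A - {a}) n" "l = l'(a := n)" by blast
    have lt: "\<And>b. b \<in> A - {a} \<Longrightarrow> l' b < n" and inj: "inj_on l' (A - {a})" and ext: "l' \<in> extensional (A - {a})"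
      using a(2) by (auto simp: inj_index_def PiE_iff)
    have "l b \<noteq> l a" if "b \<in> A - {a}" for b using lt[OF that] that a(3) by auto
    then have "inj_on l A" using inj a by (auto simp: inj_on_def)
    moreover have "l \<in> A \<rightarrow>\<^sub>E {..<Suc n}" using lt ext a by (auto simp: PiE_iff extensional_def less_Suc_eq)
    ultimately show ?thesis by (simp add: inj_index_def)
  qed
qed

lemma sum_inj_index_Suc:
  fixes c :: "'b \<Rightarrow> nat \<Rightarrow> real"
  assumes A: "finite A"
  shows "(\<Sum>l\<in>inj_index A (Suc n). \<Prod>a\<in>A. c a (l a)) =
    (\<Sum>l\<in>inj_index A n. \<Prod>a\<in>A. c a (l a)) + (\<Sum>a\<in>A. (\<Sum>l\<in>inj_index (A - {a}) n. \<Prod>b\<in>A - {a}. c b (l b)) * c a n)"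
proof -
  let ?h = "\<lambda>l. \<Prod>a\<in>A. c a (l a)"
  let ?U = "\<lambda>a. (\<lambda>l. l(a := n)) ` inj_index (A - {a}) n"
  have val: "l a < n" if "l \<in> inj_index A n" "a \<in> A" for l A and a :: 'b
    using that by (auto simp: inj_index_def)
  have disj1: "inj_index A n \<inter> (\<Union>a\<in>A. ?U a) = {}"
    using val[of _ A] by fastforce
  have disj2: "?U a \<inter> ?U b = {}" if "a \<in> A" "b \<in> A" "a \<noteq> b" for a b
  proof -
    have "l(a := n) \<noteq> l'(b := n)" if "l \<in> inj_index (A - {a}) n" for l l'
    proof
      assume "l(a := n) = l'(b := n)"
      then have "(l(a := n)) b = n" by simp
      then have "l b = n" using \<open>a \<noteq> b\<close> by simp
      moreover have "l b < n" using val[OF that] \<open>b \<in> A\<close> \<open>a \<noteq> b\<close> by auto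
      ultimately show False by simp
    qed
    then show ?thesis by blast
  qed
  have "sum ?h (inj_index A (Suc n)) = sum ?h (inj_index A n) + sum ?h (\<Union>a\<in>A. ?U a)"
    unfolding inj_index_Suc using A disj1 by (intro sum.union_disjoint) (auto intro: finite_inj_index)
  also have "sum ?h (\<Union>a\<in>A. ?U a) = (\<Sum>a\<in>A. sum ?h (?U a))"
    using A disj2 by (intro sum.UNION_disjoint) (auto intro: finite_inj_index)
  also have "\<dots> = (\<Sum>a\<in>A. (\<Sum>l\<in>inj_index (A - {a}) n. \<Prod>b\<in>A - {a}. c b (l b)) * c a n)"
  proof (rule sum.cong[OF refl])
    fix a assume a: "a \<in> A"
    have inj: "inj_on (\<lambda>l. l(a := n)) (inj_index (A - {a}) n)"
    proof (rule inj_onI)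
      fix l l' assume l: "l \<in> inj_index (A - {a}) n" "l' \<in> inj_index (A - {a}) n" "l(a := n) = l'(a := n)"
      then have "l a = undefined" "l' a = undefined" by (auto simp: inj_index_def PiE_iff extensional_def)
      with l(3) show "l = l'" by (metis fun_upd_idem_iff fun_upd_upd)
    qed
    have "sum ?h (?U a) = (\<Sum>l\<in>inj_index (A - {a}) n. ?h (l(a := n)))"
      by (subst sum.reindex[OF inj]) (simp add: comp_def)
    also have "\<dots> = (\<Sum>l\<in>inj_index (A - {a}) n. (\<Prod>b\<in>A - {a}. c b (l b)) * c a n)"
    proof (rule sum.cong[OF refl])
      fix l
      have "?h (l(a := n)) = c a ((l(a := n)) a) * (\<Prod>b\<in>A - {a}. c b ((l(a := n)) b))"
        by (rule prod.remove[OF A a])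
      also have "(\<Prod>b\<in>A - {a}. c b ((l(a := n)) b)) = (\<Prod>b\<in>A - {a}. c b (l b))"
        by (rule prod.cong) auto
      finally show "?h (l(a := n)) = (\<Prod>b\<in>A - {a}. c b (l b)) * c a n" by simp
    qed
    finally show "sum ?h (?U a) = (\<Sum>l\<in>inj_index (A - {a}) n. \<Prod>b\<in>A - {a}. c b (l b)) * c a n"
      by (simp add: sum_distrib_right)
  qed
  finally show ?thesis .
qed

text \<open>Both sides obey one recursion in \<open>n\<close>: if the value \<open>n\<close> occurs
  it is the largest index, so it belongs to the outermost variable, which is the head of the list.
  In effect the injective multi-indices are sorted by the order of their values.\<close>

lemma sum_inj_index_eq_permutations:
  assumes "finite A"
  shows "(\<Sum>l\<in>inj_index A n. \<Prod>a\<in>A. c a (l a)) = (\<Sum>xs\<in>permutations_of_set A. list_ordered_sum c xs n)"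
  using assms
proof (induction n arbitrary: A)
  case 0
  show ?case
  proof (cases "A = {}")
    case True
    then show ?thesis by (simp add: inj_index_def)
  next
    case False
    then have "inj_index A 0 = {}" by (auto simp: inj_index_def PiE_iff)
    then show ?thesis by (simp add: sum_permutations_of_set_Cons[OF 0 False])
  qed
next
  case (Suc n)
  have IH: "(\<Sum>l\<in>inj_index B n. \<Prod>a\<in>B. c a (l a)) = (\<Sum>xs\<in>permutations_of_set B. list_ordered_sum c xs n)" if "B \<subseteq> A" for B
    using Suc.IH[of B] finite_subset[OF that Suc.prems] by simp
  show ?case
  proof (cases "A = {}")
    case True
    then show ?thesis by (simp add: inj_index_def)
  next
    case False
    have "(\<Sum>xs\<in>permutations_of_set A. list_ordered_sum c xs (Suc n))
      = (\<Sum>a\<in>A. \<Sum>ys\<in>permutations_of_set (A - {a}). list_ordered_sum c (a # ys) n + list_ordered_sum c ys n * c a n)"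
      unfolding sum_permutations_of_set_Cons[OF Suc.prems False] by simp
    also have "\<dots> = (\<Sum>xs\<in>permutations_of_set A. list_ordered_sum c xs n)
        + (\<Sum>a\<in>A. (\<Sum>ys\<in>permutations_of_set (A - {a}). list_ordered_sum c ys n) * c a n)"
      unfolding sum_permutations_of_set_Cons[OF Suc.prems False] by (simp add: sum.distrib sum_distrib_right)
    also have "\<dots> = (\<Sum>l\<in>inj_index A (Suc n). \<Prod>a\<in>A. c a (l a))"
      unfolding sum_inj_index_Suc[OF Suc.prems] IH[OF subset_refl] by (simp add: IH)
    finally show ?thesis by simp
  qed
qed

lemma L_set_eq_inj_index: "L_set k N = inj_index {1..k} N"
  by (auto simp: L_set_def H_set_def inj_index_def inj_on_def)

lemma sum_L_set:
  "(\<Sum>l\<in>L_set k N. \<Prod>q\<in>{1..k}. c q (l q)) = (\<Sum>\<sigma> | \<sigma> permutes {1..k}. ordered_sum (\<lambda>q. c (\<sigma> q)) k N)"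
  unfolding L_set_eq_inj_index ordered_sum_eq_list
  by (simp only: sum_permutes_eq_permutations_of_set[of "\<lambda>xs. list_ordered_sum c xs N"] sum_inj_index_eq_permutations finite_atLeastAtMost)

lemma sum_H_set:
  fixes c :: "nat \<Rightarrow> nat \<Rightarrow> real"
  shows "(\<Sum>l\<in>H_set k N. \<Prod>q\<in>{1..k}. c q (l q)) = (\<Prod>q\<in>{1..k}. \<Sum>l<N. c q l)"
  unfolding H_set_def by (rule prod_sum_PiE[symmetric]) auto

lemma sum_G_set:
  fixes c :: "nat \<Rightarrow> nat \<Rightarrow> real"
  shows "(\<Sum>l\<in>G_set k N. \<Prod>q\<in>{1..k}. c q (l q)) =
    (\<Prod>q\<in>{1..k}. \<Sum>l<N. c q l) - (\<Sum>\<sigma> | \<sigma> permutes {1..k}. ordered_sum (\<lambda>q. c (\<sigma> q)) k N)"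
proof -
  have "finite (H_set k N)" unfolding H_set_def by (intro finite_PiE) auto
  moreover have "L_set k N \<subseteq> H_set k N" by (auto simp: L_set_def)
  ultimately show ?thesis
    unfolding G_set_def by (simp only: sum_diff sum_H_set sum_L_set)
qed

section \<open>Iterated integrals over simplices\<close>

lemma continuous_list_iterated_integral:
  assumes "\<And>a. a \<in> set xs \<Longrightarrow> continuous_on {t..T} (g a)"
  shows "continuous_on {t..T} (list_iterated_integral g t xs)"
  using assms
proof (induction xs)
  case Nil
  then show ?case by simp
next
  case (Cons a xs)
  have "(\<lambda>u. g a u * list_iterated_integral g t xs u) integrable_on {t..T}"
    by (rule integrable_continuous_interval) (intro continuous_on_mult, use Cons in auto)
  from indefinite_integral_continuous_1[OF this] show ?case by simp
qed

lemma has_real_derivative_prod_within: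
  fixes f f' :: "'b \<Rightarrow> real \<Rightarrow> real"
  assumes "finite A" "\<And>a. a \<in> A \<Longrightarrow> (f a has_real_derivative f' a z) (at z within S)"
  shows "((\<lambda>u. \<Prod>a\<in>A. f a u) has_real_derivative (\<Sum>a\<in>A. f' a z * (\<Prod>b\<in>A - {a}. f b z))) (at z within S)"
  using assms
proof (induction A rule: finite_induct)
  case (insert x A)
  have eq: "insert x A - {y} = insert x (A - {y})" if "y \<in> A" for y
    using insert.hyps that by auto
  show ?case
    using insert.hyps
    by (auto intro!: derivative_eq_intros insert.prems insert.IH sum.cong
             simp: sum_distrib_left sum_distrib_right eq)
qed simp

text \<open>Product rule for the primitives of the \<open>g a\<close>: each summand singles out the
  variable with the largest time, and by induction the others already sum to a product. The
  fundamental theorem then integrates, with lower boundary term 0 since \<open>A\<close> is not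
  empty. The cube is thus assembled from simplices without measuring the diagonals.\<close>

lemma sum_permutations_list_iterated_integral:
  assumes "finite A" "\<And>a. a \<in> A \<Longrightarrow> continuous_on {t..T} (g a)" "s \<in> {t..T}"
  shows "(\<Sum>xs\<in>permutations_of_set A. list_iterated_integral g t xs s) = (\<Prod>a\<in>A. integral {t..s} (g a))"
  using assms
proof (induction "card A" arbitrary: A s)
  case 0
  then show ?case by simp
next
  case (Suc k)
  then have A: "finite A" "A \<noteq> {}" by auto
  let ?G = "\<lambda>a u. integral {t..u} (g a)"
  have cont: "continuous_on {t..s} (list_iterated_integral g t ys)" if "ys \<in> permutations_of_set (A - {a})" for ys a
  proof (rule continuous_on_subset)
    show "continuous_on {t..T} (list_iterated_integral g t ys)"
      by (rule continuous_list_iterated_integral) (use that Suc.prems in \<open>auto simp: permutations_of_set_def\<close>)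
  qed (use Suc.prems in auto)
  have gc: "continuous_on {t..s} (g a)" if "a \<in> A" for a
    using continuous_on_subset[OF Suc.prems(2)[OF that], of "{t..s}"] Suc.prems(3) by auto
  have "(\<Sum>xs\<in>permutations_of_set A. list_iterated_integral g t xs s)
      = (\<Sum>a\<in>A. \<Sum>ys\<in>permutations_of_set (A - {a}). integral {t..s} (\<lambda>u. g a u * list_iterated_integral g t ys u))"
    by (simp add: sum_permutations_of_set_Cons[OF A])
  also have "\<dots> = (\<Sum>a\<in>A. integral {t..s} (\<lambda>u. g a u * (\<Prod>b\<in>A - {a}. ?G b u)))"
  proof (rule sum.cong[OF refl])
    fix a assume a: "a \<in> A"
    have "(\<Sum>ys\<in>permutations_of_set (A - {a}). integral {t..s} (\<lambda>u. g a u * list_iterated_integral g t ys u))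
      = integral {t..s} (\<lambda>u. \<Sum>ys\<in>permutations_of_set (A - {a}). g a u * list_iterated_integral g t ys u)"
      by (rule Henstock_Kurzweil_Integration.integral_sum[symmetric])
        (auto intro!: integrable_continuous_interval continuous_on_mult gc[OF a] cont)
    also have "\<dots> = integral {t..s} (\<lambda>u. g a u * (\<Prod>b\<in>A - {a}. ?G b u))"
    proof (rule integral_cong)
      fix u assume u: "u \<in> {t..s}"
      have "(\<Sum>ys\<in>permutations_of_set (A - {a}). list_iterated_integral g t ys u) = (\<Prod>b\<in>A - {a}. ?G b u)"
        by (rule Suc.hyps(1)) (use Suc a A u in \<open>auto simp: card_Diff_singleton\<close>)
      then show "(\<Sum>ys\<in>permutations_of_set (A - {a}). g a u * list_iterated_integral g t ys u) = g a u * (\<Prod>b\<in>A - {a}. ?G b u)"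
        by (simp flip: sum_distrib_left)
    qed
    finally show "(\<Sum>ys\<in>permutations_of_set (A - {a}). integral {t..s} (\<lambda>u. g a u * list_iterated_integral g t ys u))
      = integral {t..s} (\<lambda>u. g a u * (\<Prod>b\<in>A - {a}. ?G b u))" .
  qed
  also have "\<dots> = integral {t..s} (\<lambda>u. \<Sum>a\<in>A. g a u * (\<Prod>b\<in>A - {a}. ?G b u))"
  proof (rule Henstock_Kurzweil_Integration.integral_sum[OF A(1), symmetric])
    fix a assume "a \<in> A"
    then show "(\<lambda>u. g a u * (\<Prod>b\<in>A - {a}. ?G b u)) integrable_on {t..s}"
      by (intro integrable_continuous_interval continuous_on_mult continuous_on_prod gc
          indefinite_integral_continuous_1) auto
  qed
  also have "\<dots> = (\<Prod>a\<in>A. ?G a s) - (\<Prod>a\<in>A. ?G a t)"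
  proof (rule integral_unique, rule fundamental_theorem_of_calculus)
    show "t \<le> s" using Suc.prems(3) by simp
    fix u assume "u \<in> {t..s}"
    then have "((\<lambda>u. \<Prod>a\<in>A. ?G a u) has_real_derivative (\<Sum>a\<in>A. g a u * (\<Prod>b\<in>A - {a}. ?G b u))) (at u within {t..s})"
      by (intro has_real_derivative_prod_within[OF A(1)] integral_has_real_derivative gc)
    then show "((\<lambda>u. \<Prod>a\<in>A. ?G a u) has_vector_derivative (\<Sum>a\<in>A. g a u * (\<Prod>b\<in>A - {a}. ?G b u))) (at u within {t..s})"
      by (simp add: has_real_derivative_iff_has_vector_derivative)
  qed
  also have "(\<Prod>a\<in>A. ?G a t) = 0" using A by (intro prod_zero) auto
  finally show ?case by simp
qed

lemma sum_permutes_iterated_integral: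
  assumes "\<And>l. l \<in> {1..k} \<Longrightarrow> continuous_on {t..T} (g l)" "t \<le> T"
  shows "(\<Sum>\<sigma> | \<sigma> permutes {1..k}. iterated_integral (\<lambda>q. g (\<sigma> q)) t k T) = (\<Prod>l\<in>{1..k}. integral {t..T} (g l))"
  unfolding iterated_integral_eq_list sum_permutes_eq_permutations_of_set[of "\<lambda>xs. list_iterated_integral g t xs T"]
  by (rule sum_permutations_list_iterated_integral) (use assms in auto)

section \<open>Lebesgue integrals over an ordered simplex\<close>

lemma continuous_iterated_integral:
  assumes "\<And>l. l \<in> {1..k} \<Longrightarrow> continuous_on {t..T} (c l)"
  shows "continuous_on {t..T} (iterated_integral c t k)"
proof -
  have "iterated_integral c t k = list_iterated_integral c t (map (\<lambda>q. q) (rev [1..<Suc k]))"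
    using iterated_integral_eq_list[of c "\<lambda>q. q"] by (simp add: fun_eq_iff)
  then show ?thesis using continuous_list_iterated_integral[of "map (\<lambda>q. q) (rev [1..<Suc k])" t T c] assms
    by (auto simp del: upt_Suc)
qed

text \<open>The range \<open>D\<close> of the coordinates is a parameter because it shrinks from the
  full interval to \<open>{t..<u}\<close> once the last coordinate is fixed at
  \<open>u\<close>.\<close>

definition simplex_integrand :: "(nat \<Rightarrow> real \<Rightarrow> real) \<Rightarrow> real set \<Rightarrow> nat \<Rightarrow> (nat \<Rightarrow> real) \<Rightarrow> real" where
  "simplex_integrand c D k x = (\<Prod>l\<in>{1..k}. indicator D (x l) * c l (x l)) * (if strict_mono_on {1..k} x then 1 else 0)"

interpretation lborel_product: product_sigma_finite "\<lambda>l::nat. lborel :: real measure" ..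

lemma simplex_integrand_integrable:
  assumes c: "\<And>l. l \<in> {1..k} \<Longrightarrow> continuous_on {t..s} (c l)" and D: "D \<in> sets borel" "D \<subseteq> {t..s}"
  shows "integrable (\<Pi>\<^sub>M l\<in>{1..k}. lborel) (simplex_integrand c D k)"
proof -
  have "set_integrable lborel D (c l)" if "l \<in> {1..k}" for l
    by (rule set_integrable_subset[OF borel_integrable_atLeastAtMost'[OF c[OF that]]]) (use D in auto)
  then have int: "integrable lborel (\<lambda>u. indicator D u * c l u)" if "l \<in> {1..k}" for l
    using that by (simp add: set_integrable_def)
  have P: "integrable (\<Pi>\<^sub>M l\<in>{1..k}. lborel) (\<lambda>x. \<Prod>l\<in>{1..k}. indicator D (x l) * c l (x l))"
    by (rule lborel_product.product_integrable_prod) (use int in auto)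
  have "Measurable.pred (\<Pi>\<^sub>M l\<in>{1..k}. lborel :: real measure) (\<lambda>x. \<forall>r\<in>{1..k}. \<forall>q\<in>{1..k}. r < q \<longrightarrow> x r < x q)"
  proof (intro pred_intros_finite(3))
    fix r q assume rq: "r \<in> {1..k}" "q \<in> {1..k}"
    have "(\<lambda>x. x l) \<in> borel_measurable (\<Pi>\<^sub>M l\<in>{1..k}. lborel :: real measure)" if "l \<in> {1..k}" for l
      using measurable_component_singleton[OF that, of "\<lambda>_. lborel :: real measure"] by simp
    note [measurable] = this[OF rq(1)] this[OF rq(2)]
    show "Measurable.pred (\<Pi>\<^sub>M l\<in>{1..k}. lborel :: real measure) (\<lambda>x. r < q \<longrightarrow> x r < x q)"
      by measurable
  qed simp_all
  then have m: "Measurable.pred (\<Pi>\<^sub>M l\<in>{1..k}. lborel :: real measure) (\<lambda>x. strict_mono_on {1..k} x)"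
    by (simp add: strict_mono_on_def)
  show ?thesis
  proof (rule Bochner_Integration.integrable_bound[OF P])
    note [measurable] = m borel_measurable_integrable[OF P]
    show "simplex_integrand c D k \<in> borel_measurable (\<Pi>\<^sub>M l\<in>{1..k}. lborel)"
      unfolding simplex_integrand_def[abs_def] by measurable
    show "AE x in (\<Pi>\<^sub>M l\<in>{1..k}. lborel). norm (simplex_integrand c D k x) \<le> norm (\<Prod>l\<in>{1..k}. indicator D (x l) * c l (x l))"
      by (simp add: simplex_integrand_def)
  qed
qed

text \<open>Strict monotonicity puts all earlier coordinates below \<open>u\<close>, so their range
  may be replaced by \<open>{t..<u}\<close>. The two inclusions on \<open>D\<close> admit both the
  closed interval of the cube and the half-open one produced here.\<close>

lemma simplex_integrand_Suc:
  assumes D: "{t..<s} \<subseteq> D" "D \<subseteq> {t..s}"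
  shows "simplex_integrand c D (Suc k) (y(Suc k := u))
    = (indicator D u * c (Suc k) u) * simplex_integrand c {t..<u} k y"
proof (cases "u \<in> D")
  case False
  have "(\<Prod>l\<in>{1..Suc k}. indicator D ((y(Suc k := u)) l) * c l ((y(Suc k := u)) l)) = 0"
    by (rule prod_zero) (use False in \<open>auto intro!: bexI[of _ "Suc k"]\<close>)
  then show ?thesis using False by (simp add: simplex_integrand_def)
next
  case True
  have us: "u \<le> s" using True D by auto
  have P: "(\<Prod>l\<in>{1..Suc k}. indicator D ((y(Suc k := u)) l) * c l ((y(Suc k := u)) l))
      = c (Suc k) u * (\<Prod>l\<in>{1..k}. indicator D (y l) * c l (y l))"
    using True by (simp add: atLeastAtMostSuc_conv)
  have mono: "strict_mono_on {1..Suc k} (y(Suc k := u)) \<longleftrightarrow> strict_mono_on {1..k} y \<and> (\<forall>l\<in>{1..k}. y l < u)"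
    unfolding strict_mono_on_def by (auto simp: le_Suc_eq)
  show ?thesis
  proof (cases "\<forall>l\<in>{1..k}. y l < u")
    case lt: True
    have "(\<Prod>l\<in>{1..k}. indicator D (y l) * c l (y l)) = (\<Prod>l\<in>{1..k}. indicator {t..<u} (y l) * c l (y l))"
      by (rule prod.cong[OF refl]) (use lt us D in \<open>force simp: indicator_def\<close>)
    then show ?thesis using True lt unfolding simplex_integrand_def P mono by simp
  next
    case False
    then obtain l where "l \<in> {1..k}" "u \<le> y l" by force
    then have "(\<Prod>l\<in>{1..k}. indicator {t..<u} (y l) * c l (y l)) = 0"
      by (intro prod_zero) (auto intro!: bexI[of _ l])
    then show ?thesis using False unfolding simplex_integrand_def P mono by auto
  qed
qed

text \<open>Fubini with the last coordinate outermost. \<open>D\<close> is determined up to the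
  point \<open>s\<close>, which is a null set.\<close>

lemma simplex_integral:
  assumes "\<And>l. l \<in> {1..k} \<Longrightarrow> continuous_on {t..T} (c l)" "s \<in> {t..T}"
    and "D \<in> sets borel" "{t..<s} \<subseteq> D" "D \<subseteq> {t..s}"
  shows "(\<integral>x. simplex_integrand c D k x \<partial>(\<Pi>\<^sub>M l\<in>{1..k}. lborel)) = iterated_integral c t k s"
  using assms
proof (induction k arbitrary: s D)
  case 0
  have "simplex_integrand c D 0 = (\<lambda>x. 1)" by (simp add: simplex_integrand_def[abs_def] strict_mono_on_def)
  then show ?case by (simp add: space_PiM measure_def PiM_empty)
next
  case (Suc k)
  let ?P = "\<lambda>I. \<Pi>\<^sub>M l\<in>I. (lborel :: real measure)"
  have c: "continuous_on {t..s} (c l)" if "l \<in> {1..Suc k}" for l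
    using continuous_on_subset[OF Suc.prems(1)[OF that], of "{t..s}"] Suc.prems(2) by auto
  have ins: "{1..Suc k} = {Suc k} \<union> {1..k}" by auto
  have int: "integrable (?P ({Suc k} \<union> {1..k})) (simplex_integrand c D (Suc k))"
    unfolding ins[symmetric] by (rule simplex_integrand_integrable[OF c Suc.prems(3,5)])
  have "(\<integral>x. simplex_integrand c D (Suc k) x \<partial>?P {1..Suc k})
      = (\<integral>x. (\<integral>y. simplex_integrand c D (Suc k) (merge {Suc k} {1..k} (x, y)) \<partial>?P {1..k}) \<partial>?P {Suc k})"
    unfolding ins by (rule lborel_product.product_integral_fold[OF _ _ _ int]) auto
  also have "\<dots> = (\<integral>x. (indicator D (x (Suc k)) * c (Suc k) (x (Suc k))) * iterated_integral c t k (x (Suc k)) \<partial>?P {Suc k})"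
  proof (rule Bochner_Integration.integral_cong[OF refl])
    fix x :: "nat \<Rightarrow> real"
    let ?u = "x (Suc k)"
    have "(\<integral>y. simplex_integrand c D (Suc k) (merge {Suc k} {1..k} (x, y)) \<partial>?P {1..k})
        = (\<integral>y. (indicator D ?u * c (Suc k) ?u) * simplex_integrand c {t..<?u} k y \<partial>?P {1..k})"
    proof (rule Bochner_Integration.integral_cong[OF refl])
      fix y assume "y \<in> space (?P {1..k})"
      then have "y \<in> extensional {1..k}" by (auto simp: space_PiM PiE_def)
      then have "merge {Suc k} {1..k} (x, y) = y(Suc k := ?u)"
        by (auto simp: merge_def fun_eq_iff extensional_def)
      then show "simplex_integrand c D (Suc k) (merge {Suc k} {1..k} (x, y))
          = (indicator D ?u * c (Suc k) ?u) * simplex_integrand c {t..<?u} k y"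
        by (simp only: simplex_integrand_Suc[OF Suc.prems(4,5)])
    qed
    also have "\<dots> = (indicator D ?u * c (Suc k) ?u) * (\<integral>y. simplex_integrand c {t..<?u} k y \<partial>?P {1..k})"
      by (rule integral_mult_right_zero)
    also have "\<dots> = (indicator D ?u * c (Suc k) ?u) * iterated_integral c t k ?u"
    proof (cases "?u \<in> D")
      case True
      then have u: "?u \<in> {t..T}" using Suc.prems(2,5) by auto
      have "(\<integral>y. simplex_integrand c {t..<?u} k y \<partial>?P {1..k}) = iterated_integral c t k ?u"
        by (rule Suc.IH[OF _ u]) (use Suc.prems in auto)
      then show ?thesis by simp
    qed simp
    finally show "(\<integral>y. simplex_integrand c D (Suc k) (merge {Suc k} {1..k} (x, y)) \<partial>?P {1..k})
        = (indicator D ?u * c (Suc k) ?u) * iterated_integral c t k ?u" .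
  qed
  also have "\<dots> = (\<integral>u. (indicator D u * c (Suc k) u) * iterated_integral c t k u \<partial>lborel)"
  proof (rule lborel_product.product_integral_singleton)
    have "continuous_on {t..s} (iterated_integral c t k)"
      by (rule continuous_iterated_integral) (use c in auto)
    then have "set_integrable lborel D (\<lambda>u. c (Suc k) u * iterated_integral c t k u)"
      using set_integrable_subset[OF borel_integrable_atLeastAtMost'[OF continuous_on_mult[OF c]], of "Suc k" "iterated_integral c t k" D]
        Suc.prems(3,5) by auto
    then show "(\<lambda>u. (indicator D u * c (Suc k) u) * iterated_integral c t k u) \<in> borel_measurable lborel"
      by (auto simp: set_integrable_def mult.assoc dest: borel_measurable_integrable)
  qed
  also have "\<dots> = (LINT u:{t..s}|lborel. c (Suc k) u * iterated_integral c t k u)"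
    unfolding set_lebesgue_integral_def
  proof (rule integral_cong_AE)
    have kc: "continuous_on {t..s} (iterated_integral c t k)"
      by (rule continuous_iterated_integral) (use c in auto)
    have si: "set_integrable lborel {t..s} (\<lambda>u. c (Suc k) u * iterated_integral c t k u)"
      by (rule borel_integrable_atLeastAtMost'[OF continuous_on_mult[OF c kc]]) simp
    have "set_integrable lborel D (\<lambda>u. c (Suc k) u * iterated_integral c t k u)"
      by (rule set_integrable_subset[OF si]) (use Suc.prems(3,5) in auto)
    then show "(\<lambda>u. (indicator D u * c (Suc k) u) * iterated_integral c t k u) \<in> borel_measurable lborel"
      by (auto simp: set_integrable_def mult.assoc dest: borel_measurable_integrable)
    show "(\<lambda>u. indicat_real {t..s} u *\<^sub>R (c (Suc k) u * iterated_integral c t k u)) \<in> borel_measurable lborel"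
      using si unfolding set_integrable_def by (rule borel_measurable_integrable)
    have "AE u in lborel. u \<noteq> s" by (rule AE_lborel_singleton)
    then show "AE u in lborel. (indicator D u * c (Suc k) u) * iterated_integral c t k u
        = indicat_real {t..s} u *\<^sub>R (c (Suc k) u * iterated_integral c t k u)"
    proof eventually_elim
      case (elim u)
      have "u \<in> D \<longleftrightarrow> u \<in> {t..s}" using elim Suc.prems(4,5) by force
      then have "indicat_real D u = indicat_real {t..s} u" by (simp only: indicator_def)
      then show ?case by simp
    qed
  qed
  also have "\<dots> = integral {t..s} (\<lambda>u. c (Suc k) u * iterated_integral c t k u)"
    by (rule set_borel_integral_eq_integral(2))
      (intro borel_integrable_atLeastAtMost' continuous_on_mult c continuous_iterated_integral, use c in auto)
  finally show ?case by simp
qed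

text \<open>Kept general in \<open>g\<close> to cover both the Fourier coefficients, where
  \<open>c l\<close> is the product of \<open>\<psi> l\<close> and \<open>\<phi> (j l)\<close>, and
  the squared kernel.\<close>

lemma cube_integral_eq_iterated_integral:
  assumes c: "\<And>l. l \<in> {1..k} \<Longrightarrow> continuous_on {t..T} (c l)" and "t \<le> T"
    and g: "\<And>x. g x = (if strict_mono_on {1..k} x then \<Prod>l\<in>{1..k}. c l (x l) else 0)"
  shows "cube_integral t T k g = iterated_integral c t k T"
proof -
  have "cube_integral t T k g = (\<integral>x. simplex_integrand c {t..T} k x \<partial>(\<Pi>\<^sub>M l\<in>{1..k}. lborel))"
    unfolding cube_integral_def set_lebesgue_integral_def
  proof (rule Bochner_Integration.integral_cong[OF refl])
    fix x assume "x \<in> space (\<Pi>\<^sub>M l\<in>{1..k}. (lborel :: real measure))"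
    then have ext: "x \<in> extensional {1..k}" by (auto simp: space_PiM PiE_def)
    have "indicat_real ({1..k} \<rightarrow>\<^sub>E {t..T}) x = (\<Prod>l\<in>{1..k}. indicat_real {t..T} (x l))"
    proof (cases "x \<in> {1..k} \<rightarrow>\<^sub>E {t..T}")
      case True
      then show ?thesis by (simp add: PiE_iff)
    next
      case False
      then obtain l where "l \<in> {1..k}" "x l \<notin> {t..T}" using ext by (auto simp: PiE_iff)
      then have "(\<Prod>l\<in>{1..k}. indicat_real {t..T} (x l)) = 0" by (intro prod_zero) (auto intro!: bexI[of _ l])
      then show ?thesis using False by simp
    qed
    then show "indicat_real ({1..k} \<rightarrow>\<^sub>E {t..T}) x *\<^sub>R g x = simplex_integrand c {t..T} k x"
      by (simp add: g simplex_integrand_def prod.distrib)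
  qed
  also have "\<dots> = iterated_integral c t k T"
    by (rule simplex_integral[OF c]) (use assms(2) in auto)
  finally show ?thesis .
qed

section \<open>The mean-square error\<close>

context wiener_orthonormal
begin

lemma t_le_T: "t \<le> T" "T \<in> {t..T}"
  using t by auto

lemma permutes_index:
  assumes "\<sigma> permutes {1..k}" "\<And>l. l \<in> {1..k} \<Longrightarrow> i l \<in> {1..m}" "l \<in> {1..k}"
  shows "i (\<sigma> l) \<in> {1..m}"
  using assms permutes_in_image[OF assms(1)] by blast

lemma sq_integrable_iterated_ito:
  assumes "\<And>l. l \<in> {1..k} \<Longrightarrow> i l \<in> {1..m}" "\<And>l. l \<in> {1..k} \<Longrightarrow> continuous_on {t..T} (\<psi> l)"
  shows "sq_integrable M (iterated_ito M F f t \<psi> i k T)"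
  using ms_ucontD[OF conjunct2[OF iterated_ito_process[OF t(1) assms]]] t_le_T by simp

lemma sq_integrable_perm_sum:
  assumes "\<And>l. l \<in> {1..k} \<Longrightarrow> i l \<in> {1..m}"
  shows "sq_integrable M (perm_sum M F f t T \<phi> k i j)"
  unfolding perm_sum_def[abs_def]
proof (rule sq_integrable_sum)
  fix \<sigma> assume "\<sigma> \<in> {\<sigma>. \<sigma> permutes {1..k}}"
  then have "\<sigma> permutes {1..k}" by simp
  then show "sq_integrable M (iterated_ito M F f t (\<lambda>l. \<phi> (j (\<sigma> l))) (\<lambda>l. i (\<sigma> l)) k T)"
    using permutes_index[of \<sigma> k i] assms by (intro sq_integrable_iterated_ito \<phi>_cont) auto
qed

text \<open>\<open>G_set\<close> is the complement of the injective multi-indices, and the sum over the latter splits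
  into one ordered sum per permutation.\<close>

lemma off_diagonal_ms_limit:
  assumes i: "\<And>l. l \<in> {1..k} \<Longrightarrow> i l \<in> {1..m}"
  shows "has_ms_limit M (\<lambda>N \<omega>. \<Sum>l\<in>G_set k (n N). \<Prod>q\<in>{1..k}.
      \<phi> (j q) (\<tau> N (l q)) * (f (i q) (\<tau> N (Suc (l q))) \<omega> - f (i q) (\<tau> N (l q)) \<omega>))
    (\<lambda>\<omega>. (\<Prod>l\<in>{1..k}. \<zeta> (i l) (j l) \<omega>) - perm_sum M F f t T \<phi> k i j \<omega>)"
proof -
  let ?P = "\<lambda>N \<omega>. \<Prod>q\<in>{1..k}. R (i q) (j q) N \<omega>" and ?Z = "\<lambda>\<omega>. \<Prod>l\<in>{1..k}. \<zeta> (i l) (j l) \<omega>"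
  let ?O = "\<lambda>\<sigma> N \<omega>. ordered_sum (weighted_incr (\<lambda>q. \<phi> (j (\<sigma> q))) (\<lambda>q. i (\<sigma> q)) (\<tau> N) \<omega>) k (n N)"
  let ?I = "\<lambda>\<sigma>. iterated_ito M F f t (\<lambda>q. \<phi> (j (\<sigma> q))) (\<lambda>q. i (\<sigma> q)) k T"
  let ?S = "{\<sigma>. \<sigma> permutes {1..k}}"
  have eq: "(\<Sum>l\<in>G_set k (n N). \<Prod>q\<in>{1..k}.
      \<phi> (j q) (\<tau> N (l q)) * (f (i q) (\<tau> N (Suc (l q))) \<omega> - f (i q) (\<tau> N (l q)) \<omega>))
    = ?P N \<omega> - (\<Sum>\<sigma>\<in>?S. ?O \<sigma> N \<omega>)" for N \<omega>
  proof -
    define c where "c = weighted_incr (\<lambda>q. \<phi> (j q)) i (\<tau> N) \<omega>"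
    have e1: "\<phi> (j q) (\<tau> N (l q)) * (f (i q) (\<tau> N (Suc (l q))) \<omega> - f (i q) (\<tau> N (l q)) \<omega>) = c q (l q)" for q l
      by (simp add: c_def weighted_incr_def incr_def)
    have e2: "(\<Sum>l<n N. c q l) = R (i q) (j q) N \<omega>" for q
      by (simp add: c_def weighted_incr_def riemann_noise_def)
    have e3: "(\<lambda>q. c (\<sigma> q)) = weighted_incr (\<lambda>q. \<phi> (j (\<sigma> q))) (\<lambda>q. i (\<sigma> q)) (\<tau> N) \<omega>" for \<sigma>
      by (simp add: c_def weighted_incr_def fun_eq_iff)
    have e4: "ordered_sum (\<lambda>q. c (\<sigma> q)) k (n N) = ?O \<sigma> N \<omega>" for \<sigma>
      by (rule arg_cong[where f = "\<lambda>g. ordered_sum g k (n N)"], rule e3)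
    have "(\<Sum>l\<in>G_set k (n N). \<Prod>q\<in>{1..k}.
        \<phi> (j q) (\<tau> N (l q)) * (f (i q) (\<tau> N (Suc (l q))) \<omega> - f (i q) (\<tau> N (l q)) \<omega>))
      = (\<Sum>l\<in>G_set k (n N). \<Prod>q\<in>{1..k}. c q (l q))"
      by (simp only: e1)
    also have "\<dots> = (\<Prod>q\<in>{1..k}. \<Sum>l<n N. c q l) - (\<Sum>\<sigma>\<in>?S. ordered_sum (\<lambda>q. c (\<sigma> q)) k (n N))"
      by (rule sum_G_set)
    finally show ?thesis by (simp only: e2 e4)
  qed
  have i\<sigma>: "\<And>l. l \<in> {1..k} \<Longrightarrow> i (\<sigma> l) \<in> {1..m}" if "\<sigma> \<in> ?S" for \<sigma>
    using permutes_index[of \<sigma> k i] that i by auto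
  have sqO: "sq_integrable M (?O \<sigma> N)" if "\<sigma> \<in> ?S" for \<sigma> N
    using ordered_sum_adapted[OF t(1) order_refl part, of k "\<lambda>q. i (\<sigma> q)" "n N" N "\<lambda>q. \<phi> (j (\<sigma> q))"] i\<sigma>[OF that] by simp
  have sqI: "sq_integrable M (?I \<sigma>)" if "\<sigma> \<in> ?S" for \<sigma>
    using i\<sigma>[OF that] by (intro sq_integrable_iterated_ito \<phi>_cont) auto
  have limO: "(\<lambda>N. expectation (\<lambda>\<omega>. (?O \<sigma> N \<omega> - ?I \<sigma> \<omega>)\<^sup>2)) \<longlonglongrightarrow> 0" if "\<sigma> \<in> ?S" for \<sigma>
    using i\<sigma>[OF that] by (intro ordered_sum_ms_limit t t_le_T \<phi>_cont part mesh) auto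
  let ?D = "\<lambda>\<omega>. \<Sum>\<sigma>\<in>?S. ?I \<sigma> \<omega>"
  have limD: "(\<lambda>N. expectation (\<lambda>\<omega>. ((\<Sum>\<sigma>\<in>?S. ?O \<sigma> N \<omega>) - ?D \<omega>)\<^sup>2)) \<longlonglongrightarrow> 0"
    using ms_tendsto_sum[of ?S M ?O ?I "\<lambda>_. 1", OF finite_permutations sqO sqI limO] by simp
  have sqD: "sq_integrable M ?D" "sq_integrable M (\<lambda>\<omega>. \<Sum>\<sigma>\<in>?S. ?O \<sigma> N \<omega>)" for N
    by (intro sq_integrable_sum sqI sqO; assumption)+
  have PR: "sq_integrable M (?P N)" "sq_integrable M ?Z" "(\<lambda>N. expectation (\<lambda>\<omega>. (?P N \<omega> - ?Z \<omega>)\<^sup>2)) \<longlonglongrightarrow> 0" for N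
    using prod_riemann_noise_ms_limit[where i = i and j = j and k = k, OF i] by blast+
  \<comment> \<open>A difference is written as a sum over \<open>bool\<close> with coefficients 1
    and -1, so that \<open>ms_tendsto_sum\<close> applies.\<close>
  let ?X = "\<lambda>r N \<omega>. if r then ?P N \<omega> else \<Sum>\<sigma>\<in>?S. ?O \<sigma> N \<omega>" and ?Y = "\<lambda>r \<omega>. if r then ?Z \<omega> else ?D \<omega>"
  have "(\<lambda>N. expectation (\<lambda>\<omega>. ((\<Sum>r\<in>UNIV. (if r then 1 else -1) * ?X r N \<omega>) - (\<Sum>r\<in>UNIV. (if r then 1 else -1) * ?Y r \<omega>))\<^sup>2)) \<longlonglongrightarrow> 0"
  proof (rule ms_tendsto_sum)
    show "sq_integrable M (?X r N)" for r N by (cases r) (simp_all only: PR sqD if_True if_False simp_thms)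
    show "sq_integrable M (?Y r)" for r by (cases r) (simp_all only: PR sqD if_True if_False simp_thms)
    show "(\<lambda>N. expectation (\<lambda>\<omega>. (?X r N \<omega> - ?Y r \<omega>)\<^sup>2)) \<longlonglongrightarrow> 0" for r
      by (cases r) (simp_all only: PR limD if_True if_False simp_thms)
  qed simp
  then have lim: "(\<lambda>N. expectation (\<lambda>\<omega>. ((?P N \<omega> - (\<Sum>\<sigma>\<in>?S. ?O \<sigma> N \<omega>)) - (?Z \<omega> - ?D \<omega>))\<^sup>2)) \<longlonglongrightarrow> 0"
    by (simp add: UNIV_bool)
  show ?thesis
    unfolding eq perm_sum_def
    using lim has_ms_limit_iff[of M "\<lambda>N \<omega>. ?P N \<omega> - (\<Sum>\<sigma>\<in>?S. ?O \<sigma> N \<omega>)" "\<lambda>\<omega>. ?Z \<omega> - ?D \<omega>",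
      OF sq_integrable_diff[OF PR(1) sqD(2)] sq_integrable_diff[OF PR(2) sqD(1)]] by blast
qed

text \<open>Only these permutations survive in the covariances, by orthogonality of different components.\<close>

definition stab :: "nat \<Rightarrow> (nat \<Rightarrow> nat) \<Rightarrow> (nat \<Rightarrow> nat) set" where
  "stab k i = {\<rho>. \<rho> permutes {1..k} \<and> (\<forall>l\<in>{1..k}. i l = i (\<rho> l))}"

section \<open>Covariances of iterated integrals and permutation sums\<close>

lemma sum_permutes_stab:
  fixes h :: "(nat \<Rightarrow> nat) \<Rightarrow> real"
  shows "(\<Sum>\<rho> | \<rho> permutes {1..k}. if \<forall>l\<in>{1..k}. i l = i (\<rho> l) then h \<rho> else 0) = sum h (stab k i)"
  unfolding stab_def by (simp add: sum.If_cases finite_permutations Int_def)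

lemma expectation_iterated_ito_perm_sum:
  assumes i: "\<And>l. l \<in> {1..k} \<Longrightarrow> i l \<in> {1..m}" and \<psi>: "\<And>l. l \<in> {1..k} \<Longrightarrow> continuous_on {t..T} (\<psi> l)"
  shows "expectation (\<lambda>\<omega>. iterated_ito M F f t \<psi> i k T \<omega> * perm_sum M F f t T \<phi> k i j \<omega>)
    = (\<Sum>\<rho>\<in>stab k i. fourier_coeff \<psi> \<phi> t T k (j \<circ> \<rho>))"
proof -
  let ?J = "iterated_ito M F f t \<psi> i k T"
  let ?I = "\<lambda>\<sigma>. iterated_ito M F f t (\<lambda>q. \<phi> (j (\<sigma> q))) (\<lambda>q. i (\<sigma> q)) k T"
  let ?S = "{\<sigma>. \<sigma> permutes {1..k}}"
  have i\<sigma>: "\<And>l. l \<in> {1..k} \<Longrightarrow> i (\<sigma> l) \<in> {1..m}" if "\<sigma> \<in> ?S" for \<sigma>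
    using permutes_index[of \<sigma> k i] that i by auto
  have int: "integrable M (\<lambda>\<omega>. ?J \<omega> * ?I \<sigma> \<omega>)" if "\<sigma> \<in> ?S" for \<sigma>
    by (intro sq_integrable_mult sq_integrable_iterated_ito i \<psi> \<phi>_cont i\<sigma>[OF that])
  have "expectation (\<lambda>\<omega>. ?J \<omega> * perm_sum M F f t T \<phi> k i j \<omega>) = expectation (\<lambda>\<omega>. \<Sum>\<sigma>\<in>?S. ?J \<omega> * ?I \<sigma> \<omega>)"
    by (simp add: perm_sum_def sum_distrib_left)
  also have "\<dots> = (\<Sum>\<sigma>\<in>?S. expectation (\<lambda>\<omega>. ?J \<omega> * ?I \<sigma> \<omega>))"
    by (rule Bochner_Integration.integral_sum) (rule int)
  also have "\<dots> = (\<Sum>\<sigma>\<in>?S. if \<forall>l\<in>{1..k}. i l = i (\<sigma> l) then fourier_coeff \<psi> \<phi> t T k (j \<circ> \<sigma>) else 0)"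
  proof (rule sum.cong[OF refl])
    fix \<sigma> assume \<sigma>: "\<sigma> \<in> ?S"
    \<comment> \<open>The inner product of the two integrals is an iterated integral of the products
      of \<open>\<psi> l\<close> and \<open>\<phi> (j (\<sigma> l))\<close>; the ordered kernel
      describes the same simplex inside a Fourier coefficient.\<close>
    have "fourier_coeff \<psi> \<phi> t T k (j \<circ> \<sigma>) = iterated_integral (\<lambda>l u. \<psi> l u * \<phi> (j (\<sigma> l)) u) t k T"
      unfolding fourier_coeff_def
      by (rule cube_integral_eq_iterated_integral)
        (auto intro!: continuous_on_mult \<psi> \<phi>_cont t_le_T simp: ordered_kernel_def prod.distrib)
    then show "expectation (\<lambda>\<omega>. ?J \<omega> * ?I \<sigma> \<omega>) = (if \<forall>l\<in>{1..k}. i l = i (\<sigma> l) then fourier_coeff \<psi> \<phi> t T k (j \<circ> \<sigma>) else 0)"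
      by (simp only: iterated_ito_inner[OF t(1) t_le_T(2) i \<psi> i\<sigma>[OF \<sigma>] \<phi>_cont])
  qed
  finally show ?thesis by (simp only: sum_permutes_stab[of k i])
qed

text \<open>Writing the second permutation as \<open>\<rho> \<circ> \<sigma>\<close> makes the
  condition on components independent of \<open>\<sigma>\<close>. For fixed \<open>\<rho>\<close>
  the sum over \<open>\<sigma>\<close> then fills the cube and splits into one-dimensional
  integrals, which orthonormality evaluates.\<close>

lemma expectation_perm_sum_perm_sum:
  assumes i: "\<And>l. l \<in> {1..k} \<Longrightarrow> i l \<in> {1..m}"
  shows "expectation (\<lambda>\<omega>. perm_sum M F f t T \<phi> k i j \<omega> * perm_sum M F f t T \<phi> k i j' \<omega>)
    = (\<Sum>\<rho>\<in>stab k i. if \<forall>l\<in>{1..k}. j l = j' (\<rho> l) then 1 else 0)"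
proof -
  let ?I = "\<lambda>j \<sigma>. iterated_ito M F f t (\<lambda>q. \<phi> (j (\<sigma> q))) (\<lambda>q. i (\<sigma> q)) k T"
  let ?S = "{\<sigma>. \<sigma> permutes {1..k}}"
  let ?V = "\<lambda>\<sigma> \<sigma>'. iterated_integral (\<lambda>l u. \<phi> (j (\<sigma> l)) u * \<phi> (j' (\<sigma>' l)) u) t k T"
  have i\<sigma>: "\<And>l. l \<in> {1..k} \<Longrightarrow> i (\<sigma> l) \<in> {1..m}" if "\<sigma> \<in> ?S" for \<sigma>
    using permutes_index[of \<sigma> k i] that i by auto
  have int: "integrable M (\<lambda>\<omega>. ?I j \<sigma> \<omega> * ?I j' \<sigma>' \<omega>)" if "\<sigma> \<in> ?S" "\<sigma>' \<in> ?S" for \<sigma> \<sigma>'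
    by (intro sq_integrable_mult sq_integrable_iterated_ito \<phi>_cont i\<sigma>[OF that(1)] i\<sigma>[OF that(2)])
  have "expectation (\<lambda>\<omega>. perm_sum M F f t T \<phi> k i j \<omega> * perm_sum M F f t T \<phi> k i j' \<omega>)
      = expectation (\<lambda>\<omega>. \<Sum>\<sigma>\<in>?S. \<Sum>\<sigma>'\<in>?S. ?I j \<sigma> \<omega> * ?I j' \<sigma>' \<omega>)"
    by (simp only: perm_sum_def sum_product)
  also have "\<dots> = (\<Sum>\<sigma>\<in>?S. expectation (\<lambda>\<omega>. \<Sum>\<sigma>'\<in>?S. ?I j \<sigma> \<omega> * ?I j' \<sigma>' \<omega>))"
    by (rule Bochner_Integration.integral_sum) (intro Bochner_Integration.integrable_sum int)
  also have "\<dots> = (\<Sum>\<sigma>\<in>?S. \<Sum>\<rho>\<in>?S. if \<forall>l\<in>{1..k}. i l = i (\<rho> l) then ?V \<sigma> (\<rho> \<circ> \<sigma>) else 0)"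
  proof (rule sum.cong[OF refl])
    fix \<sigma> assume \<sigma>: "\<sigma> \<in> ?S"
    then have \<sigma>p: "\<sigma> permutes {1..k}" by simp
    have "expectation (\<lambda>\<omega>. \<Sum>\<sigma>'\<in>?S. ?I j \<sigma> \<omega> * ?I j' \<sigma>' \<omega>) = (\<Sum>\<sigma>'\<in>?S. expectation (\<lambda>\<omega>. ?I j \<sigma> \<omega> * ?I j' \<sigma>' \<omega>))"
      by (rule Bochner_Integration.integral_sum) (rule int[OF \<sigma>])
    also have "\<dots> = (\<Sum>\<sigma>'\<in>?S. if \<forall>l\<in>{1..k}. i (\<sigma> l) = i (\<sigma>' l) then ?V \<sigma> \<sigma>' else 0)"
      by (rule sum.cong[OF refl]) (rule iterated_ito_inner[OF t(1) t_le_T(2) i\<sigma>[OF \<sigma>] \<phi>_cont i\<sigma> \<phi>_cont])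
    also have "\<dots> = (\<Sum>\<rho>\<in>?S. if \<forall>l\<in>{1..k}. i (\<sigma> l) = i ((\<rho> \<circ> \<sigma>) l) then ?V \<sigma> (\<rho> \<circ> \<sigma>) else 0)"
      by (rule sum_permutations_compose_right[OF \<sigma>p])
    also have "\<dots> = (\<Sum>\<rho>\<in>?S. if \<forall>l\<in>{1..k}. i l = i (\<rho> l) then ?V \<sigma> (\<rho> \<circ> \<sigma>) else 0)"
    proof (rule sum.cong[OF refl])
      fix \<rho>
      have "(\<forall>l\<in>{1..k}. i (\<sigma> l) = i ((\<rho> \<circ> \<sigma>) l)) \<longleftrightarrow> (\<forall>l\<in>\<sigma> ` {1..k}. i l = i (\<rho> l))" by simp
      then have "(\<forall>l\<in>{1..k}. i (\<sigma> l) = i ((\<rho> \<circ> \<sigma>) l)) \<longleftrightarrow> (\<forall>l\<in>{1..k}. i l = i (\<rho> l))"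
        by (simp only: permutes_image[OF \<sigma>p])
      then show "(if \<forall>l\<in>{1..k}. i (\<sigma> l) = i ((\<rho> \<circ> \<sigma>) l) then ?V \<sigma> (\<rho> \<circ> \<sigma>) else 0) =
        (if \<forall>l\<in>{1..k}. i l = i (\<rho> l) then ?V \<sigma> (\<rho> \<circ> \<sigma>) else 0)" by (simp only:)
    qed
    finally show "expectation (\<lambda>\<omega>. \<Sum>\<sigma>'\<in>?S. ?I j \<sigma> \<omega> * ?I j' \<sigma>' \<omega>)
      = (\<Sum>\<rho>\<in>?S. if \<forall>l\<in>{1..k}. i l = i (\<rho> l) then ?V \<sigma> (\<rho> \<circ> \<sigma>) else 0)" .
  qed
  also have "\<dots> = (\<Sum>\<sigma>\<in>?S. \<Sum>\<rho>\<in>stab k i. ?V \<sigma> (\<rho> \<circ> \<sigma>))" by (simp only: sum_permutes_stab[of k i])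
  also have "\<dots> = (\<Sum>\<rho>\<in>stab k i. \<Sum>\<sigma>\<in>?S. ?V \<sigma> (\<rho> \<circ> \<sigma>))" by (rule sum.swap)
  also have "\<dots> = (\<Sum>\<rho>\<in>stab k i. if \<forall>l\<in>{1..k}. j l = j' (\<rho> l) then 1 else 0)"
  proof (rule sum.cong[OF refl])
    fix \<rho>
    let ?g = "\<lambda>l u. \<phi> (j l) u * \<phi> (j' (\<rho> l)) u"
    have "(\<Sum>\<sigma>\<in>?S. ?V \<sigma> (\<rho> \<circ> \<sigma>)) = (\<Prod>l\<in>{1..k}. integral {t..T} (?g l))"
      using sum_permutes_iterated_integral[of k t T ?g] t_le_T by (simp add: continuous_on_mult \<phi>_cont)
    also have "\<dots> = (\<Prod>l\<in>{1..k}. if j l = j' (\<rho> l) then 1 else 0)" by (simp only: \<phi>_orth)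
    also have "\<dots> = (if \<forall>l\<in>{1..k}. j l = j' (\<rho> l) then 1 else 0)"
      by (auto intro!: prod_zero)
    finally show "(\<Sum>\<sigma>\<in>?S. ?V \<sigma> (\<rho> \<circ> \<sigma>)) = (if \<forall>l\<in>{1..k}. j l = j' (\<rho> l) then 1 else 0)" .
  qed
  finally show ?thesis .
qed

text \<open>Summed against \<open>C j\<close>, the covariances pick out exactly one
  \<open>j = j' \<circ> \<rho>\<close> for each \<open>\<rho>\<close>, and this \<open>j\<close>
  lies in \<open>P\<close> because all entries have the same bound \<open>p\<close>. So the square
  of the expansion has the same expectation as its product with \<open>J\<close>, without any
  passage to the limit in \<open>p\<close>.\<close>

lemma perm_sum_expansion_error:
  fixes p :: nat
  assumes i: "\<And>l. l \<in> {1..k} \<Longrightarrow> i l \<in> {1..m}" and \<psi>: "\<And>l. l \<in> {1..k} \<Longrightarrow> continuous_on {t..T} (\<psi> l)"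
  defines "J \<equiv> iterated_ito M F f t \<psi> i k T" and "D \<equiv> perm_sum M F f t T \<phi> k i"
    and "C \<equiv> fourier_coeff \<psi> \<phi> t T k" and "P \<equiv> {1..k} \<rightarrow>\<^sub>E {0..p}"
  shows "expectation (\<lambda>\<omega>. (J \<omega> - (\<Sum>j\<in>P. C j * D j \<omega>))\<^sup>2)
    = expectation (\<lambda>\<omega>. (J \<omega>)\<^sup>2) - (\<Sum>j\<in>P. C j * expectation (\<lambda>\<omega>. J \<omega> * D j \<omega>))"
proof -
  let ?X = "\<lambda>\<omega>. \<Sum>j\<in>P. C j * D j \<omega>"
  have finP: "finite P" unfolding P_def by (intro finite_PiE) auto
  have sqJ: "sq_integrable M J" unfolding J_def by (rule sq_integrable_iterated_ito[OF i \<psi>])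
  have sqD: "sq_integrable M (D j)" for j unfolding D_def by (rule sq_integrable_perm_sum[OF i])
  have sqX: "sq_integrable M ?X" by (intro sq_integrable_sum sq_integrable_cmult sqD)
  have JX: "expectation (\<lambda>\<omega>. J \<omega> * ?X \<omega>) = (\<Sum>j\<in>P. C j * expectation (\<lambda>\<omega>. J \<omega> * D j \<omega>))"
  proof -
    have "expectation (\<lambda>\<omega>. J \<omega> * ?X \<omega>) = expectation (\<lambda>\<omega>. \<Sum>j\<in>P. C j * (J \<omega> * D j \<omega>))"
      by (simp add: sum_distrib_left mult.left_commute)
    also have "\<dots> = (\<Sum>j\<in>P. expectation (\<lambda>\<omega>. C j * (J \<omega> * D j \<omega>)))"
      by (rule Bochner_Integration.integral_sum) (intro integrable_mult_right sq_integrable_mult sqJ sqD)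
    finally show ?thesis by simp
  qed
  have "expectation (\<lambda>\<omega>. (?X \<omega>)\<^sup>2) = expectation (\<lambda>\<omega>. \<Sum>j\<in>P. \<Sum>j'\<in>P. (C j * C j') * (D j \<omega> * D j' \<omega>))"
    by (simp add: power2_eq_square sum_product mult_ac)
  also have "\<dots> = (\<Sum>j\<in>P. \<Sum>j'\<in>P. (C j * C j') * expectation (\<lambda>\<omega>. D j \<omega> * D j' \<omega>))"
  proof -
    have int: "integrable M (\<lambda>\<omega>. (C j * C j') * (D j \<omega> * D j' \<omega>))" for j j'
      by (intro integrable_mult_right sq_integrable_mult sqD)
    have "expectation (\<lambda>\<omega>. \<Sum>j\<in>P. \<Sum>j'\<in>P. (C j * C j') * (D j \<omega> * D j' \<omega>))
      = (\<Sum>j\<in>P. expectation (\<lambda>\<omega>. \<Sum>j'\<in>P. (C j * C j') * (D j \<omega> * D j' \<omega>)))"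
      by (rule Bochner_Integration.integral_sum) (intro Bochner_Integration.integrable_sum int)
    also have "\<dots> = (\<Sum>j\<in>P. \<Sum>j'\<in>P. expectation (\<lambda>\<omega>. (C j * C j') * (D j \<omega> * D j' \<omega>)))"
      by (intro sum.cong[OF refl] Bochner_Integration.integral_sum int)
    finally show ?thesis by simp
  qed
  also have "\<dots> = (\<Sum>j'\<in>P. \<Sum>j\<in>P. (C j * C j') * expectation (\<lambda>\<omega>. D j \<omega> * D j' \<omega>))" by (rule sum.swap)
  also have "\<dots> = (\<Sum>j'\<in>P. C j' * expectation (\<lambda>\<omega>. J \<omega> * D j' \<omega>))"
  proof (rule sum.cong[OF refl])
    fix j' assume j': "j' \<in> P"
    have "(\<Sum>j\<in>P. (C j * C j') * expectation (\<lambda>\<omega>. D j \<omega> * D j' \<omega>))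
      = (\<Sum>j\<in>P. \<Sum>\<rho>\<in>stab k i. C j' * (if j = j' \<circ> \<rho> then C (j' \<circ> \<rho>) else 0))"
    proof (rule sum.cong[OF refl])
      fix j assume j: "j \<in> P"
      \<comment> \<open>Equality on \<open>{1..k}\<close> is equality of functions: elsewhere both
        sides are \<open>undefined\<close>, as \<open>\<rho>\<close> fixes the points outside
        \<open>{1..k}\<close>.\<close>
      have "(\<forall>l\<in>{1..k}. j l = j' (\<rho> l)) \<longleftrightarrow> j = j' \<circ> \<rho>" if "\<rho> \<in> stab k i" for \<rho>
      proof -
        have "\<rho> permutes {1..k}" using that by (simp add: stab_def)
        then have "j l = (j' \<circ> \<rho>) l" if "l \<notin> {1..k}" for l
          using that j j' by (auto simp: P_def PiE_iff extensional_def permutes_def)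
        then show ?thesis by (auto simp: fun_eq_iff)
      qed
      then have "(\<Sum>\<rho>\<in>stab k i. if \<forall>l\<in>{1..k}. j l = j' (\<rho> l) then 1 else 0 :: real) = (\<Sum>\<rho>\<in>stab k i. if j = j' \<circ> \<rho> then 1 else 0)"
        by (intro sum.cong[OF refl]) (simp only:)
      moreover have "expectation (\<lambda>\<omega>. D j \<omega> * D j' \<omega>)
          = (\<Sum>\<rho>\<in>stab k i. if \<forall>l\<in>{1..k}. j l = j' (\<rho> l) then 1 else 0)"
        unfolding D_def by (rule expectation_perm_sum_perm_sum[OF i])
      ultimately show "(C j * C j') * expectation (\<lambda>\<omega>. D j \<omega> * D j' \<omega>)
          = (\<Sum>\<rho>\<in>stab k i. C j' * (if j = j' \<circ> \<rho> then C (j' \<circ> \<rho>) else 0))"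
        by (auto simp: sum_distrib_left intro!: sum.cong)
    qed
    also have "\<dots> = (\<Sum>\<rho>\<in>stab k i. \<Sum>j\<in>P. C j' * (if j = j' \<circ> \<rho> then C (j' \<circ> \<rho>) else 0))" by (rule sum.swap)
    also have "\<dots> = (\<Sum>\<rho>\<in>stab k i. C j' * C (j' \<circ> \<rho>))"
    proof (rule sum.cong[OF refl])
      fix \<rho> assume "\<rho> \<in> stab k i"
      then have "\<rho> permutes {1..k}" by (simp add: stab_def)
      then have "j' \<circ> \<rho> \<in> P"
        using j' permutes_in_image[of \<rho> "{1..k}"] by (auto simp: P_def PiE_iff extensional_def permutes_def)
      then show "(\<Sum>j\<in>P. C j' * (if j = j' \<circ> \<rho> then C (j' \<circ> \<rho>) else 0)) = C j' * C (j' \<circ> \<rho>)"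
        using finP by (simp flip: sum_distrib_left)
    qed
    also have "\<dots> = C j' * expectation (\<lambda>\<omega>. J \<omega> * D j' \<omega>)"
    proof -
      have "expectation (\<lambda>\<omega>. J \<omega> * D j' \<omega>) = (\<Sum>\<rho>\<in>stab k i. C (j' \<circ> \<rho>))"
        unfolding J_def D_def C_def by (rule expectation_iterated_ito_perm_sum[OF i \<psi>])
      then show ?thesis by (simp add: sum_distrib_left)
    qed
    finally show "(\<Sum>j\<in>P. (C j * C j') * expectation (\<lambda>\<omega>. D j \<omega> * D j' \<omega>)) = C j' * expectation (\<lambda>\<omega>. J \<omega> * D j' \<omega>)" .
  qed
  finally have XX: "expectation (\<lambda>\<omega>. (?X \<omega>)\<^sup>2) = (\<Sum>j\<in>P. C j * expectation (\<lambda>\<omega>. J \<omega> * D j \<omega>))" .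
  have "expectation (\<lambda>\<omega>. (J \<omega> - ?X \<omega>)\<^sup>2) = expectation (\<lambda>\<omega>. (J \<omega>)\<^sup>2 - 2 * (J \<omega> * ?X \<omega>) + (?X \<omega>)\<^sup>2)"
    by (simp add: power2_diff algebra_simps)
  also have "\<dots> = expectation (\<lambda>\<omega>. (J \<omega>)\<^sup>2) - 2 * expectation (\<lambda>\<omega>. J \<omega> * ?X \<omega>) + expectation (\<lambda>\<omega>. (?X \<omega>)\<^sup>2)"
  proof -
    have "integrable M (\<lambda>\<omega>. (J \<omega>)\<^sup>2)" "integrable M (\<lambda>\<omega>. (?X \<omega>)\<^sup>2)" "integrable M (\<lambda>\<omega>. J \<omega> * ?X \<omega>)"
      using sqJ sqX sq_integrable_mult[OF sqJ sqX] by (auto simp: sq_integrable_def)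
    then show ?thesis by (simp only: Bochner_Integration.integral_add Bochner_Integration.integral_diff
          Bochner_Integration.integrable_diff integrable_mult_right integral_mult_right_zero)
  qed
  finally show ?thesis unfolding JX XX by simp
qed

lemma expectation_iterated_ito_sq:
  assumes i: "\<And>l. l \<in> {1..k} \<Longrightarrow> i l \<in> {1..m}" and \<psi>: "\<And>l. l \<in> {1..k} \<Longrightarrow> continuous_on {t..T} (\<psi> l)"
  shows "expectation (\<lambda>\<omega>. (iterated_ito M F f t \<psi> i k T \<omega>)\<^sup>2) = cube_integral t T k (\<lambda>x. (ordered_kernel \<psi> k x)\<^sup>2)"
proof -
  have "cube_integral t T k (\<lambda>x. (ordered_kernel \<psi> k x)\<^sup>2) = iterated_integral (\<lambda>l u. \<psi> l u * \<psi> l u) t k T"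
    by (rule cube_integral_eq_iterated_integral)
      (auto intro!: continuous_on_mult \<psi> t_le_T simp: ordered_kernel_def prod.distrib power2_eq_square)
  moreover have "expectation (\<lambda>\<omega>. iterated_ito M F f t \<psi> i k T \<omega> * iterated_ito M F f t \<psi> i k T \<omega>)
      = iterated_integral (\<lambda>l u. \<psi> l u * \<psi> l u) t k T"
    using iterated_ito_inner[OF t(1) t_le_T(2) i \<psi> i \<psi>] by simp
  ultimately show ?thesis by (simp add: power2_eq_square)
qed

end

theorem theorem2:
  fixes M :: "'a measure" and F :: "real \<Rightarrow> 'a measure"
    and f :: "nat \<Rightarrow> real \<Rightarrow> 'a \<Rightarrow> real"
    and t T :: real and m k p :: nat and i :: "nat \<Rightarrow> nat"
    and \<psi> \<phi> :: "nat \<Rightarrow> real \<Rightarrow> real" and \<tau> :: "nat \<Rightarrow> nat \<Rightarrow> real"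
  assumes "wiener_process M F T m f"
    and "0 \<le> t" and "t < T"
    and "1 \<le> k"
    and "\<forall>l\<in>{1..k}. i l \<in> {1..m}"
    and "\<forall>l\<in>{1..k}. continuous_on {t..T} (\<psi> l)"
    and "complete_orthonormal_system t T \<phi>"
    and "\<forall>j. continuous_on {t..T} (\<phi> j)"
    and "\<forall>N\<ge>1. partition_of t T N (\<tau> N)"
    and "(\<lambda>N. Max ((\<lambda>j. \<tau> N (Suc j) - \<tau> N j) ` {..<N})) \<longlonglongrightarrow> 0"
  shows "prob_space.expectation M
           (\<lambda>\<omega>. (iterated_ito M F f t \<psi> i k T \<omega> - J_approx M F f t T \<psi> \<phi> \<tau> k i p \<omega>)\<^sup>2)
         = cube_integral t T k (\<lambda>x. (ordered_kernel \<psi> k x)\<^sup>2)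
           - (\<Sum>j\<in>{1..k} \<rightarrow>\<^sub>E {0..p}. fourier_coeff \<psi> \<phi> t T k j *
                prob_space.expectation M
                  (\<lambda>\<omega>. iterated_ito M F f t \<psi> i k T \<omega> * perm_sum M F f t T \<phi> k i j \<omega>))
         \<and> prob_space.indep_vars M (\<lambda>_. borel) (\<lambda>(q, j). zeta M F f t T \<phi> q j) ({1..m} \<times> UNIV)
         \<and> (\<forall>q\<in>{1..m}. \<forall>j. distributed M lborel (zeta M F f t T \<phi> q j) std_normal_density)"
proof -
  interpret wiener_process M F T m f by fact
  \<comment> \<open>The partitions are given from \<open>N = 1\<close> on, so the sequence is used
    from there, with index \<open>Suc N\<close>.\<close>
  have mesh: "mesh_tendsto_0 Suc (\<lambda>N. \<tau> (Suc N))"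
    unfolding mesh_tendsto_0_def
  proof (intro allI impI)
    fix d :: real assume "d > 0"
    from LIMSEQ_D[OF assms(10) this] obtain N0 where
      N0: "\<And>N. N \<ge> N0 \<Longrightarrow> norm (Max ((\<lambda>j. \<tau> N (Suc j) - \<tau> N j) ` {..<N}) - 0) < d" by blast
    have "\<tau> (Suc N) (Suc j) - \<tau> (Suc N) j < d" if "N \<ge> N0" "j < Suc N" for N j
    proof -
      have "\<tau> (Suc N) (Suc j) - \<tau> (Suc N) j \<le> Max ((\<lambda>j. \<tau> (Suc N) (Suc j) - \<tau> (Suc N) j) ` {..<Suc N})"
        by (rule Max_ge) (use that in auto)
      also have "\<dots> < d" using N0[of "Suc N"] that by auto
      finally show ?thesis .
    qed
    then show "\<exists>N0. \<forall>N\<ge>N0. \<forall>j<Suc N. \<tau> (Suc N) (Suc j) - \<tau> (Suc N) j < d" by blast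
  qed
  \<comment> \<open>Continuity lets the Lebesgue integral in the orthonormality relation be read as
    a gauge integral.\<close>
  have orth: "integral {t..T} (\<lambda>s. \<phi> j s * \<phi> l s) = (if j = l then 1 else 0)" for j l
  proof -
    have "set_integrable lborel {t..T} (\<lambda>s. \<phi> j s * \<phi> l s)"
      using assms(8) by (intro borel_integrable_atLeastAtMost' continuous_on_mult) auto
    from set_borel_integral_eq_integral(2)[OF this] show ?thesis
      using assms(7) by (simp add: complete_orthonormal_system_def)
  qed
  interpret wiener_orthonormal M F T m f t \<phi> Suc "\<lambda>N. \<tau> (Suc N)"
    by standard (use assms orth mesh in auto)
  have i: "\<And>l. l \<in> {1..k} \<Longrightarrow> i l \<in> {1..m}" and \<psi>: "\<And>l. l \<in> {1..k} \<Longrightarrow> continuous_on {t..T} (\<psi> l)"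
    using assms by auto
  let ?P = "{1..k} \<rightarrow>\<^sub>E {0..p}" and ?J = "iterated_ito M F f t \<psi> i k T"
  let ?D = "perm_sum M F f t T \<phi> k i" and ?S = "S_term M f \<phi> \<tau> k i"
  let ?Z = "\<lambda>j \<omega>. \<Prod>l\<in>{1..k}. zeta M F f t T \<phi> (i l) (j l) \<omega>"
  have finP: "finite ?P" by (intro finite_PiE) auto
  have S: "has_ms_limit M (\<lambda>N \<omega>. \<Sum>l\<in>G_set k N. \<Prod>q\<in>{1..k}.
     \<phi> (j q) (\<tau> N (l q)) * (f (i q) (\<tau> N (Suc (l q))) \<omega> - f (i q) (\<tau> N (l q)) \<omega>)) (\<lambda>\<omega>. ?Z j \<omega> - ?D j \<omega>)" for j
  proof (rule has_ms_limit_SucI[OF off_diagonal_ms_limit[where i = i and k = k, OF i]])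
    \<comment> \<open>Since \<open>k\<close> is at least 1 there are no multi-indices with entries
      below 0; the term with index 0 is an empty sum and hence measurable.\<close>
    have "G_set k 0 = {}" using assms(4) by (auto simp: G_set_def H_set_def PiE_iff)
    then show "(\<lambda>\<omega>. \<Sum>l\<in>G_set k 0. \<Prod>q\<in>{1..k}. \<phi> (j q) (\<tau> 0 (l q)) *
        (f (i q) (\<tau> 0 (Suc (l q))) \<omega> - f (i q) (\<tau> 0 (l q)) \<omega>)) \<in> borel_measurable M" by simp
  qed
  have Sm: "?S j \<in> borel_measurable M" for j
    using has_ms_limit_ms_lim[OF S[of j]] by (simp add: S_term_def has_ms_limit_def)
  have SAE: "AE \<omega> in M. ?Z j \<omega> - ?D j \<omega> = ?S j \<omega>" for j
    unfolding S_term_def by (rule has_ms_limit_unique[OF S has_ms_limit_ms_lim[OF S]])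
  have Zm: "?Z j \<in> borel_measurable M" for j
    by (rule sq_integrable_measurable[OF prod_riemann_noise_ms_limit(2)[OF i]])
  have Dm: "?D j \<in> borel_measurable M" for j by (rule sq_integrable_measurable[OF sq_integrable_perm_sum[OF i]])
  have Jm: "?J \<in> borel_measurable M" by (rule sq_integrable_measurable[OF sq_integrable_iterated_ito[OF i \<psi>]])
  \<comment> \<open>Each \<open>S_term\<close> is a selected version, known only up to a null set;
    the finitely many multi-indices share one exceptional null set.\<close>
  have "AE \<omega> in M. \<forall>j\<in>?P. ?Z j \<omega> - ?D j \<omega> = ?S j \<omega>"
    using SAE by (intro AE_finite_allI finP)
  then have "AE \<omega> in M. J_approx M F f t T \<psi> \<phi> \<tau> k i p \<omega> = (\<Sum>j\<in>?P. fourier_coeff \<psi> \<phi> t T k j * ?D j \<omega>)"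
  proof eventually_elim
    case (elim \<omega>)
    have "?Z j \<omega> - ?S j \<omega> = ?D j \<omega>" if "j \<in> ?P" for j using bspec[OF elim that] by linarith
    then show ?case unfolding J_approx_def by (intro sum.cong[OF refl]) simp
  qed
  then have "expectation (\<lambda>\<omega>. (?J \<omega> - J_approx M F f t T \<psi> \<phi> \<tau> k i p \<omega>)\<^sup>2)
      = expectation (\<lambda>\<omega>. (?J \<omega> - (\<Sum>j\<in>?P. fourier_coeff \<psi> \<phi> t T k j * ?D j \<omega>))\<^sup>2)"
    unfolding J_approx_def[abs_def]
    by (intro integral_cong_AE borel_measurable_power borel_measurable_diff borel_measurable_sum
        borel_measurable_times borel_measurable_const Jm Zm Sm Dm) auto
  also have "\<dots> = expectation (\<lambda>\<omega>. (?J \<omega>)\<^sup>2)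
      - (\<Sum>j\<in>?P. fourier_coeff \<psi> \<phi> t T k j * expectation (\<lambda>\<omega>. ?J \<omega> * ?D j \<omega>))"
    by (rule perm_sum_expansion_error[OF i \<psi>])
  also have "expectation (\<lambda>\<omega>. (?J \<omega>)\<^sup>2) = cube_integral t T k (\<lambda>x. (ordered_kernel \<psi> k x)\<^sup>2)"
    by (rule expectation_iterated_ito_sq[OF i \<psi>])
  finally show ?thesis using zeta_indep zeta_distributed by blast
qed

end
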